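(* For every integer $m\ge 1$ there is a constant $C_m>0$, depending only on $m$, with the following property. Let $\mathcal{P}=\{P_1,\dots,P_m\}$ be a relatively curved collection of polynomials such that $\mathbf{P}(\mathcal{P})$ holds, with Sobolev gain $\sigma_{\mathcal{P}}$. Let $a_{\mathcal{P}}>0$ and $c_{\mathcal{P}}>0$ be such that $$c_{\mathcal{P}}\le C_m\,\sigma_{\mathcal{P}}\,a_{\mathcal{P}}^{10m}$$ and $c_{\mathcal{P}}$ is sufficiently small in terms of $\mathcal{P}$ (and the constants $\sigma_{\mathcal P}, C_{\mathcal P}$ in $\mathbf{P}(\mathcal{P})$). Let $A\subset[0,1]$ be a compact set whose Hausdorff content satisfies $$H^s_\infty(A)\ge a_{\mathcal{P}}>0\quad\text{for some } s>1-c_{\mathcal{P}}.$$ Then there exist $x,t\in[0,1]$ with $t\ne 0$ such that $$\{x,\;x-P_1(t),\;x-P_2(t),\dots,x-P_m(t)\}\subset A.$$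
   Context: Let $\mathcal{P}=\{P_1,\dots,P_m\}$ be a collection of real polynomials vanishing at the origin, written $P_k(t)=\sum_{n=e_k}^{d_k}a_{k,n}t^n$ with $1\le e_k\le d_k$ and $a_{k,e_k}\neq0$, so that $e_k$ is the order of vanishing of $P_k$ at $0$. The collection $\mathcal{P}$ is called relatively curved if the exponents $e_1,\dots,e_m$ are pairwise distinct. The statement $\mathbf{P}(\mathcal{P})$ means: there are constants $0<\sigma_{\mathcal{P}}<C_{\mathcal{P}}<\infty$ such that for all $l\ge C_{\mathcal{P}}$, all $N>0$ and all functions $f_1,\dots,f_m\in L^m(\mathbb{R})$ for which at least one index $i$ has $\widehat{f_i}$ vanishing on $\{|\xi|\le N\cdot 2^{l e_i}\}$, one has $$\Big\|\int_0^1\prod_{i=1}^m f_i\big(x-P_i(2^{-l}t)\big)\,dt\Big\|_{L^1_x(\mathbb{R})}\le C_{\mathcal{P}}\,N^{-\sigma_{\mathcal{P}}}\prod_{i=1}^m\|f_i\|_{L^m(\mathbb{R})}.$$ The constant $\sigma_{\mathcal{P}}$ is called the Sobolev gain. The $s$-dimensional Hausdorff content is $H^s_\infty(A)=\inf\{\sum_j \operatorname{diam}(U_j)^s : A\subset\bigcup_j U_j\}$, the infimum being over countable covers. *)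

theory Defs
  imports "HOL-Analysis.Analysis" "HOL-Computational_Algebra.Polynomial"
begin

definition in_Lp :: "real \<Rightarrow> (real \<Rightarrow> complex) \<Rightarrow> bool" where
  "in_Lp p f \<longleftrightarrow> f \<in> borel_measurable lborel \<and> integrable lborel (\<lambda>x. norm (f x) powr p)"

definition Lp_norm :: "real \<Rightarrow> (real \<Rightarrow> complex) \<Rightarrow> real" where
  "Lp_norm p f = (LINT x|lborel. norm (f x) powr p) powr (1 / p)"

definition fourier_transform :: "(real \<Rightarrow> complex) \<Rightarrow> real \<Rightarrow> complex" where
  "fourier_transform \<phi> x = (LINT y|lborel. cis (- 2 * pi * x * y) * \<phi> y)"

text \<open>Complex-valued smooth functions whose compact support is contained in \<open>S\<close>;
  \<open>D n\<close> is the \<open>n\<close>-th derivative of \<open>\<phi>\<close>.\<close>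

definition test_function_on :: "real set \<Rightarrow> (real \<Rightarrow> complex) \<Rightarrow> bool" where
  "test_function_on S \<phi> \<longleftrightarrow>
     (\<exists>D :: nat \<Rightarrow> real \<Rightarrow> complex. D 0 = \<phi> \<and>
        (\<forall>n x. (D n has_vector_derivative D (Suc n) x) (at x))) \<and>
     compact (closure {y. \<phi> y \<noteq> 0}) \<and> closure {y. \<phi> y \<noteq> 0} \<subseteq> S"

text \<open>For \<open>f\<close> in \<open>L\<^sup>p\<close> with \<open>p > 2\<close> the Fourier transform is in general only a tempered
  distribution, acting on a test function \<open>\<phi>\<close> by integrating \<open>f\<close> against the Fourier transform
  of \<open>\<phi>\<close> (a Schwartz function, so that the product is integrable). Vanishing is therefore
  understood in the sense of distributions. When \<open>S\<close> is a closed interval of positive length,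
  this agrees for \<open>p = 1\<close> with pointwise and for \<open>p = 2\<close> with almost everywhere vanishing
  on \<open>S\<close>.\<close>

definition fourier_vanishes_on :: "(real \<Rightarrow> complex) \<Rightarrow> real set \<Rightarrow> bool" where
  "fourier_vanishes_on f S \<longleftrightarrow>
     (\<forall>\<phi>. test_function_on S \<phi> \<longrightarrow> (LINT x|lborel. f x * fourier_transform \<phi> x) = 0)"

text \<open>The collection is the family \<open>P 1, \<dots>, P m\<close>; the exponent \<open>e\<^sub>k\<close> is \<open>order 0 (P k)\<close>.\<close>

definition relatively_curved :: "nat \<Rightarrow> (nat \<Rightarrow> real poly) \<Rightarrow> bool" where
  "relatively_curved m P \<longleftrightarrow>
     (\<forall>k\<in>{1..m}. P k \<noteq> 0 \<and> poly (P k) 0 = 0) \<and>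
     inj_on (\<lambda>k. order 0 (P k)) {1..m}"

text \<open>The estimate \<open>\<^bold>P(P)\<close> with given constants: \<open>\<sigma>\<close> is the Sobolev gain. By Hoelder and Tonelli
  the inner integral converges absolutely for almost every \<open>x\<close>. The outer \<open>L\<^sup>1\<close> norm is written as
  a nonnegative integral, so that the inequality includes its finiteness.\<close>

definition sobolev_estimate :: "nat \<Rightarrow> (nat \<Rightarrow> real poly) \<Rightarrow> real \<Rightarrow> real \<Rightarrow> bool" where
  "sobolev_estimate m P \<sigma> C \<longleftrightarrow> 0 < \<sigma> \<and> \<sigma> < C \<and>
     (\<forall>(l::nat) (N::real) (f :: nat \<Rightarrow> real \<Rightarrow> complex).
        real l \<ge> C \<longrightarrow> N > 0 \<longrightarrow>
        (\<forall>i\<in>{1..m}. in_Lp (real m) (f i)) \<longrightarrow>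
        (\<exists>i\<in>{1..m}. fourier_vanishes_on (f i) {\<xi>. \<bar>\<xi>\<bar> \<le> N * 2 ^ (l * order 0 (P i))}) \<longrightarrow>
        (\<integral>\<^sup>+x. norm (LINT t:{0..1}|lborel. (\<Prod>i=1..m. f i (x - poly (P i) (t / 2 ^ l)))) \<partial>lborel)
          \<le> ennreal (C * N powr (- \<sigma>) * (\<Prod>i=1..m. Lp_norm (real m) (f i))))"

text \<open>Covers are indexed by \<open>nat\<close>; empty members have diameter \<open>0\<close> and contribute nothing, so
  finite covers are included. Only bounded members are allowed because \<open>diameter\<close> is
  meaningful only for bounded sets; an unbounded one would contribute \<open>\<infinity>\<close>.
  The definition is meant for \<open>s > 0\<close> (note \<open>0 powr 0 = 0\<close>).\<close>

definition hausdorff_content :: "real \<Rightarrow> real set \<Rightarrow> ennreal" where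
  "hausdorff_content s A =
     (INF U \<in> {U :: nat \<Rightarrow> real set. (\<forall>j. bounded (U j)) \<and> A \<subseteq> (\<Union>j. U j)}.
        (\<Sum>j. ennreal (diameter (U j) powr s)))"

end

theory Submission
  imports Defs "HOL-Probability.Sinc_Integral" "HOL-Real_Asymp.Real_Asymp"
begin

text \<open>The max-flow/min-cut form of Frostman's lemma on the dyadic tree of depth \<open>K\<close> gives dyadic masses
  on \<open>A\<close> of total at least \<open>a\<close>; their densities \<open>dens k\<close> form a martingale with
  \<open>dens k \<le> 2 powr (c * k)\<close>, so up to level about \<open>1 / c\<close> they are bounded by \<open>2\<close>. Let \<open>form l\<close> be
  the counting form of the pattern with \<open>t\<close> rescaled by \<open>2\<^sup>-\<^sup>l\<close>. The Sobolev estimate allows one to replace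
  the \<open>i\<close>-th density by a coarser one as long as its level exceeds \<open>l * e\<^sub>i\<close> by some \<open>R\<close>. Doing this along
  the levels \<open>2\<^sup>j * k\<close> costs a geometric series because \<open>c\<close> is tiny compared with the gain, and brings all
  densities down to bounded ones. An energy pigeonhole over \<open>J\<close> scales \<open>l\<close> finds one at which the
  martingale hardly changes between the levels \<open>l * e\<^sub>i + R\<close> and \<open>l * e\<^sub>i - R\<close>; densities of level
  \<open>l * e\<^sub>i - R\<close> do not feel the shift by \<open>P\<^sub>i(2\<^sup>-\<^sup>l t)\<close>, and the unshifted form is bounded below by a power
  of \<open>a\<close>. Subtracting the contribution of \<open>t \<le> 2\<^sup>-\<^sup>R\<close>, which is a multiple of \<open>form (l + R)\<close>, leaves a
  pattern near \<open>A\<close> with \<open>t\<close> bounded below uniformly in \<open>K\<close>, and compactness finishes.\<close>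

section \<open>A de la Vallee-Poussin kernel\<close>

text \<open>The hypothesis rewards functions whose Fourier transform vanishes near 0, whereas
  martingale differences of dyadic densities only have mean zero on cells. The bridge is a kernel
  whose Fourier transform is 1 on an interval; only its L1 norm and its L1 modulus of continuity are
  measured, so a combination of two Fejer kernels, with explicit integrals, suffices. The unshifted
  factor \<open>g0\<close> plays the dual function for the L1 norm and enjoys no Fourier gain. Along
  the doublings it is therefore kept at twice the level of the other factors: they are nearly
  constant on its cells, and its own level can be lowered by cancellation alone. The exponent
  \<open>10 * m\<close> enters at the very end. The argument wants \<open>R\<close> of order
  \<open>1 / a\<close> and \<open>J\<close> of order \<open>1 / a ^ (2 * m + 2)\<close>, hence
  \<open>c\<close> below \<open>a ^ (2 * m + 3)\<close> times a factor depending on the polynomials.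
  Multiplying the bounds \<open>c \<le> \<sigma> * a ^ (10 * m)\<close> and
  \<open>c \<le> c0\<close> gives this for the square of \<open>c\<close>, since
  \<open>10 * m\<close> is at least \<open>4 * m + 6\<close>; so \<open>Cm = 1\<close>
  works.\<close>

lemma abs_cos_diff_le: "\<bar>cos x - cos y\<bar> \<le> \<bar>x - y\<bar>" for x y :: real
proof -
  have "\<bar>sin ((x + y) / 2)\<bar> * \<bar>sin ((y - x) / 2)\<bar> \<le> 1 * \<bar>(y - x) / 2\<bar>"
    by (intro mult_mono abs_sin_le_one abs_sin_x_le_abs_x) auto
  then show ?thesis unfolding cos_diff_cos abs_mult by simp
qed

text \<open>Away from 0 this is (1 - cos y) / y^2. The integral form has no removable singularity,
  so the bound 1/2, the Lipschitz constant 1 and thereby continuity follow by estimating the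
  integrand.\<close>

definition fejer :: "real \<Rightarrow> real" where
  "fejer y = integral {0..1} (\<lambda>t. (1 - t) * cos (t * y))"

lemma fejer_integrable: "(\<lambda>t. (1 - t) * cos (t * y)) integrable_on {0..1::real}"
  by (intro integrable_continuous_real continuous_intros)

lemma fejer_0: "fejer 0 = 1/2"
proof -
  have "((\<lambda>t::real. (1 - t) * cos (t * 0)) has_integral ((1 - 1^2/2) - (0 - 0^2/2))) {0..1}"
    by (rule fundamental_theorem_of_calculus)
       (auto simp flip: has_real_derivative_iff_has_vector_derivative intro!: derivative_eq_intros)
  then show ?thesis by (simp add: fejer_def integral_unique)
qed

lemma fejer_nonzero: "y \<noteq> 0 \<Longrightarrow> fejer y = (1 - cos y) / y\<^sup>2"
proof -
  assume y: "y \<noteq> 0"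
  have "((\<lambda>t. (1 - t) * cos (t * y)) has_integral
      (((1 - 1) * sin (1 * y) / y - cos (1 * y) / y\<^sup>2) - ((1 - 0) * sin (0 * y) / y - cos (0 * y) / y\<^sup>2))) {0..1}"
    by (rule fundamental_theorem_of_calculus)
       (auto simp flip: has_real_derivative_iff_has_vector_derivative
         intro!: derivative_eq_intros simp: y field_simps power2_eq_square)
  then show ?thesis by (simp add: fejer_def integral_unique diff_divide_distrib)
qed

lemma fejer_mult_sq: "y\<^sup>2 * fejer y = 1 - cos y"
  by (cases "y = 0") (auto simp: fejer_nonzero)

lemma fejer_even: "fejer (- y) = fejer y"
  by (simp add: fejer_def)

lemma fejer_nonneg: "0 \<le> fejer y"
  by (cases "y = 0") (auto simp: fejer_nonzero fejer_0)

lemma fejer_le_half: "fejer y \<le> 1/2"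
proof -
  have "fejer y \<le> fejer 0"
    unfolding fejer_def by (intro integral_le fejer_integrable) (auto intro: mult_left_le)
  then show ?thesis by (simp add: fejer_0)
qed

lemma fejer_lipschitz: "\<bar>fejer x - fejer y\<bar> \<le> \<bar>x - y\<bar>"
proof -
  have "fejer x - fejer y = integral {0..1} (\<lambda>t. (1 - t) * cos (t * x) - (1 - t) * cos (t * y))"
    unfolding fejer_def by (rule integral_diff [symmetric]) (rule fejer_integrable)+
  moreover have "norm (integral {0..1} (\<lambda>t. (1 - t) * cos (t * x) - (1 - t) * cos (t * y)))
      \<le> \<bar>x - y\<bar> * (1 - 0)"
  proof (rule integral_bound)
    fix t :: real assume t: "t \<in> {0..1}"
    have "\<bar>cos (t * x) - cos (t * y)\<bar> \<le> \<bar>t * x - t * y\<bar>"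
      by (rule abs_cos_diff_le)
    also have "\<dots> = t * \<bar>x - y\<bar>" using t by (simp add: right_diff_distrib [symmetric] abs_mult)
    also have "\<dots> \<le> \<bar>x - y\<bar>" using t by (simp add: mult_left_le_one_le)
    finally have "\<bar>cos (t * x) - cos (t * y)\<bar> \<le> \<bar>x - y\<bar>" .
    then have "(1 - t) * \<bar>cos (t * x) - cos (t * y)\<bar> \<le> 1 * \<bar>x - y\<bar>"
      using t by (intro mult_mono) auto
    then show "norm ((1 - t) * cos (t * x) - (1 - t) * cos (t * y)) \<le> \<bar>x - y\<bar>"
      using t by (simp add: right_diff_distrib [symmetric] abs_mult)
  qed (auto intro!: continuous_intros)
  ultimately show ?thesis by simp
qed

lemma continuous_fejer: "isCont fejer x"
proof -
  have "(\<lambda>y. \<bar>y - x\<bar>) \<midarrow>x\<rightarrow> 0" by real_asymp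
  then have "(\<lambda>y. fejer y - fejer x) \<midarrow>x\<rightarrow> 0"
    by (rule tendsto_0_le[where K=1]) (auto intro!: always_eventually fejer_lipschitz)
  then show ?thesis by (simp add: isCont_def LIM_zero_iff)
qed

lemma borel_measurable_fejer [measurable]: "fejer \<in> borel_measurable borel"
  by (intro borel_measurable_continuous_onI continuous_at_imp_continuous_on ballI continuous_fejer)

text \<open>Differentiating \<open>Si y - (1 - cos y) / y\<close> cancels two copies of
  \<open>sin y / y\<close> and leaves (1 - cos y) / y^2. Writing the subtracted term as
  \<open>y * fejer y\<close> covers the point 0, where its difference quotient is
  \<open>fejer y\<close> itself.\<close>

lemma fejer_primitive:
  "((\<lambda>y. Si y - y * fejer y) has_real_derivative fejer x) (at x)"
proof (cases "x = 0")
  case True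
  have "((\<lambda>y. y * fejer y) has_real_derivative fejer 0) (at 0)"
    unfolding has_field_derivative_iff
  proof (rule Lim_transform_eventually)
    show "fejer \<midarrow>0\<rightarrow> fejer 0" using continuous_fejer[of 0] by (simp add: isCont_def)
  qed (simp add: eventually_at_filter)
  from DERIV_diff[OF DERIV_Si[of 0] this] True show ?thesis
    by (simp add: fejer_0)
next
  case False
  have "((\<lambda>y. Si y - (1 - cos y) / y) has_real_derivative fejer x) (at x)"
    using False DERIV_Si[of x]
    by (auto intro!: derivative_eq_intros simp: fejer_nonzero field_simps power2_eq_square)
  moreover have "\<forall>\<^sub>F y in nhds x. Si y - (1 - cos y) / y = Si y - y * fejer y"
    using t1_space_nhds[OF False] by eventually_elim (auto simp: fejer_nonzero power2_eq_square)
  ultimately show ?thesis using DERIV_cong_ev[OF refl, of "\<lambda>y. Si y - (1 - cos y) / y" "\<lambda>y. Si y - y * fejer y" x] by simp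
qed

lemma fejer_integral: "has_bochner_integral lborel fejer pi"
proof -
  have lim: "((\<lambda>y. Si y - y * fejer y) \<longlongrightarrow> pi / 2 - 0) at_top"
  proof (intro tendsto_diff Si_at_top)
    have "((\<lambda>y::real. 2 / y) \<longlongrightarrow> 0) at_top" by real_asymp
    then show "((\<lambda>y. y * fejer y) \<longlongrightarrow> 0) at_top"
    proof (rule tendsto_0_le[where K=1])
      show "\<forall>\<^sub>F y in at_top. norm (y * fejer y) \<le> norm (2 / y) * 1"
        using eventually_gt_at_top[of "0::real"]
        by eventually_elim (auto simp: fejer_nonzero power2_eq_square divide_right_mono)
    qed
  qed
  have "(\<integral>\<^sup>+x. ennreal (fejer x) * indicator {0..} x \<partial>lborel) = ennreal (pi/2 - 0 - (Si 0 - 0 * fejer 0))"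
    by (rule nn_integral_FTC_atLeast) (auto intro: fejer_primitive fejer_nonneg lim[simplified])
  also have "Si 0 = 0" by (simp add: Si_def interval_lebesgue_integral_def zero_ereal_def set_lebesgue_integral_def)
  finally have "(\<integral>\<^sup>+x. ennreal (indicator {0..} x *\<^sub>R fejer x) \<partial>lborel) = ennreal (pi/2)"
    by (subst (asm) nn_integral_cong[where v="\<lambda>x. ennreal (indicator {0..} x *\<^sub>R fejer x)"])
       (auto simp: indicator_def)
  then have "has_bochner_integral lborel (\<lambda>x. indicator {0..} x *\<^sub>R fejer x) (pi/2)"
    by (intro has_bochner_integral_nn_integral) (auto intro!: AE_I2 simp: fejer_nonneg)
  then have "has_bochner_integral lborel fejer (2 *\<^sub>R (pi/2))"
    by (intro has_bochner_integral_even_function fejer_even) auto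
  then show ?thesis by simp
qed

lemma fejer_scaled_integral:
  "has_bochner_integral lborel (\<lambda>y. b\<^sup>2 * fejer (b * y)) (pi * \<bar>b\<bar>)"
proof (cases "b = 0")
  case False
  have "has_bochner_integral lborel (\<lambda>y. fejer (0 + b * y)) (pi /\<^sub>R \<bar>b\<bar>)"
    using fejer_integral False lborel_has_bochner_integral_real_affine_iff[of b fejer pi 0] by simp
  from has_bochner_integral_mult_right[OF this, of "b\<^sup>2"]
  have "has_bochner_integral lborel (\<lambda>y. b\<^sup>2 * fejer (b * y)) (b\<^sup>2 * (pi /\<^sub>R \<bar>b\<bar>))"
    by (simp only: add_0)
  moreover have "b\<^sup>2 * (pi /\<^sub>R \<bar>b\<bar>) = pi * \<bar>b\<bar>"
    using False by (simp add: divide_simps power2_eq_square)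
  ultimately show ?thesis by (simp only:)
qed auto

text \<open>By the product formula for cosines the integrand is half the kernel b^2 fejer(b y) taken
  at 1 + b, plus half of it at 1 - b, minus its value at b. These kernels have integral pi * |b|,
  and this second difference of the absolute value is the tent function.\<close>

lemma fejer_cos_integral:
  "has_bochner_integral lborel (\<lambda>y. fejer y * cos (b * y)) (pi * max 0 (1 - \<bar>b\<bar>))"
proof -
  have eq: "fejer y * cos (b * y) = (1/2) * ((1+b)\<^sup>2 * fejer ((1+b)*y)) + (1/2) * ((1-b)\<^sup>2 * fejer ((1-b)*y)) - b\<^sup>2 * fejer (b*y)"
    (is "?l = ?r") for y
  proof (cases "y = 0")
    case True then show ?thesis by (simp add: fejer_0 power2_eq_square field_simps)
  next
    case False
    have "y\<^sup>2 * ?l = (1 - cos y) * cos (b * y)"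
      using fejer_mult_sq[of y] by (simp add: mult.assoc[symmetric])
    also have "\<dots> = (1/2) * (1 - cos ((1+b)*y)) + (1/2) * (1 - cos ((1-b)*y)) - (1 - cos (b*y))"
      by (simp add: distrib_right left_diff_distrib cos_add cos_diff field_simps)
    also have "\<dots> = y\<^sup>2 * ?r"
      using fejer_mult_sq[of "(1+b)*y"] fejer_mult_sq[of "(1-b)*y"] fejer_mult_sq[of "b*y"]
      by (simp only: power_mult_distrib) (simp add: algebra_simps)
    finally show ?thesis using False by simp
  qed
  have "has_bochner_integral lborel (\<lambda>y. fejer y * cos (b * y))
     ((1/2) * (pi * \<bar>1+b\<bar>) + (1/2) * (pi * \<bar>1-b\<bar>) - pi * \<bar>b\<bar>)"
    unfolding eq by (intro has_bochner_integral_diff has_bochner_integral_add has_bochner_integral_mult_right fejer_scaled_integral)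
  moreover have m: "(1/2) * \<bar>1+b\<bar> + (1/2) * \<bar>1-b\<bar> - \<bar>b\<bar> = max 0 (1 - \<bar>b\<bar>)"
    by (auto simp: max_def abs_if field_simps)
  then have "(1/2) * (pi * \<bar>1+b\<bar>) + (1/2) * (pi * \<bar>1-b\<bar>) - pi * \<bar>b\<bar> = pi * max 0 (1 - \<bar>b\<bar>)"
    by (simp add: algebra_simps flip: m)
  ultimately show ?thesis by (simp only:)
qed

lemma fejer_fourier: "has_bochner_integral lborel (\<lambda>y. fejer y * cis (b * y)) (of_real (pi * max 0 (1 - \<bar>b\<bar>)))"
proof -
  have i: "integrable lborel (\<lambda>y. fejer y * sin (b * y))"
    by (rule Bochner_Integration.integrable_bound[OF integrable.intros[OF fejer_integral]])
       (auto simp: abs_mult fejer_nonneg mult_left_le)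
  have z: "(LINT y|lborel. fejer y * sin (b * y)) = 0"
    using lborel_integral_real_affine[of "-1" "\<lambda>y. fejer y * sin (b * y)" 0] by (simp add: fejer_even)
  have s: "has_bochner_integral lborel (\<lambda>y. fejer y * sin (b * y)) 0"
    using i z by (simp add: has_bochner_integral_iff)
  have "has_bochner_integral lborel (\<lambda>y. of_real (fejer y * cos (b * y)) + \<i> * of_real (fejer y * sin (b * y)))
      (of_real (pi * max 0 (1 - \<bar>b\<bar>)) + \<i> * of_real 0)"
    by (intro has_bochner_integral_add has_bochner_integral_mult_right has_bochner_integral_of_real fejer_cos_integral s)
  then show ?thesis
    by (simp add: cis_conv_exp exp_Euler algebra_simps flip: cos_of_real sin_of_real)
qed

section \<open>The L1 modulus of continuity of the Fejer kernel\<close>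

lemma has_bochner_integral_inverse_1_plus_square:
  "has_bochner_integral lborel (\<lambda>x::real. inverse (1 + x\<^sup>2)) pi"
  using integrable_inverse_1_plus_square LBINT_inverse_1_plus_square
  by (simp add: has_bochner_integral_iff interval_lebesgue_integral_def set_lebesgue_integral_def set_integrable_def einterval_def)

text \<open>An integrable majorant linear in \<open>u\<close>: the Lipschitz bound serves near 0,
  the quadratic decay elsewhere. The constant 14 comes from the far case, where 11 / x^2 has to be
  dominated for x^2 at least 4.\<close>

lemma fejer_modulus_small:
  assumes "\<bar>u\<bar> \<le> 1"
  shows "\<bar>fejer x - fejer (x - u)\<bar> \<le> 14 * \<bar>u\<bar> * inverse (1 + x\<^sup>2)"
proof (cases "\<bar>x\<bar> < 2")
  case True
  then have "x\<^sup>2 \<le> 2\<^sup>2" by (subst abs_le_square_iff [symmetric]) auto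
  then have "1 + x\<^sup>2 \<le> 14" by simp
  then have "1 \<le> 14 * inverse (1 + x\<^sup>2)" by (simp add: field_simps add_pos_nonneg)
  then have "\<bar>u\<bar> * 1 \<le> \<bar>u\<bar> * (14 * inverse (1 + x\<^sup>2))" by (intro mult_left_mono) auto
  then show ?thesis using fejer_lipschitz[of x "x - u"] by simp
next
  case False
  then have x: "x \<noteq> 0" "\<bar>x\<bar> \<ge> 2" by auto
  let ?z = "x - u"
  have z: "\<bar>?z\<bar> \<ge> \<bar>x\<bar>/2" "?z \<noteq> 0" "\<bar>x + ?z\<bar> \<le> 5/2 * \<bar>x\<bar>" using x assms by linarith+
  have cosd: "\<bar>cos ?z - cos x\<bar> \<le> \<bar>u\<bar>" using abs_cos_diff_le[of ?z x] by simp
  \<comment> \<open>First the numerator is changed, then the denominator; the difference of the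
    inverse squares contains the factor \<open>?z - x = - u\<close>.\<close>
  have eq: "fejer x - fejer ?z = (cos ?z - cos x) / x\<^sup>2 + (1 - cos ?z) * (- u * (x + ?z)) / (x\<^sup>2 * ?z\<^sup>2)"
    using x z(2) by (simp add: fejer_nonzero divide_simps) (simp add: power2_eq_square algebra_simps)
  have zs: "x\<^sup>2 / 4 \<le> ?z\<^sup>2"
    using power_mono[OF z(1), of 2] by (simp add: power_divide)
  have "\<bar>1 - cos ?z\<bar> \<le> 2" using cos_ge_minus_one[of ?z] cos_le_one[of ?z] by linarith
  then have n: "\<bar>(1 - cos ?z) * (- u * (x + ?z))\<bar> \<le> 2 * (\<bar>u\<bar> * (5/2 * \<bar>x\<bar>))"
    unfolding abs_mult abs_minus_cancel using z(3) by (intro mult_mono) auto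
  have "\<bar>(1 - cos ?z) * (- u * (x + ?z)) / (x\<^sup>2 * ?z\<^sup>2)\<bar> \<le> (2 * (\<bar>u\<bar> * (5/2 * \<bar>x\<bar>))) / (x\<^sup>2 * (x\<^sup>2/4))"
    unfolding abs_divide abs_mult[of "x\<^sup>2"] using n zs x by (intro frac_le mult_mono mult_pos_pos) auto
  also have "\<dots> = (20 / \<bar>x\<bar>) * (\<bar>u\<bar> / x\<^sup>2)" using x by (simp add: divide_simps) (simp add: power2_eq_square power4_eq_xxxx)
  also have "\<dots> \<le> 10 * (\<bar>u\<bar> / x\<^sup>2)" using x by (intro mult_right_mono) (auto simp: divide_simps)
  finally have b2: "\<bar>(1 - cos ?z) * (- u * (x + ?z)) / (x\<^sup>2 * ?z\<^sup>2)\<bar> \<le> 10 * (\<bar>u\<bar> / x\<^sup>2)" .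
  have "\<bar>(cos ?z - cos x) / x\<^sup>2\<bar> \<le> \<bar>u\<bar> / x\<^sup>2"
    unfolding abs_divide using cosd by (simp add: divide_right_mono)
  then have "\<bar>fejer x - fejer ?z\<bar> \<le> 11 * (\<bar>u\<bar> / x\<^sup>2)" unfolding eq using b2 by linarith
  also have "\<dots> = \<bar>u\<bar> * (11 / x\<^sup>2)" by simp
  also have "\<dots> \<le> \<bar>u\<bar> * (14 * inverse (1 + x\<^sup>2))"
  proof (intro mult_left_mono)
    have "2\<^sup>2 \<le> x\<^sup>2" using x by (subst abs_le_square_iff [symmetric]) auto
    then show "11 / x\<^sup>2 \<le> 14 * inverse (1 + x\<^sup>2)" using x(1) by (simp add: divide_simps add_pos_nonneg)
  qed auto
  finally show ?thesis by simp
qed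

lemma integrable_fejer_affine:
  assumes "c \<noteq> 0" shows "integrable lborel (\<lambda>x. fejer (t + c * x))"
  using assms lborel_integrable_real_affine[OF integrable.intros[OF fejer_integral]] by blast

lemma integral_fejer_modulus:
  "(LINT x|lborel. \<bar>fejer x - fejer (x - u)\<bar>) \<le> 14 * pi * \<bar>u\<bar>"
proof -
  have i1: "integrable lborel fejer" by (rule integrable.intros[OF fejer_integral])
  have i2: "integrable lborel (\<lambda>x. fejer (x - u))"
    using integrable_fejer_affine[of 1 "- u"] by simp
  show ?thesis
  proof (cases "\<bar>u\<bar> \<le> 1")
    case True
    have "(LINT x|lborel. \<bar>fejer x - fejer (x - u)\<bar>) \<le> (LINT x|lborel. 14 * \<bar>u\<bar> * inverse (1 + x\<^sup>2))"
      using i1 i2 integrable.intros[OF has_bochner_integral_inverse_1_plus_square]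
      by (intro integral_mono fejer_modulus_small True) auto
    also have "\<dots> = 14 * \<bar>u\<bar> * pi"
      using has_bochner_integral_integral_eq[OF has_bochner_integral_inverse_1_plus_square] by simp
    finally show ?thesis by (simp add: mult_ac)
  next
    case False
    have "(LINT x|lborel. \<bar>fejer x - fejer (x - u)\<bar>) \<le> (LINT x|lborel. fejer x + fejer (x - u))"
      using i1 i2 by (intro integral_mono) (auto simp: abs_le_iff fejer_nonneg add_increasing add_increasing2)
    also have "\<dots> = pi + pi"
      using i1 i2 has_bochner_integral_integral_eq[OF fejer_integral]
        lborel_integral_real_affine[of 1 fejer "- u"] by simp
    also have "\<dots> \<le> 14 * pi * 1" by simp
    also have "\<dots> \<le> 14 * pi * \<bar>u\<bar>" using False by (intro mult_left_mono) auto
    finally show ?thesis .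
  qed
qed

section \<open>The de la Vallee-Poussin combination: L1 bounds and Fourier transform\<close>

text \<open>The weights make the Fourier transform a tent of height 2 and half-width 2 minus a tent
  of height 1 and half-width 1: a trapezoid equal to 1 on [-1, 1].\<close>

definition vallee_poussin :: "real \<Rightarrow> real" where
  "vallee_poussin x = 8 * fejer (4 * pi * x) - 2 * fejer (2 * pi * x)"

lemma integrable_vallee_poussin [simp]: "integrable lborel vallee_poussin"
  unfolding vallee_poussin_def
  using integrable_fejer_affine[of "4*pi" 0] integrable_fejer_affine[of "2*pi" 0] by simp

lemma borel_measurable_vallee_poussin [measurable]: "vallee_poussin \<in> borel_measurable borel"
  unfolding vallee_poussin_def by measurable

lemma integral_abs_vallee_poussin: "(LINT x|lborel. \<bar>vallee_poussin x\<bar>) \<le> 3"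
proof -
  have i: "integrable lborel (\<lambda>x. fejer (4 * pi * x))" "integrable lborel (\<lambda>x. fejer (2 * pi * x))"
    using integrable_fejer_affine[of "4*pi" 0] integrable_fejer_affine[of "2*pi" 0] by simp_all
  have "(LINT x|lborel. \<bar>vallee_poussin x\<bar>) \<le> (LINT x|lborel. 8 * fejer (4 * pi * x) + 2 * fejer (2 * pi * x))"
  proof (intro integral_mono)
    fix x show "\<bar>vallee_poussin x\<bar> \<le> 8 * fejer (4 * pi * x) + 2 * fejer (2 * pi * x)"
      using fejer_nonneg[of "4 * pi * x"] fejer_nonneg[of "2 * pi * x"] unfolding vallee_poussin_def by linarith
  qed (use i in auto)
  also have "\<dots> = 3"
    using i has_bochner_integral_integral_eq[OF fejer_integral]
      lborel_integral_real_affine[of "4*pi" fejer 0] lborel_integral_real_affine[of "2*pi" fejer 0]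
    by (simp add: field_simps)
  finally show ?thesis .
qed

text \<open>Dilating a kernel by \<open>c\<close> divides its L1 norm by \<open>c\<close> but
  multiplies the shift by \<open>c\<close>, so the modulus bound
  \<open>14 * pi * \<bar>u\<bar>\<close> is unchanged; the weights 8 and 2 give the factor
  10.\<close>

lemma integral_vallee_poussin_modulus:
  "(LINT x|lborel. \<bar>vallee_poussin x - vallee_poussin (x - u)\<bar>) \<le> 140 * pi * \<bar>u\<bar>"
proof -
  have i: "integrable lborel (\<lambda>x. \<bar>fejer (c * x) - fejer (c * x - c * u)\<bar>)"
    and e: "(LINT x|lborel. \<bar>fejer (c * x) - fejer (c * x - c * u)\<bar>) \<le> 14 * pi * \<bar>u\<bar>" if "c > 0" for c
  proof -
    show "integrable lborel (\<lambda>x. \<bar>fejer (c * x) - fejer (c * x - c * u)\<bar>)"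
      using integrable_fejer_affine[of c 0] integrable_fejer_affine[of c "- c * u"] that by simp
    have "(LINT x|lborel. \<bar>fejer x - fejer (x - c * u)\<bar>) = c * (LINT x|lborel. \<bar>fejer (c * x) - fejer (c * x - c * u)\<bar>)"
      using lborel_integral_real_affine[of c "\<lambda>x. \<bar>fejer x - fejer (x - c * u)\<bar>" 0] that by simp
    then have "c * (LINT x|lborel. \<bar>fejer (c * x) - fejer (c * x - c * u)\<bar>) \<le> c * (14 * pi * \<bar>u\<bar>)"
      using integral_fejer_modulus[of "c * u"] that by (simp add: abs_mult mult_ac)
    then show "(LINT x|lborel. \<bar>fejer (c * x) - fejer (c * x - c * u)\<bar>) \<le> 14 * pi * \<bar>u\<bar>"
      using that by simp
  qed
  have p: "4 * pi > 0" "2 * pi > 0" by simp_all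
  have iv: "integrable lborel (\<lambda>x. vallee_poussin (x - u))"
    using lborel_integrable_real_affine[OF integrable_vallee_poussin, of 1 "- u"] by simp
  have "(LINT x|lborel. \<bar>vallee_poussin x - vallee_poussin (x - u)\<bar>)
    \<le> (LINT x|lborel. 8 * \<bar>fejer (4*pi * x) - fejer (4*pi * x - 4*pi * u)\<bar> + 2 * \<bar>fejer (2*pi * x) - fejer (2*pi * x - 2*pi * u)\<bar>)"
  proof (intro integral_mono)
    fix x
    show "\<bar>vallee_poussin x - vallee_poussin (x - u)\<bar>
      \<le> 8 * \<bar>fejer (4*pi * x) - fejer (4*pi * x - 4*pi * u)\<bar> + 2 * \<bar>fejer (2*pi * x) - fejer (2*pi * x - 2*pi * u)\<bar>"
    proof -
      have "\<bar>8 * a - 2 * b - (8 * c - 2 * d)\<bar> \<le> 8 * \<bar>a - c\<bar> + 2 * \<bar>b - d\<bar>" for a b c d :: real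
        by (auto simp: abs_if)
      then show ?thesis unfolding vallee_poussin_def right_diff_distrib .
    qed
  qed (use i[OF p(1)] i[OF p(2)] iv in auto)
  also have "\<dots> \<le> 8 * (14 * pi * \<bar>u\<bar>) + 2 * (14 * pi * \<bar>u\<bar>)"
    using i[OF p(1)] i[OF p(2)] e[OF p(1)] e[OF p(2)] by simp
  finally show ?thesis by simp
qed

lemma vallee_poussin_fourier:
  assumes "\<bar>w\<bar> \<le> 1"
  shows "(LINT z|lborel. vallee_poussin z * cis (- 2 * pi * z * w)) = 1"
proof -
  have h: "has_bochner_integral lborel (\<lambda>x. fejer (c * x) * cis (- 2 * pi * x * w))
      (of_real (pi * max 0 (1 - \<bar>2 * pi * w / c\<bar>)) /\<^sub>R c)" if "c > 0" for c
  proof -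
    have "has_bochner_integral lborel (\<lambda>x. (\<lambda>y. fejer y * cis (- 2 * pi * w / c * y)) (0 + c * x))
      (of_real (pi * max 0 (1 - \<bar>- 2 * pi * w / c\<bar>)) /\<^sub>R \<bar>c\<bar>)"
      using fejer_fourier[of "- 2 * pi * w / c"] that
      by (subst lborel_has_bochner_integral_real_affine_iff[symmetric]) auto
    then show ?thesis using that by (simp add: mult_ac)
  qed
  have "has_bochner_integral lborel
     (\<lambda>z. 8 * (fejer (4*pi * z) * cis (- 2 * pi * z * w)) - 2 * (fejer (2*pi * z) * cis (- 2 * pi * z * w)))
     (8 * (of_real (pi * max 0 (1 - \<bar>2 * pi * w / (4*pi)\<bar>)) /\<^sub>R (4*pi)) - 2 * (of_real (pi * max 0 (1 - \<bar>2 * pi * w / (2*pi)\<bar>)) /\<^sub>R (2*pi)))"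
    by (intro has_bochner_integral_diff has_bochner_integral_mult_right h) auto
  then have "(LINT z|lborel. vallee_poussin z * cis (- 2 * pi * z * w)) =
      8 * (of_real (pi * max 0 (1 - \<bar>2 * pi * w / (4*pi)\<bar>)) /\<^sub>R (4*pi)) - 2 * (of_real (pi * max 0 (1 - \<bar>2 * pi * w / (2*pi)\<bar>)) /\<^sub>R (2*pi))"
    by (intro has_bochner_integral_integral_eq) (simp add: vallee_poussin_def algebra_simps)
  also have "\<dots> = of_real (8 * (pi * (1 - \<bar>w\<bar>/2)) / (4*pi) - 2 * (pi * (1 - \<bar>w\<bar>)) / (2*pi))"
    using assms by (simp add: scaleR_conv_of_real max_def abs_divide divide_simps)
  also have "8 * (pi * (1 - \<bar>w\<bar>/2)) / (4*pi) - 2 * (pi * (1 - \<bar>w\<bar>)) / (2*pi) = 1"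
    by (simp add: field_simps)
  finally show ?thesis by simp
qed

section \<open>The counting form and the Sobolev estimate\<close>

lemma abs_integral_le:
  fixes f :: "'a \<Rightarrow> real"
  assumes "integrable M w" "\<And>x. \<bar>f x\<bar> \<le> w x"
  shows "\<bar>integral\<^sup>L M f\<bar> \<le> integral\<^sup>L M w"
proof -
  have "\<bar>integral\<^sup>L M f\<bar> \<le> (\<integral>x. \<bar>f x\<bar> \<partial>M)" by (rule integral_abs_bound)
  also have "\<dots> \<le> integral\<^sup>L M w"
    by (intro integral_mono' assms) (use assms(2) abs_ge_zero order_trans in blast)
  finally show ?thesis .
qed

text \<open>The main examples are functions bounded by \<open>B\<close> with support in \<open>{0..<2}\<close>; unlike the support
  condition, the bound on the \<open>L\<^sup>1\<close> norm survives convolution.\<close>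

definition tame :: "real \<Rightarrow> (real \<Rightarrow> real) \<Rightarrow> bool" where
  "tame B g \<longleftrightarrow> g \<in> borel_measurable borel \<and> (\<forall>x. \<bar>g x\<bar> \<le> B) \<and>
     integrable lborel g \<and> (LINT x|lborel. \<bar>g x\<bar>) \<le> 2 * B"

text \<open>The integral in \<open>x\<close> at a fixed parameter is split off because the
  elementary bounds hold for every \<open>t\<close> separately, by translation invariance.\<close>

definition slice :: "nat \<Rightarrow> (nat \<Rightarrow> real poly) \<Rightarrow> (real \<Rightarrow> real) \<Rightarrow> (nat \<Rightarrow> real \<Rightarrow> real) \<Rightarrow> real \<Rightarrow> real" where
  "slice m P g0 g t = (LINT x|lborel. g0 x * (\<Prod>i=1..m. g i (x - poly (P i) t)))"

definition form :: "nat \<Rightarrow> (nat \<Rightarrow> real poly) \<Rightarrow> nat \<Rightarrow> (real \<Rightarrow> real) \<Rightarrow> (nat \<Rightarrow> real \<Rightarrow> real) \<Rightarrow> real" where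
  "form m P l g0 g = (LINT t:{0..1}|lborel. slice m P g0 g (t / 2 ^ l))"

lemma tame_measurable: "tame B g \<Longrightarrow> g \<in> borel_measurable borel"
  and tame_abs_le: "tame B g \<Longrightarrow> \<bar>g x\<bar> \<le> B"
  and tame_integrable: "tame B g \<Longrightarrow> integrable lborel g"
  and tame_integral: "tame B g \<Longrightarrow> (LINT x|lborel. \<bar>g x\<bar>) \<le> 2 * B"
  by (auto simp: tame_def)

lemma tame_nonneg: "tame B g \<Longrightarrow> 0 \<le> B"
  using tame_abs_le[of B g 0] by linarith

lemma tame_mono: "tame B g \<Longrightarrow> B \<le> B' \<Longrightarrow> tame B' g"
  unfolding tame_def by (meson mult_left_mono order_trans zero_le_numeral)

lemma borel_measurable_poly [measurable]: "poly p \<in> borel_measurable borel" for p :: "real poly"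
  by (intro borel_measurable_continuous_onI continuous_on_poly continuous_on_id)

text \<open>The \<open>m\<close>-th power of |g| is at most B^(m-1) |g|, so its integral is at most
  2 B^m, hence at most (2 B)^m.\<close>

lemma tame_Lp:
  assumes "tame B g" "m \<ge> 1"
  shows "in_Lp (real m) (\<lambda>x. complex_of_real (g x))"
    and "Lp_norm (real m) (\<lambda>x. complex_of_real (g x)) \<le> 2 * B"
    and "0 \<le> Lp_norm (real m) (\<lambda>x. complex_of_real (g x))"
proof -
  note [measurable] = tame_measurable[OF assms(1)]
  have B: "0 \<le> B" using tame_nonneg[OF assms(1)] .
  have pw: "norm (complex_of_real (g x)) powr real m = \<bar>g x\<bar> ^ m" for x
    using assms(2) by (simp add: powr_realpow')
  have le: "\<bar>g x\<bar> ^ m \<le> B ^ (m - 1) * \<bar>g x\<bar>" for x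
  proof -
    have "\<bar>g x\<bar> ^ m = \<bar>g x\<bar> ^ (m - 1) * \<bar>g x\<bar>" using assms(2) by (metis Suc_diff_1 power_Suc2 less_eq_Suc_le One_nat_def)
    then show ?thesis using tame_abs_le[OF assms(1)] by (simp add: mult_right_mono power_mono)
  qed
  have int: "integrable lborel (\<lambda>x. \<bar>g x\<bar> ^ m)"
    by (rule Bochner_Integration.integrable_bound[of _ "\<lambda>x. B ^ (m - 1) * \<bar>g x\<bar>"])
       (use tame_integrable[OF assms(1)] le B in \<open>auto simp: abs_mult\<close>)
  then show "in_Lp (real m) (\<lambda>x. complex_of_real (g x))"
    unfolding in_Lp_def pw by simp
  have "(LINT x|lborel. \<bar>g x\<bar> ^ m) \<le> (LINT x|lborel. B ^ (m - 1) * \<bar>g x\<bar>)"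
    using tame_integrable[OF assms(1)] int le by (intro integral_mono) auto
  also have "\<dots> \<le> B ^ (m - 1) * (2 * B)"
    using tame_integral[OF assms(1)] B by (simp add: mult_left_mono)
  also have "\<dots> = 2 * B ^ m" using assms(2) by (metis Suc_diff_1 power_Suc2 less_eq_Suc_le One_nat_def mult.left_commute)
  also have "\<dots> \<le> 2 ^ m * B ^ m"
    using assms(2) B self_le_power[of "2::real" m] by (intro mult_right_mono) auto
  finally have "(LINT x|lborel. \<bar>g x\<bar> ^ m) \<le> (2 * B) ^ m" by (simp add: power_mult_distrib)
  then have "(LINT x|lborel. \<bar>g x\<bar> ^ m) powr (1 / real m) \<le> ((2 * B) ^ m) powr (1 / real m)"
    by (intro powr_mono2) (auto intro: integral_nonneg_AE)
  also have "(2 * B) ^ m = (2 * B) powr real m"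
    using assms(2) B by (simp add: powr_realpow')
  also have "((2 * B) powr real m) powr (1 / real m) = 2 * B"
    unfolding powr_powr using assms(2) B by simp
  finally show "Lp_norm (real m) (\<lambda>x. complex_of_real (g x)) \<le> 2 * B"
    unfolding Lp_norm_def pw .
  show "0 \<le> Lp_norm (real m) (\<lambda>x. complex_of_real (g x))" by (simp add: Lp_norm_def)
qed

lemma abs_prod_le_power:
  assumes "\<And>i. i \<in> {1..m} \<Longrightarrow> \<bar>F i\<bar> \<le> B"
  shows "\<bar>\<Prod>i=1..m. F i :: real\<bar> \<le> B ^ m"
proof -
  have "\<bar>\<Prod>i=1..m. F i\<bar> \<le> (\<Prod>i=1..m. B)"
    unfolding abs_prod by (intro prod_mono) (use assms in auto)
  then show ?thesis by simp
qed

lemma abs_prod_le_power_except: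
  assumes "\<And>i. i \<in> {1..m} - {j} \<Longrightarrow> \<bar>F i\<bar> \<le> B" "j \<in> {1..m}"
  shows "\<bar>\<Prod>i=1..m. F i :: real\<bar> \<le> B ^ (m - 1) * \<bar>F j\<bar>"
proof -
  have "(\<Prod>i=1..m. F i) = F j * (\<Prod>i\<in>{1..m}-{j}. F i)"
    using assms(2) by (intro prod.remove) auto
  moreover have "\<bar>\<Prod>i\<in>{1..m}-{j}. F i\<bar> \<le> (\<Prod>i\<in>{1..m}-{j}. B)"
    unfolding abs_prod by (intro prod_mono) (use assms in auto)
  ultimately show ?thesis using assms(2) by (simp add: abs_mult mult_left_mono mult.commute)
qed

lemma slice_integrable:
  fixes m :: nat and g0 :: "real \<Rightarrow> real" and g :: "nat \<Rightarrow> real \<Rightarrow> real"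
  assumes g0: "g0 \<in> borel_measurable borel" "integrable lborel g0"
    and g: "\<And>i. i \<in> {1..m} \<Longrightarrow> g i \<in> borel_measurable borel" "\<And>i x. i \<in> {1..m} \<Longrightarrow> \<bar>g i x\<bar> \<le> B"
  shows "integrable lborel (\<lambda>x. g0 x * (\<Prod>i=1..m. g i (x - p i)))"
proof (rule Bochner_Integration.integrable_bound[of lborel "\<lambda>x. B ^ m * \<bar>g0 x\<bar>"])
  note [measurable] = g0(1) g(1)
  show "integrable lborel (\<lambda>x. B ^ m * \<bar>g0 x\<bar>)" using g0(2) by simp
  show "(\<lambda>x. g0 x * (\<Prod>i=1..m. g i (x - p i))) \<in> borel_measurable lborel" by measurable
  have "\<bar>\<Prod>i=1..m. g i (x - p i)\<bar> \<le> \<bar>B ^ m\<bar>" for x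
    using abs_prod_le_power[of m "\<lambda>i. g i (x - p i)" B] g(2) by force
  then have "\<bar>g0 x\<bar> * \<bar>\<Prod>i=1..m. g i (x - p i)\<bar> \<le> \<bar>g0 x\<bar> * \<bar>B ^ m\<bar>" for x
    by (intro mult_left_mono) auto
  then show "AE x in lborel. norm (g0 x * (\<Prod>i=1..m. g i (x - p i))) \<le> norm (B ^ m * \<bar>g0 x\<bar>)"
    unfolding real_norm_def abs_mult[of "B ^ m"] abs_mult[of "g0 _"] abs_idempotent mult.commute[of "\<bar>B ^ m\<bar>"]
    by (intro AE_I2)
qed

lemma slice_diff_0:
  assumes "u \<in> borel_measurable borel" "integrable lborel u" "v \<in> borel_measurable borel" "integrable lborel v"
    and "\<And>i. i \<in> {1..m} \<Longrightarrow> g i \<in> borel_measurable borel" "\<And>i x. i \<in> {1..m} \<Longrightarrow> \<bar>g i x\<bar> \<le> B"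
  shows "slice m P (\<lambda>x. u x - v x) g t = slice m P u g t - slice m P v g t"
  unfolding slice_def left_diff_distrib
  by (intro Bochner_Integration.integral_diff slice_integrable[where B=B] assms)

lemma slice_diff:
  assumes j: "j \<in> {1..m}" and g0: "g0 \<in> borel_measurable borel" "integrable lborel g0"
    and g: "\<And>i. i \<in> {1..m} \<Longrightarrow> g i \<in> borel_measurable borel" "\<And>i x. i \<in> {1..m} \<Longrightarrow> \<bar>g i x\<bar> \<le> B"
    and u: "u \<in> borel_measurable borel" "\<And>x. \<bar>u x\<bar> \<le> B" and v: "v \<in> borel_measurable borel" "\<And>x. \<bar>v x\<bar> \<le> B"
  shows "slice m P g0 (g(j := \<lambda>x. u x - v x)) t = slice m P g0 (g(j := u)) t - slice m P g0 (g(j := v)) t"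
proof -
  have pj: "(\<Prod>i=1..m. (g(j := w)) i (x - poly (P i) t)) = w (x - poly (P j) t) * (\<Prod>i\<in>{1..m}-{j}. g i (x - poly (P i) t))" for w x
    using j by (subst prod.remove[of _ j]) (auto intro!: prod.cong)
  have i: "integrable lborel (\<lambda>x. g0 x * (\<Prod>i=1..m. (g(j := w)) i (x - poly (P i) t)))"
    if "w \<in> borel_measurable borel" "\<And>x. \<bar>w x\<bar> \<le> B" for w
    by (intro slice_integrable[where B=B]) (use that g g0 in auto)
  show ?thesis
    unfolding slice_def Bochner_Integration.integral_diff[OF i[OF u] i[OF v], symmetric]
    unfolding pj by (simp add: algebra_simps)
qed

text \<open>Sup norms for all factors but the \<open>j\<close>-th, the L1 norm for the
  \<open>j\<close>-th, whose shift disappears by translation invariance.\<close>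

lemma abs_slice_le:
  assumes j: "j \<in> {1..m}" and g0: "\<And>x. \<bar>g0 x\<bar> \<le> B"
    and g: "\<And>i x. i \<in> {1..m} - {j} \<Longrightarrow> \<bar>g i x\<bar> \<le> B" and gj: "integrable lborel (g j)"
  shows "\<bar>slice m P g0 g t\<bar> \<le> B ^ m * (LINT x|lborel. \<bar>g j x\<bar>)"
proof -
  have B: "0 \<le> B" using g0[of 0] by linarith
  have i: "integrable lborel (\<lambda>x. g j (x - poly (P j) t))"
    using lborel_integrable_real_affine[OF gj, of 1 "- poly (P j) t"] by simp
  have b: "\<bar>g0 x * (\<Prod>i=1..m. g i (x - poly (P i) t))\<bar> \<le> B ^ m * \<bar>g j (x - poly (P j) t)\<bar>" for x
  proof -
    have "\<bar>g0 x * (\<Prod>i=1..m. g i (x - poly (P i) t))\<bar> \<le> B * (B ^ (m - 1) * \<bar>g j (x - poly (P j) t)\<bar>)"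
      unfolding abs_mult[of "g0 x"] by (intro mult_mono g0 abs_prod_le_power_except[of m j "\<lambda>i. g i (x - poly (P i) t)"] g j B) auto
    also have "\<dots> = B ^ m * \<bar>g j (x - poly (P j) t)\<bar>"
      using j by (cases m) auto
    finally show ?thesis .
  qed
  have "\<bar>slice m P g0 g t\<bar> \<le> (LINT x|lborel. B ^ m * \<bar>g j (x - poly (P j) t)\<bar>)"
    unfolding slice_def by (rule abs_integral_le) (use i b in auto)
  also have "\<dots> = B ^ m * (LINT x|lborel. \<bar>g j x\<bar>)"
    using lborel_integral_real_affine[of 1 "\<lambda>x. \<bar>g j x\<bar>" "- poly (P j) t"] by simp
  finally show ?thesis .
qed

lemma abs_form_le:
  assumes "\<And>t. 0 \<le> t \<Longrightarrow> t \<le> 1 \<Longrightarrow> \<bar>slice m P g0 g (t / 2 ^ l)\<bar> \<le> E"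
  shows "\<bar>form m P l g0 g\<bar> \<le> E"
proof -
  have E: "0 \<le> E" using assms[of 0] by force
  show ?thesis
  \<comment> \<open>If the slices are not integrable in \<open>t\<close>, the integral is 0 by
    convention, and \<open>E\<close> is nonnegative.\<close>
  proof (cases "set_integrable lborel {0..1} (\<lambda>t. slice m P g0 g (t / 2 ^ l))")
    case True
    have "\<bar>form m P l g0 g\<bar> \<le> (LINT t:{0..1}|lborel. \<bar>slice m P g0 g (t / 2 ^ l)\<bar>)"
      unfolding form_def using set_integral_norm_bound[OF True] by simp
    also have "\<dots> \<le> (LINT t:{0..1::real}|lborel. E)"
      using assms True by (intro set_integral_mono set_integrable_abs) (auto simp: set_integrable_def)
    also have "\<dots> = E" by (simp add: set_integral_const)
    finally show ?thesis .
  qed (use E in \<open>auto simp: form_def set_lebesgue_integral_def set_integrable_def not_integrable_integral_eq\<close>)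
qed

lemma borel_measurable_slice:
  assumes [measurable]: "g0 \<in> borel_measurable borel" "\<And>i. i \<in> {1..m} \<Longrightarrow> g i \<in> borel_measurable borel"
  shows "slice m P g0 g \<in> borel_measurable borel"
  unfolding slice_def by measurable

lemma set_integrable_slice:
  assumes g0: "g0 \<in> borel_measurable borel" "integrable lborel g0"
    and g: "\<And>i. i \<in> {1..m} \<Longrightarrow> g i \<in> borel_measurable borel" "\<And>i x. i \<in> {1..m} \<Longrightarrow> \<bar>g i x\<bar> \<le> B"
    and A: "A \<in> sets borel" "A \<subseteq> {0..1}"
  shows "set_integrable lborel A (\<lambda>t. slice m P g0 g (t / 2 ^ l))"
proof -
  note [measurable] = borel_measurable_slice[OF g0(1) g(1), of m] 
  have b: "\<bar>slice m P g0 g s\<bar> \<le> B ^ m * (LINT x|lborel. \<bar>g0 x\<bar>)" for s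
  proof -
    have "\<bar>slice m P g0 g s\<bar> \<le> (LINT x|lborel. B ^ m * \<bar>g0 x\<bar>)"
      unfolding slice_def
    proof (rule abs_integral_le)
      fix x
      have "\<bar>\<Prod>i=1..m. g i (x - poly (P i) s)\<bar> \<le> B ^ m" by (intro abs_prod_le_power g)
      then show "\<bar>g0 x * (\<Prod>i=1..m. g i (x - poly (P i) s))\<bar> \<le> B ^ m * \<bar>g0 x\<bar>"
        unfolding abs_mult by (subst mult.commute) (rule mult_right_mono, auto)
    qed (use g0 in auto)
    then show ?thesis by simp
  qed
  have "set_integrable lborel {0..1::real} (\<lambda>t. slice m P g0 g (t / 2 ^ l))"
    unfolding set_integrable_def
    by (rule integrableI_bounded_set_indicator[where B="B ^ m * (LINT x|lborel. \<bar>g0 x\<bar>)"])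
       (use b in auto)
  then show ?thesis by (rule set_integrable_subset) (use A in auto)
qed

lemma form_diff_0:
  assumes u: "tame B u" and v: "tame B v" and g: "\<And>i. i \<in> {1..m} \<Longrightarrow> tame B (g i)"
  shows "form m P l (\<lambda>x. u x - v x) g = form m P l u g - form m P l v g"
proof -
  note t = tame_measurable tame_integrable tame_abs_le
  have "slice m P (\<lambda>x. u x - v x) g t = slice m P u g t - slice m P v g t" for t
    by (rule slice_diff_0[where B=B]) (rule t u v g | assumption)+
  moreover have "set_integrable lborel {0..1} (\<lambda>t. slice m P w g (t / 2 ^ l))" if "tame B w" for w
    by (rule set_integrable_slice[where B=B]) (rule t that g order_refl atLeastAtMost_borel | assumption)+
  ultimately show ?thesis unfolding form_def by (simp add: u v set_integral_diff)
qed

lemma form_diff: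
  assumes j: "j \<in> {1..m}" and g0: "tame B g0" and g: "\<And>i. i \<in> {1..m} \<Longrightarrow> tame B (g i)"
    and u: "tame B u" and v: "tame B v"
  shows "form m P l g0 (g(j := \<lambda>x. u x - v x)) = form m P l g0 (g(j := u)) - form m P l g0 (g(j := v))"
proof -
  note t = tame_measurable tame_integrable tame_abs_le
  have "slice m P g0 (g(j := \<lambda>x. u x - v x)) t = slice m P g0 (g(j := u)) t - slice m P g0 (g(j := v)) t" for t
    by (rule slice_diff[where B=B]) (rule t u v g g0 j | assumption)+
  moreover have "set_integrable lborel {0..1} (\<lambda>t. slice m P g0 (g(j := w)) (t / 2 ^ l))" if "tame B w" for w
  proof (rule set_integrable_slice[where B=B])
    have "tame B ((g(j := w)) i)" if "i \<in> {1..m}" for i using g[OF that] \<open>tame B w\<close> by simp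
    then show "(g(j := w)) i \<in> borel_measurable borel" "\<bar>(g(j := w)) i x\<bar> \<le> B" if "i \<in> {1..m}" for i x
      using that t by blast+
  qed (rule t g0 order_refl atLeastAtMost_borel | assumption)+
  ultimately show ?thesis unfolding form_def by (simp add: u v set_integral_diff)
qed

section \<open>Smoothing by the rescaled kernel\<close>

definition vp :: "real \<Rightarrow> real \<Rightarrow> real" where
  "vp M x = M * vallee_poussin (M * x)"

definition smooth :: "real \<Rightarrow> (real \<Rightarrow> real) \<Rightarrow> real \<Rightarrow> real" where
  "smooth M g x = (LINT y|lborel. g y * vp M (x - y))"

lemma borel_measurable_vp [measurable]: "vp M \<in> borel_measurable borel"
  unfolding vp_def by measurable

lemma integrable_vp: "M > 0 \<Longrightarrow> integrable lborel (vp M)"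
  unfolding vp_def
  using lborel_integrable_real_affine[OF integrable_vallee_poussin, of M 0] by simp

lemma integrable_vp_shift: "M > 0 \<Longrightarrow> integrable lborel (\<lambda>x. vp M (x - u))"
  using lborel_integrable_real_affine[OF integrable_vp, of M 1 "- u"] by simp

lemma nn_integral_abs_vp:
  assumes "M > 0" shows "(\<integral>\<^sup>+x. ennreal \<bar>vp M (x - u)\<bar> \<partial>lborel) \<le> 3"
proof -
  have "(LINT x|lborel. \<bar>vp M (x - u)\<bar>) = (LINT x|lborel. \<bar>vp M x\<bar>)"
    using lborel_integral_real_affine[of 1 "\<lambda>x. \<bar>vp M x\<bar>" "- u"] by simp
  also have "\<dots> = (LINT x|lborel. \<bar>vallee_poussin x\<bar>)"
    using lborel_integral_real_affine[of M "\<lambda>x. \<bar>vallee_poussin x\<bar>" 0] assms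
    by (simp add: vp_def abs_mult)
  finally have "(LINT x|lborel. \<bar>vp M (x - u)\<bar>) \<le> 3" using integral_abs_vallee_poussin by simp
  then show ?thesis using integrable_vp_shift[OF assms]
    by (subst nn_integral_eq_integral) (auto simp: ennreal_le_iff simp flip: ennreal_numeral)
qed

lemma nn_integral_vp_modulus:
  assumes "M > 0"
  shows "(\<integral>\<^sup>+x. ennreal \<bar>vp M (x - u) - vp M (x - v)\<bar> \<partial>lborel) \<le> ennreal (140 * pi * M * \<bar>u - v\<bar>)"
proof -
  have "(LINT x|lborel. \<bar>vp M (x - u) - vp M (x - v)\<bar>)
      = (LINT x|lborel. \<bar>vp M x - vp M (x - (v - u))\<bar>)"
    using lborel_integral_real_affine[of 1 "\<lambda>x. \<bar>vp M (x - u) - vp M (x - v)\<bar>" u]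
    by (simp add: algebra_simps)
  also have "\<dots> = (LINT x|lborel. \<bar>vallee_poussin x - vallee_poussin (x - M * (v - u))\<bar>)"
    using lborel_integral_real_affine[of M "\<lambda>x. \<bar>vallee_poussin x - vallee_poussin (x - M * (v - u))\<bar>" 0] assms
    by (simp add: vp_def abs_mult right_diff_distrib[symmetric])
  also have "\<dots> \<le> 140 * pi * \<bar>M * (v - u)\<bar>"
    by (rule integral_vallee_poussin_modulus)
  finally have "(LINT x|lborel. \<bar>vp M (x - u) - vp M (x - v)\<bar>) \<le> 140 * pi * M * \<bar>u - v\<bar>"
    using assms by (simp add: abs_mult abs_minus_commute mult_ac)
  then show ?thesis using integrable_vp_shift[OF assms]
    by (subst nn_integral_eq_integral) (auto intro!: ennreal_leI)
qed

text \<open>Schur's test in L1, by Tonelli. Where a section is not integrable in \<open>y\<close>,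
  the inner Bochner integral is 0 and the bound is trivial.\<close>

lemma nn_integral_kernel_le:
  fixes D :: "real \<Rightarrow> real" and K :: "real \<Rightarrow> real \<Rightarrow> real"
  assumes [measurable]: "D \<in> borel_measurable borel" "case_prod K \<in> borel_measurable (borel \<Otimes>\<^sub>M borel)"
    and K: "\<And>y. (\<integral>\<^sup>+x. ennreal \<bar>K x y\<bar> \<partial>lborel) \<le> c"
  shows "(\<integral>\<^sup>+x. ennreal \<bar>LINT y|lborel. D y * K x y\<bar> \<partial>lborel) \<le> c * (\<integral>\<^sup>+y. ennreal \<bar>D y\<bar> \<partial>lborel)"
proof -
  have "(\<integral>\<^sup>+x. ennreal \<bar>LINT y|lborel. D y * K x y\<bar> \<partial>lborel)
      \<le> (\<integral>\<^sup>+x. \<integral>\<^sup>+y. ennreal \<bar>D y\<bar> * ennreal \<bar>K x y\<bar> \<partial>lborel \<partial>lborel)"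
  proof (rule nn_integral_mono)
    fix x
    show "ennreal \<bar>LINT y|lborel. D y * K x y\<bar> \<le> (\<integral>\<^sup>+y. ennreal \<bar>D y\<bar> * ennreal \<bar>K x y\<bar> \<partial>lborel)"
    proof (cases "integrable lborel (\<lambda>y. D y * K x y)")
      case True
      from integral_norm_bound_ennreal[OF this] show ?thesis
        by (simp add: abs_mult ennreal_mult)
    qed (simp add: not_integrable_integral_eq)
  qed
  also have "\<dots> = (\<integral>\<^sup>+y. \<integral>\<^sup>+x. ennreal \<bar>D y\<bar> * ennreal \<bar>K x y\<bar> \<partial>lborel \<partial>lborel)"
    by (rule lborel_pair.Fubini'[symmetric]) measurable
  also have "\<dots> = (\<integral>\<^sup>+y. ennreal \<bar>D y\<bar> * (\<integral>\<^sup>+x. ennreal \<bar>K x y\<bar> \<partial>lborel) \<partial>lborel)"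
    by (intro nn_integral_cong nn_integral_cmult) measurable
  also have "\<dots> \<le> (\<integral>\<^sup>+y. ennreal \<bar>D y\<bar> * c \<partial>lborel)"
    by (intro nn_integral_mono mult_left_mono K) auto
  also have "\<dots> = c * (\<integral>\<^sup>+y. ennreal \<bar>D y\<bar> \<partial>lborel)"
    by (subst nn_integral_multc) (auto simp: mult.commute)
  finally show ?thesis .
qed

lemma nn_integral_tame:
  assumes "tame B g" shows "(\<integral>\<^sup>+x. ennreal \<bar>g x\<bar> \<partial>lborel) \<le> ennreal (2 * B)"
  using assms by (subst nn_integral_eq_integral) (auto simp: tame_def intro!: ennreal_leI)

lemma integrable_if_nn_integral_le:
  fixes h :: "real \<Rightarrow> real"
  assumes "h \<in> borel_measurable lborel" "(\<integral>\<^sup>+x. ennreal \<bar>h x\<bar> \<partial>lborel) \<le> ennreal c" "0 \<le> c"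
  shows "integrable lborel h" "(LINT x|lborel. \<bar>h x\<bar>) \<le> c"
proof -
  show i: "integrable lborel h"
    using assms by (intro integrableI_bounded) (auto intro: le_less_trans)
  show "(LINT x|lborel. \<bar>h x\<bar>) \<le> c"
    using assms i by (subst (asm) nn_integral_eq_integral) auto
qed

lemma borel_measurable_smooth:
  assumes [measurable]: "g \<in> borel_measurable borel" shows "smooth M g \<in> borel_measurable borel"
  unfolding smooth_def by measurable

text \<open>Convolution multiplies both the sup norm and the L1 norm by at most the L1 norm of the
  kernel, which is at most 3.\<close>

lemma tame_smooth:
  assumes g: "tame B g" and M: "M > 0"
  shows "tame (3 * B) (smooth M g)"
proof -
  note [measurable] = tame_measurable[OF g]
  have B: "0 \<le> B" using tame_nonneg[OF g] .
  have "(\<integral>\<^sup>+x. ennreal \<bar>smooth M g x\<bar> \<partial>lborel) \<le> 3 * (\<integral>\<^sup>+y. ennreal \<bar>g y\<bar> \<partial>lborel)"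
    unfolding smooth_def
    by (rule nn_integral_kernel_le) (use nn_integral_abs_vp[OF M] in auto)
  also have "\<dots> \<le> 3 * ennreal (2 * B)" by (intro mult_left_mono nn_integral_tame g) auto
  also have "\<dots> = ennreal (2 * (3 * B))" using B ennreal_mult[of 3 "2 * B"] by (simp add: mult.left_commute)
  finally have l: "(\<integral>\<^sup>+x. ennreal \<bar>smooth M g x\<bar> \<partial>lborel) \<le> ennreal (2 * (3 * B))" .
  have "\<bar>smooth M g x\<bar> \<le> 3 * B" for x
  proof -
    have i: "integrable lborel (\<lambda>y. vp M (x - y))"
      using lborel_integrable_real_affine[OF integrable_vp[OF M], of "-1" x] by simp
    have "\<bar>smooth M g x\<bar> \<le> (LINT y|lborel. B * \<bar>vp M (x - y)\<bar>)"
      unfolding smooth_def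
      by (rule abs_integral_le) (use i tame_abs_le[OF g] in \<open>auto simp: abs_mult mult_right_mono\<close>)
    also have "\<dots> = B * (LINT y|lborel. \<bar>vp M y\<bar>)"
      using lborel_integral_real_affine[of "-1" "\<lambda>y. \<bar>vp M y\<bar>" x] by simp
    also have "\<dots> \<le> B * 3"
      using nn_integral_abs_vp[OF M, of 0] by (intro mult_left_mono integrable_if_nn_integral_le B) auto
    finally show ?thesis by simp
  qed
  with integrable_if_nn_integral_le[OF _ l] B show ?thesis
    unfolding tame_def by (simp add: borel_measurable_smooth tame_measurable[OF g])
qed

lemma abs_vp_le: "M > 0 \<Longrightarrow> \<bar>vp M x\<bar> \<le> 5 * M"
proof -
  assume M: "M > 0"
  have "\<bar>vallee_poussin y\<bar> \<le> 5" for y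
    unfolding vallee_poussin_def
    using fejer_nonneg[of "4 * pi * y"] fejer_nonneg[of "2 * pi * y"] fejer_le_half[of "4 * pi * y"] fejer_le_half[of "2 * pi * y"]
    by linarith
  then have "M * \<bar>vallee_poussin (M * x)\<bar> \<le> M * 5" using M by (intro mult_left_mono) auto
  then show ?thesis using M by (simp add: vp_def abs_mult mult.commute)
qed

section \<open>Dyadic cancellation against smoothing\<close>

text \<open>For integrable \<open>D\<close> this is vanishing conditional expectation on the cells
  of level \<open>k\<close>. With arbitrary functions of the cell index, any bounded expression in
  \<open>y\<close> becomes a test function once \<open>y\<close> is frozen at the left end of its
  cell.\<close>

definition cancels :: "nat \<Rightarrow> (real \<Rightarrow> real) \<Rightarrow> bool" where
  "cancels k D \<longleftrightarrow> (\<forall>\<psi>. (LINT y|lborel. D y * \<psi> \<lfloor>2 ^ k * y\<rfloor>) = 0)"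

lemma integrable_mult_bounded:
  fixes D h :: "real \<Rightarrow> real"
  assumes "integrable lborel D" "h \<in> borel_measurable borel" "\<And>y. \<bar>h y\<bar> \<le> c"
  shows "integrable lborel (\<lambda>y. D y * h y)"
proof (rule Bochner_Integration.integrable_bound[of lborel "\<lambda>y. c * \<bar>D y\<bar>"])
  have [measurable]: "D \<in> borel_measurable borel" using assms(1) by auto
  note [measurable] = assms(2)
  show "(\<lambda>y. D y * h y) \<in> borel_measurable lborel" by measurable
  have "0 \<le> c" using assms(3)[of 0] by linarith
  then show "AE y in lborel. norm (D y * h y) \<le> norm (c * \<bar>D y\<bar>)"
    using assms(3) by (auto simp: abs_mult mult.commute[of c] intro!: AE_I2 mult_left_mono)
qed (use assms in auto)

text \<open>Cancellation allows subtracting the kernel centred at the left end of the cell of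
  \<open>y\<close>, which moves the centre by at most \<open>1 / 2 ^ k\<close>. The L1 modulus of
  the kernel then gives \<open>140 * pi * M / 2 ^ k\<close>, and the L1 norm of \<open>D\<close>
  contributes \<open>2 * B\<close>.\<close>

lemma integral_smooth_cancels:
  assumes D: "tame B D" "cancels k D" and M: "M > 0"
  shows "(LINT x|lborel. \<bar>smooth M D x\<bar>) \<le> 280 * pi * M / 2 ^ k * B"
proof -
  note [measurable] = tame_measurable[OF D(1)]
  let ?r = "\<lambda>y. of_int \<lfloor>2 ^ k * y\<rfloor> / 2 ^ k :: real"
  have B: "0 \<le> B" using tame_nonneg[OF D(1)] .
  have r: "\<bar>y - ?r y\<bar> \<le> 1 / 2 ^ k" for y
  proof -
    have "\<bar>2 ^ k * y - of_int \<lfloor>2 ^ k * y\<rfloor>\<bar> \<le> 1" by linarith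
    moreover have "y - ?r y = (2 ^ k * y - of_int \<lfloor>2 ^ k * y\<rfloor>) / 2 ^ k" by (simp add: field_simps)
    ultimately show ?thesis by (simp add: abs_divide divide_right_mono)
  qed
  have eq: "smooth M D x = (LINT y|lborel. D y * (vp M (x - y) - vp M (x - ?r y)))" for x
  proof -
    have "(LINT y|lborel. D y * vp M (x - ?r y)) = 0"
      using D(2) unfolding cancels_def by (elim allE[of _ "\<lambda>j. vp M (x - of_int j / 2 ^ k)"])
    moreover have "integrable lborel (\<lambda>y. D y * vp M (x - y))" "integrable lborel (\<lambda>y. D y * vp M (x - ?r y))"
      by (intro integrable_mult_bounded[where c="5 * M"] tame_integrable[OF D(1)] abs_vp_le[OF M]; measurable)+
    ultimately show ?thesis by (simp add: smooth_def right_diff_distrib)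
  qed
  have "(\<integral>\<^sup>+x. ennreal \<bar>smooth M D x\<bar> \<partial>lborel) \<le> ennreal (140 * pi * M * (1 / 2 ^ k)) * (\<integral>\<^sup>+y. ennreal \<bar>D y\<bar> \<partial>lborel)"
    unfolding eq
  proof (rule nn_integral_kernel_le)
    fix y
    have "140 * pi * M * \<bar>y - ?r y\<bar> \<le> 140 * pi * M * (1 / 2 ^ k)"
      using r M by (intro mult_left_mono) auto
    then show "(\<integral>\<^sup>+x. ennreal \<bar>vp M (x - y) - vp M (x - ?r y)\<bar> \<partial>lborel) \<le> ennreal (140 * pi * M * (1 / 2 ^ k))"
      using nn_integral_vp_modulus[OF M] ennreal_leI order_trans by blast
  qed measurable
  also have "\<dots> \<le> ennreal (140 * pi * M * (1 / 2 ^ k)) * ennreal (2 * B)"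
    by (intro mult_left_mono nn_integral_tame D) auto
  also have "\<dots> = ennreal (280 * pi * M / 2 ^ k * B)"
    using M B by (subst ennreal_mult[symmetric]) (auto simp: field_simps)
  finally show ?thesis
    using M B by (intro integrable_if_nn_integral_le) (auto simp: borel_measurable_smooth tame_measurable[OF D(1)])
qed

section \<open>The Fourier side of the smoothing\<close>

lemma vp_fourier:
  assumes "M > 0" "\<bar>w\<bar> \<le> M"
  shows "(LINT z|lborel. vp M z * cis (- 2 * pi * z * w)) = 1"
proof -
  have "(LINT z|lborel. vallee_poussin z * cis (- 2 * pi * z * (w / M))) = 1"
    using assms by (intro vallee_poussin_fourier) (simp add: abs_divide)
  moreover have "(LINT z|lborel. vallee_poussin z * cis (- 2 * pi * z * (w / M)))
     = M *\<^sub>R (LINT z|lborel. vallee_poussin (M * z) * cis (- 2 * pi * (M * z) * (w / M)))"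
    using assms(1) lborel_integral_real_affine[of M "\<lambda>z. vallee_poussin z * cis (- 2 * pi * z * (w / M))" 0] by simp
  moreover have "\<dots> = (LINT z|lborel. M *\<^sub>R (vallee_poussin (M * z) * cis (- 2 * pi * (M * z) * (w / M))))"
    by simp
  moreover have "\<dots> = (LINT z|lborel. vp M z * cis (- 2 * pi * z * w))"
    using assms(1) by (intro Bochner_Integration.integral_cong) (auto simp: vp_def scaleR_conv_of_real mult.assoc)
  ultimately show ?thesis by simp
qed

lemma norm_fourier_transform_le: "norm (fourier_transform \<phi> x) \<le> (LINT y|lborel. norm (\<phi> y))"
  unfolding fourier_transform_def
  using integral_norm_bound[of lborel "\<lambda>y. cis (- 2 * pi * x * y) * \<phi> y"] by (simp add: norm_mult)

lemma borel_measurable_cis [measurable]: "cis \<in> borel_measurable borel"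
  by (intro borel_measurable_continuous_onI continuous_on_cis continuous_on_id)

lemma test_function_integrable:
  assumes "test_function_on S \<phi>"
  shows "\<phi> \<in> borel_measurable borel" "integrable lborel \<phi>"
proof -
  from assms obtain D where D: "D 0 = \<phi>" "\<And>n x. (D n has_vector_derivative D (Suc n) x) (at x)"
    unfolding test_function_on_def by blast
  have c: "continuous_on X \<phi>" for X
    using D by (intro continuous_at_imp_continuous_on) (metis has_vector_derivative_continuous)
  then show "\<phi> \<in> borel_measurable borel" by (intro borel_measurable_continuous_onI)
  let ?K = "closure {y. \<phi> y \<noteq> 0}"
  have K: "compact ?K" using assms unfolding test_function_on_def by blast
  have "set_integrable lborel ?K \<phi>"
    unfolding set_integrable_def using borel_integrable_compact[OF K c] by (simp add: indicator_def if_distrib cong: if_cong)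
  moreover have "indicator ?K x *\<^sub>R \<phi> x = \<phi> x" for x
    using closure_subset[of "{y. \<phi> y \<noteq> 0}"] by (auto simp: indicator_def)
  ultimately show "integrable lborel \<phi>" unfolding set_integrable_def by simp
qed

lemma borel_measurable_fourier_transform:
  assumes [measurable]: "\<phi> \<in> borel_measurable borel"
  shows "fourier_transform \<phi> \<in> borel_measurable borel"
  unfolding fourier_transform_def by measurable

lemma Fubini_kernel:
  fixes F :: "real \<Rightarrow> real \<Rightarrow> complex"
  assumes [measurable]: "case_prod F \<in> borel_measurable (borel \<Otimes>\<^sub>M borel)"
    and "integrable lborel D" "c \<ge> 0"
    and F: "\<And>x. integrable lborel (F x)" "\<And>x. (LINT y|lborel. norm (F x y)) \<le> c * D x"
  shows "(LINT x|lborel. LINT y|lborel. F x y) = (LINT y|lborel. LINT x|lborel. F x y)"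
proof -
  have "integrable (lborel \<Otimes>\<^sub>M lborel) (case_prod F)"
  proof (rule lborel_pair.Fubini_integrable)
    show "integrable lborel (\<lambda>x. LINT y|lborel. norm (case (x, y) of (x, y) \<Rightarrow> F x y))"
      by (rule Bochner_Integration.integrable_bound[of lborel "\<lambda>x. c * D x"])
         (use assms(2) F(2) in \<open>auto intro!: AE_I2 order_trans[OF _ abs_ge_self]\<close>)
  qed (use F(1) in auto)
  from lborel_pair.Fubini_integral[OF this] show ?thesis by simp
qed

text \<open>On the Fourier side the kernel multiplies \<open>\<phi>\<close> by a function that
  equals 1 on the support of \<open>\<phi>\<close>.\<close>

lemma integral_vp_fourier_transform:
  assumes \<phi>: "test_function_on {\<xi>. \<bar>\<xi>\<bar> \<le> M} \<phi>" and M: "M > 0"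
  shows "(LINT x|lborel. vp M (x - y) * fourier_transform \<phi> x) = fourier_transform \<phi> y"
proof -
  note [measurable] = test_function_integrable(1)[OF \<phi>]
  note int = test_function_integrable(2)[OF \<phi>]
  have "(LINT x|lborel. vp M (x - y) * fourier_transform \<phi> x)
      = (LINT z|lborel. vp M z * fourier_transform \<phi> (y + z))"
    using lborel_integral_real_affine[of 1 "\<lambda>x. vp M (x - y) * fourier_transform \<phi> x" y] by simp
  also have "\<dots> = (LINT z|lborel. LINT w|lborel. vp M z * (cis (- 2 * pi * (y + z) * w) * \<phi> w))"
    unfolding fourier_transform_def by simp
  also have "\<dots> = (LINT w|lborel. LINT z|lborel. vp M z * (cis (- 2 * pi * (y + z) * w) * \<phi> w))"
  proof (rule Fubini_kernel[where D="\<lambda>z. \<bar>vp M z\<bar>" and c="LINT w|lborel. norm (\<phi> w)"])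
    show "integrable lborel (\<lambda>z. \<bar>vp M z\<bar>)" using integrable_vp[OF M] by simp
    fix z
    have "integrable lborel (\<lambda>w. cis (- 2 * pi * (y + z) * w) * \<phi> w)"
      by (rule Bochner_Integration.integrable_bound[OF int]) (auto simp: norm_mult)
    then show "integrable lborel (\<lambda>w. vp M z * (cis (- 2 * pi * (y + z) * w) * \<phi> w))" by simp
  qed (auto simp: norm_mult)
  also have "\<dots> = (LINT w|lborel. cis (- 2 * pi * y * w) * \<phi> w)"
  proof (intro Bochner_Integration.integral_cong refl)
    fix w
    have "(LINT z|lborel. vp M z * (cis (- 2 * pi * (y + z) * w) * \<phi> w))
      = (LINT z|lborel. (vp M z * cis (- 2 * pi * z * w)) * (cis (- 2 * pi * y * w) * \<phi> w))"
    proof (intro Bochner_Integration.integral_cong refl)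
      fix z
      have "cis (- 2 * pi * (y + z) * w) = cis (- 2 * pi * z * w) * cis (- 2 * pi * y * w)"
        unfolding cis_mult by (simp add: algebra_simps)
      then show "vp M z * (cis (- 2 * pi * (y + z) * w) * \<phi> w)
          = (vp M z * cis (- 2 * pi * z * w)) * (cis (- 2 * pi * y * w) * \<phi> w)" by (simp only: mult.assoc)
    qed
    also have "\<dots> = (LINT z|lborel. vp M z * cis (- 2 * pi * z * w)) * (cis (- 2 * pi * y * w) * \<phi> w)"
      by (rule integral_mult_left_zero)
    also have "\<dots> = cis (- 2 * pi * y * w) * \<phi> w"
    proof (cases "\<phi> w = 0")
      case False
      then have "w \<in> closure {y. \<phi> y \<noteq> 0}" using closure_subset[of "{y. \<phi> y \<noteq> 0}"] by auto
      moreover have "closure {y. \<phi> y \<noteq> 0} \<subseteq> {\<xi>. \<bar>\<xi>\<bar> \<le> M}" using \<phi> by (simp add: test_function_on_def)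
      ultimately have "\<bar>w\<bar> \<le> M" by auto
      from vp_fourier[OF M this] show ?thesis by (simp only: mult_1)
    qed simp
    finally show "(LINT z|lborel. vp M z * (cis (- 2 * pi * (y + z) * w) * \<phi> w)) = cis (- 2 * pi * y * w) * \<phi> w" .
  qed
  finally show ?thesis by (simp add: fourier_transform_def)
qed

text \<open>Duality: Fubini moves the kernel from the test side, where it acts as the identity, onto
  \<open>D\<close>. This stays within the distributional meaning of vanishing and never forms the
  Fourier transform of \<open>D\<close>.\<close>

lemma fourier_vanishes_smooth:
  assumes D: "tame B D" and M: "M > 0"
  shows "fourier_vanishes_on (\<lambda>x. complex_of_real (D x - smooth M D x)) {\<xi>. \<bar>\<xi>\<bar> \<le> M}"
  unfolding fourier_vanishes_on_def
proof (intro allI impI)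
  fix \<phi> assume \<phi>: "test_function_on {\<xi>. \<bar>\<xi>\<bar> \<le> M} \<phi>"
  note [measurable] = test_function_integrable(1)[OF \<phi>] tame_measurable[OF D]
    borel_measurable_fourier_transform[OF test_function_integrable(1)[OF \<phi>]]
  let ?F = "fourier_transform \<phi>" and ?c = "LINT w|lborel. norm (\<phi> w)"
  have ib: "integrable lborel (\<lambda>x. complex_of_real (h x) * ?F x)" "(LINT x|lborel. norm (complex_of_real (h x) * ?F x)) \<le> ?c * (LINT x|lborel. \<bar>h x\<bar>)"
    if h: "integrable lborel h" for h
  proof -
    have [measurable]: "h \<in> borel_measurable borel" using h by auto
    have le: "norm (complex_of_real (h x) * ?F x) \<le> ?c * \<bar>h x\<bar>" for x
      using mult_left_mono[OF norm_fourier_transform_le[of \<phi> x] abs_ge_zero[of "h x"]]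
      by (simp add: norm_mult mult.commute[of ?c])
    show i: "integrable lborel (\<lambda>x. complex_of_real (h x) * ?F x)"
      by (rule Bochner_Integration.integrable_bound[of lborel "\<lambda>x. ?c * \<bar>h x\<bar>"])
         (use h le in \<open>auto intro!: AE_I2 order_trans[OF _ abs_ge_self]\<close>)
    have "(LINT x|lborel. norm (complex_of_real (h x) * ?F x)) \<le> (LINT x|lborel. ?c * \<bar>h x\<bar>)"
      using i h le by (intro integral_mono) auto
    then show "(LINT x|lborel. norm (complex_of_real (h x) * ?F x)) \<le> ?c * (LINT x|lborel. \<bar>h x\<bar>)" by simp
  qed
  have vi: "(LINT x|lborel. \<bar>vp M (x - y)\<bar>) \<le> 3" for y
    using nn_integral_abs_vp[OF M, of y] by (intro integrable_if_nn_integral_le) auto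
  have "(LINT y|lborel. D y * ?F y) = (LINT y|lborel. LINT x|lborel. D y * (vp M (x - y) * ?F x))"
    using integral_vp_fourier_transform[OF \<phi> M] by simp
  also have "\<dots> = (LINT x|lborel. LINT y|lborel. D y * (vp M (x - y) * ?F x))"
  proof (rule Fubini_kernel[where D="\<lambda>y. \<bar>D y\<bar>" and c="?c * 3"])
    show "integrable lborel (\<lambda>y. \<bar>D y\<bar>)" using tame_integrable[OF D] by simp
    fix y
    show "integrable lborel (\<lambda>x. D y * (vp M (x - y) * ?F x))"
      using ib(1)[OF integrable_vp_shift[OF M]] by simp
    have "(LINT x|lborel. norm (vp M (x - y) * ?F x)) \<le> ?c * 3"
      by (rule order_trans[OF ib(2)[OF integrable_vp_shift[OF M]]]) (intro mult_left_mono vi, simp)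
    then show "(LINT x|lborel. norm (D y * (vp M (x - y) * ?F x))) \<le> ?c * 3 * \<bar>D y\<bar>"
      by (simp add: norm_mult mult.commute mult_left_mono)
  qed (auto intro!: mult_nonneg_nonneg integral_nonneg_AE)
  also have "\<dots> = (LINT x|lborel. smooth M D x * ?F x)"
    unfolding smooth_def by (simp add: mult.assoc[symmetric] flip: of_real_mult integral_complex_of_real)
  finally have "(LINT y|lborel. D y * ?F y) = (LINT x|lborel. smooth M D x * ?F x)" .
  then show "(LINT x|lborel. complex_of_real (D x - smooth M D x) * ?F x) = 0"
    using ib(1)[OF tame_integrable[OF D]] ib(1)[OF tame_integrable[OF tame_smooth[OF D M]]]
    by (simp add: left_diff_distrib)
qed

section \<open>The Sobolev estimate applied to the form\<close>

text \<open>With the average over \<open>t\<close> inside, the form pairs \<open>g0\<close> with the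
  function whose L1 norm the Sobolev estimate controls.\<close>

lemma form_swap:
  assumes g0: "tame B g0" and g: "\<And>i. i \<in> {1..m} \<Longrightarrow> tame B (g i)"
  shows "form m P l g0 g = (LINT x|lborel. g0 x * (LINT t:{0..1}|lborel. \<Prod>i=1..m. g i (x - poly (P i) (t / 2 ^ l))))"
proof -
  note [measurable] = tame_measurable[OF g0] tame_measurable[OF g]
  let ?F = "\<lambda>t x. indicator {0..1} t * (g0 x * (\<Prod>i=1..m. g i (x - poly (P i) (t / 2 ^ l))))"
  have si: "integrable lborel (\<lambda>x. g0 x * (\<Prod>i=1..m. g i (x - poly (P i) (t / 2 ^ l))))" for t
    by (rule slice_integrable[where B=B]) (rule tame_measurable tame_integrable tame_abs_le g0 g | assumption)+
  have bnd: "\<bar>?F t x\<bar> \<le> indicator {0..1} t * (B ^ m * \<bar>g0 x\<bar>)" for t x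
  proof -
    have "\<bar>\<Prod>i=1..m. g i (x - poly (P i) (t / 2 ^ l))\<bar> \<le> B ^ m"
      by (intro abs_prod_le_power tame_abs_le g)
    from mult_left_mono[OF this abs_ge_zero[of "g0 x"]] show ?thesis
      by (auto simp: indicator_def abs_mult mult.commute)
  qed
  have int: "integrable (lborel \<Otimes>\<^sub>M lborel) (case_prod ?F)"
  proof (rule lborel_pair.Fubini_integrable)
    show "case_prod ?F \<in> borel_measurable (lborel \<Otimes>\<^sub>M lborel)" by measurable
    show "AE t in lborel. integrable lborel (\<lambda>x. case_prod ?F (t, x))" using si by simp
    show "integrable lborel (\<lambda>t. LINT x|lborel. norm (case_prod ?F (t, x)))"
    proof (rule Bochner_Integration.integrable_bound[of lborel "\<lambda>t. indicator {0..1} t * (B ^ m * (LINT x|lborel. \<bar>g0 x\<bar>))"])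
      show "AE t in lborel. norm (LINT x|lborel. norm (case_prod ?F (t, x))) \<le> norm (indicator {0..1::real} t * (B ^ m * (LINT x|lborel. \<bar>g0 x\<bar>)))"
      proof (intro AE_I2)
        fix t
        have "\<bar>LINT x|lborel. norm (case_prod ?F (t, x))\<bar> \<le> (LINT x|lborel. indicator {0..1} t * (B ^ m * \<bar>g0 x\<bar>))"
          by (rule abs_integral_le) (use tame_integrable[OF g0] bnd in auto)
        then show "norm (LINT x|lborel. norm (case_prod ?F (t, x))) \<le> norm (indicator {0..1::real} t * (B ^ m * (LINT x|lborel. \<bar>g0 x\<bar>)))"
          using tame_nonneg[OF g0] unfolding real_norm_def by (simp add: abs_mult)
      qed
      show "(\<lambda>t. LINT x|lborel. norm (case_prod ?F (t, x))) \<in> borel_measurable lborel" by measurable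
    qed auto
  qed
  have "form m P l g0 g = (LINT t|lborel. LINT x|lborel. ?F t x)"
    unfolding form_def slice_def set_lebesgue_integral_def by simp
  also have "\<dots> = (LINT x|lborel. LINT t|lborel. ?F t x)"
    using lborel_pair.Fubini_integral[OF int] by simp
  also have "\<dots> = (LINT x|lborel. g0 x * (LINT t:{0..1}|lborel. \<Prod>i=1..m. g i (x - poly (P i) (t / 2 ^ l))))"
    unfolding set_lebesgue_integral_def
    by (simp add: mult.left_commute[of "indicator _ _"])
  finally show ?thesis .
qed

text \<open>L1 against sup norm: \<open>g0\<close> gives one factor \<open>B\<close>, and each of
  the \<open>m\<close> norms on the right of the Sobolev estimate is at most
  \<open>2 * B\<close>.\<close>

lemma abs_form_le_sobolev:
  assumes S: "sobolev_estimate m P \<sigma> C" and m: "m \<ge> 1" and l: "real l \<ge> C" and N: "N > 0"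
    and g0: "tame B g0" and g: "\<And>i. i \<in> {1..m} \<Longrightarrow> tame B (g i)" and j: "j \<in> {1..m}"
    and v: "fourier_vanishes_on (\<lambda>x. complex_of_real (g j x)) {\<xi>. \<bar>\<xi>\<bar> \<le> N * 2 ^ (l * order 0 (P j))}"
  shows "\<bar>form m P l g0 g\<bar> \<le> 2 ^ m * C * B ^ (m + 1) * N powr (- \<sigma>)"
proof -
  have B: "0 \<le> B" using tame_nonneg[OF g0] .
  have C: "0 < C" using S by (auto simp: sobolev_estimate_def)
  let ?T = "\<lambda>x. LINT t:{0..1}|lborel. \<Prod>i=1..m. g i (x - poly (P i) (t / 2 ^ l))"
  let ?f = "\<lambda>i x. complex_of_real (g i x)"
  let ?R = "C * N powr (- \<sigma>) * (\<Prod>i=1..m. Lp_norm (real m) (?f i))"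
  have c: "(LINT t:{0..1}|lborel. (\<Prod>i=1..m. ?f i (x - poly (P i) (t / 2 ^ l)))) = complex_of_real (?T x)" for x
    unfolding set_lebesgue_integral_def
    by (simp add: scaleR_conv_of_real flip: of_real_prod of_real_mult)
  have "(\<integral>\<^sup>+x. norm (LINT t:{0..1}|lborel. (\<Prod>i=1..m. ?f i (x - poly (P i) (t / 2 ^ l)))) \<partial>lborel) \<le> ennreal ?R"
  proof -
    have *: "\<And>(l::nat) (N::real) (f :: nat \<Rightarrow> real \<Rightarrow> complex).
        real l \<ge> C \<Longrightarrow> N > 0 \<Longrightarrow> (\<forall>i\<in>{1..m}. in_Lp (real m) (f i)) \<Longrightarrow>
        (\<exists>i\<in>{1..m}. fourier_vanishes_on (f i) {\<xi>. \<bar>\<xi>\<bar> \<le> N * 2 ^ (l * order 0 (P i))}) \<Longrightarrow>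
        (\<integral>\<^sup>+x. norm (LINT t:{0..1}|lborel. (\<Prod>i=1..m. f i (x - poly (P i) (t / 2 ^ l)))) \<partial>lborel)
          \<le> ennreal (C * N powr (- \<sigma>) * (\<Prod>i=1..m. Lp_norm (real m) (f i)))"
      using S by (simp only: sobolev_estimate_def)
    show ?thesis
      by (rule *[OF l N]) (use tame_Lp(1)[OF g m] in simp, rule bexI[OF _ j], rule v)
  qed
  then have T: "(\<integral>\<^sup>+x. ennreal \<bar>?T x\<bar> \<partial>lborel) \<le> ennreal ?R" unfolding c by simp
  have R: "?R \<le> C * N powr (- \<sigma>) * (2 * B) ^ m"
  proof -
    have "(\<Prod>i=1..m. Lp_norm (real m) (?f i)) \<le> (\<Prod>i=1..m. 2 * B)"
      by (intro prod_mono conjI tame_Lp[OF g m])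
    then show ?thesis using C by (intro mult_left_mono) auto
  qed
  note [measurable] = tame_measurable[OF g]
  have [measurable]: "?T \<in> borel_measurable borel"
    unfolding set_lebesgue_integral_def by measurable
  have R0: "0 \<le> ?R" using C by (intro mult_nonneg_nonneg prod_nonneg tame_Lp(3)[OF g m]) auto
  note iT = integrable_if_nn_integral_le[OF _ T R0]
  have sw: "form m P l g0 g = (LINT x|lborel. g0 x * ?T x)" by (rule form_swap[OF g0 g])
  have iT1: "integrable lborel ?T" by (rule iT(1)) measurable
  have iT2: "(LINT x|lborel. \<bar>?T x\<bar>) \<le> ?R" by (rule iT(2)) measurable
  have "\<bar>form m P l g0 g\<bar> \<le> (LINT x|lborel. B * \<bar>?T x\<bar>)"
    unfolding sw
  proof (rule abs_integral_le)
    show "integrable lborel (\<lambda>x. B * \<bar>?T x\<bar>)" using integrable_abs[OF iT1] by (rule integrable_mult_right)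
    show "\<bar>g0 x * ?T x\<bar> \<le> B * \<bar>?T x\<bar>" for x
      unfolding abs_mult by (intro mult_right_mono tame_abs_le[OF g0] abs_ge_zero)
  qed
  also have "\<dots> = B * (LINT x|lborel. \<bar>?T x\<bar>)" by simp
  also have "\<dots> \<le> B * (C * N powr (- \<sigma>) * (2 * B) ^ m)"
    by (intro mult_left_mono B order_trans[OF iT2 R])
  finally show ?thesis by (simp add: power_mult_distrib) (simp only: mult_ac)
qed

text \<open>Transfers the Sobolev gain from Fourier localisation to dyadic cancellation: the low
  frequencies of a function with cancellation at scale \<open>2\<^sup>-\<^sup>k\<close> are small in \<open>L\<^sup>1\<close>.\<close>

lemma abs_form_le_cancels:
  assumes S: "sobolev_estimate m P \<sigma> C" and m: "m \<ge> 1" and l: "real l \<ge> C"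
    and g0: "tame B g0" and g: "\<And>i. i \<in> {1..m} \<Longrightarrow> tame B (g i)" and j: "j \<in> {1..m}"
    and cn: "cancels k (g j)" and k: "l * order 0 (P j) \<le> k"
  shows "\<bar>form m P l g0 g\<bar> \<le> (8 ^ m * 4 * C + 280 * pi) * B ^ (m + 1) * 2 powr (- (min \<sigma> 1 / 2) * real (k - l * order 0 (P j)))"
proof -
  have B: "0 \<le> B" using tame_nonneg[OF g0] .
  have C: "0 < C" and s: "0 < \<sigma>" using S by (auto simp: sobolev_estimate_def)
  let ?q = "l * order 0 (P j)" and ?s = "min \<sigma> 1 / 2"
  define r where "r = real (k - ?q)"
  \<comment> \<open>The frequency cut balances two errors: the part above it gains
    \<open>N powr (- \<sigma>)\<close>, the part below it costs \<open>M / 2 ^ k\<close>, which is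
    \<open>1 / N\<close>. Each gets half of the \<open>r\<close> spare levels, whence the exponent
    \<open>min \<sigma> 1 / 2\<close>.\<close>
  define N where "N = 2 powr (r / 2)"
  define M where "M = N * 2 ^ ?q"
  have N: "N > 0" "M > 0" by (auto simp: N_def M_def)
  let ?D = "g j" and ?L = "smooth M (g j)"
  have D: "tame B ?D" using g j .
  have L: "tame (3 * B) ?L" by (rule tame_smooth[OF D N(2)])
  have g4: "tame (4 * B) (g i)" if "i \<in> {1..m}" for i using tame_mono[OF g[OF that]] B by simp
  have g04: "tame (4 * B) g0" and L4: "tame (4 * B) ?L" using tame_mono[OF g0] tame_mono[OF L] B by simp_all
  \<comment> \<open>\<open>B\<close> from the function and \<open>3 * B\<close> from its smoothing.
    All factors are relaxed to this common bound, which is the origin of the constant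
    \<open>8 ^ m * 4\<close>.\<close>
  have H: "tame (4 * B) (\<lambda>x. ?D x - ?L x)"
  proof -
    have "\<bar>?D x - ?L x\<bar> \<le> 4 * B" for x using tame_abs_le[OF D, of x] tame_abs_le[OF L, of x] by linarith
    moreover have "(LINT x|lborel. \<bar>?D x - ?L x\<bar>) \<le> (LINT x|lborel. \<bar>?D x\<bar> + \<bar>?L x\<bar>)"
      using tame_integrable[OF D] tame_integrable[OF L] by (intro integral_mono) auto
    moreover have "\<dots> \<le> 2 * (4 * B)"
      using tame_integrable[OF D] tame_integrable[OF L] tame_integral[OF D] tame_integral[OF L] by simp
    ultimately show ?thesis
      using tame_integrable[OF D] tame_integrable[OF L] tame_measurable[OF D] tame_measurable[OF L]
      unfolding tame_def by auto
  qed
  have "form m P l g0 (g(j := \<lambda>x. ?D x - ?L x)) = form m P l g0 (g(j := ?D)) - form m P l g0 (g(j := ?L))"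
    using g4 j by (intro form_diff[where B="4 * B"] g04 L4) auto
  then have split: "form m P l g0 g = form m P l g0 (g(j := \<lambda>x. ?D x - ?L x)) + form m P l g0 (g(j := ?L))"
    by simp
  have e1: "\<bar>form m P l g0 (g(j := \<lambda>x. ?D x - ?L x))\<bar> \<le> 2 ^ m * C * (4 * B) ^ (m + 1) * N powr (- \<sigma>)"
  proof (rule abs_form_le_sobolev[OF S m l N(1) g04])
    show "tame (4 * B) ((g(j := \<lambda>x. ?D x - ?L x)) i)" if "i \<in> {1..m}" for i
      using g4[OF that] H by simp
    show "fourier_vanishes_on (\<lambda>x. complex_of_real ((g(j := \<lambda>x. ?D x - ?L x)) j x)) {\<xi>. \<bar>\<xi>\<bar> \<le> N * 2 ^ ?q}"
      using fourier_vanishes_smooth[OF D N(2)] by (simp add: M_def)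
  qed (rule j)
  have e2: "\<bar>form m P l g0 (g(j := ?L))\<bar> \<le> B ^ m * (280 * pi * M / 2 ^ k * B)"
  proof (rule abs_form_le)
    fix t
    have "\<bar>slice m P g0 (g(j := ?L)) (t / 2 ^ l)\<bar> \<le> B ^ m * (LINT x|lborel. \<bar>(g(j := ?L)) j x\<bar>)"
    proof (rule abs_slice_le[OF j])
      show "\<bar>(g(j := ?L)) i x\<bar> \<le> B" if "i \<in> {1..m} - {j}" for i x
        using tame_abs_le[OF g] that by simp
    qed (use tame_abs_le[OF g0] tame_integrable[OF L] in auto)
    also have "\<dots> \<le> B ^ m * (280 * pi * M / 2 ^ k * B)"
      using integral_smooth_cancels[OF D cn N(2)] B by (intro mult_left_mono) auto
    finally show "\<bar>slice m P g0 (g(j := ?L)) (t / 2 ^ l)\<bar> \<le> B ^ m * (280 * pi * M / 2 ^ k * B)" .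
  qed
  have r0: "0 \<le> r" by (simp add: r_def)
  have m1: "min \<sigma> 1 * r \<le> \<sigma> * r" and m2: "min \<sigma> 1 * r \<le> 1 * r"
    using r0 by (intro mult_right_mono; simp)+
  have n1: "N powr (- \<sigma>) \<le> 2 powr (- ?s * r)"
    unfolding N_def powr_powr using m1 by (intro powr_mono) (auto simp: field_simps)
  have "M / 2 ^ k = 2 powr (r / 2) * 2 powr real ?q / 2 powr real k"
    unfolding M_def N_def by (simp only: powr_realpow zero_less_numeral)
  also have "\<dots> = 2 powr (r / 2 + real ?q - real k)"
    by (simp only: powr_add powr_diff)
  also have "r / 2 + real ?q - real k = - r / 2"
  proof -
    have "r = real k - real ?q" using k by (simp only: r_def of_nat_diff)
    then show ?thesis by (simp only: field_simps) simp
  qed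
  also have "2 powr (- r / 2) \<le> 2 powr (- ?s * r)"
    using m2 by (intro powr_mono) (auto simp: field_simps)
  finally have n2: "M / 2 ^ k \<le> 2 powr (- ?s * r)" .
  have p8: "(8::real) ^ m = 2 ^ m * 4 ^ m" by (simp flip: power_mult_distrib)
  have "\<bar>form m P l g0 g\<bar> \<le> 2 ^ m * C * (4 * B) ^ (m + 1) * N powr (- \<sigma>) + B ^ m * (280 * pi * M / 2 ^ k * B)"
    unfolding split using e1 e2 abs_triangle_ineq[of "form m P l g0 (g(j := \<lambda>x. ?D x - ?L x))" "form m P l g0 (g(j := ?L))"]
    by linarith
  also have "\<dots> = 8 ^ m * 4 * C * B ^ (m + 1) * N powr (- \<sigma>) + 280 * pi * B ^ (m + 1) * (M / 2 ^ k)"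
  proof -
    have "(4 * B) ^ (m + 1) = 4 * 4 ^ m * B ^ (m + 1)" by (simp add: power_mult_distrib)
    moreover have "B ^ m * (280 * pi * M / 2 ^ k * B) = 280 * pi * B ^ (m + 1) * (M / 2 ^ k)" by simp
    ultimately show ?thesis unfolding p8 by (simp only: mult_ac)
  qed
  also have "\<dots> \<le> 8 ^ m * 4 * C * B ^ (m + 1) * 2 powr (- ?s * r) + 280 * pi * B ^ (m + 1) * 2 powr (- ?s * r)"
    using B C n1 n2 by (intro add_mono mult_left_mono) auto
  finally show ?thesis unfolding r_def by (simp only: distrib_right)
qed

section \<open>Dyadic masses and densities\<close>

definition cell :: "nat \<Rightarrow> int \<Rightarrow> real set" where
  "cell k i = {x. \<lfloor>2 ^ k * x\<rfloor> = i}"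

lemma floor_dyadic_div:
  fixes x :: real
  assumes "k \<le> k'" shows "\<lfloor>2 ^ k * x\<rfloor> = \<lfloor>2 ^ k' * x\<rfloor> div 2 ^ (k' - k)"
proof -
  have "2 ^ k * x = 2 ^ k' * x / real_of_int (2 ^ (k' - k))"
    using assms by (simp add: field_simps flip: power_add)
  then show ?thesis by (simp only: floor_divide_real_eq_div zero_le_numeral zero_le_power)
qed

lemma cell_eq: "cell k i = {of_int i / 2 ^ k ..< (of_int i + 1) / 2 ^ k}"
  by (auto simp: cell_def floor_eq_iff field_simps)

lemma diameter_cell: "diameter (cell k i) \<le> 1 / 2 ^ k"
proof -
  have "diameter (cell k i) \<le> diameter {of_int i / 2 ^ k .. (of_int i + 1) / 2 ^ k :: real}"
    by (rule diameter_subset) (auto simp: cell_eq)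
  also have "\<dots> = 1 / 2 ^ k"
    by (subst diameter_closed_interval) (auto simp: field_simps)
  finally show ?thesis .
qed

lemma bounded_cell: "bounded (cell k i)"
  unfolding cell_eq by (rule bounded_subset[OF bounded_closed_interval[of "of_int i / 2 ^ k" "(of_int i + 1) / 2 ^ k"]]) auto

lemma cell_split: "cell k i = cell (Suc k) (2 * i) \<union> cell (Suc k) (2 * i + 1)"
  using floor_dyadic_div[of k "Suc k"] by (auto simp: cell_def)

section \<open>Frostman masses by a flow on the dyadic tree\<close>

lemma hausdorff_content_le_finite:
  assumes "finite F" "A \<subseteq> (\<Union>f\<in>F. c f)" "\<And>f. f \<in> F \<Longrightarrow> bounded (c f)"
  shows "hausdorff_content s A \<le> (\<Sum>f\<in>F. ennreal (diameter (c f) powr s))"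
proof -
  obtain xs where xs: "set xs = F" "distinct xs" using finite_distinct_list[OF assms(1)] by blast
  define U where "U j = (if j < length xs then c (xs ! j) else {})" for j
  have "hausdorff_content s A \<le> (\<Sum>j. ennreal (diameter (U j) powr s))"
    unfolding hausdorff_content_def
  proof (rule INF_lower, safe)
    show "bounded (U j)" for j using assms(3) xs(1) by (auto simp: U_def)
    fix x assume "x \<in> A"
    then obtain f where "f \<in> F" "x \<in> c f" using assms(2) by blast
    then obtain j where "j < length xs" "xs ! j = f" using xs(1) by (metis in_set_conv_nth)
    with \<open>x \<in> c f\<close> show "x \<in> (\<Union>j. U j)" by (auto simp: U_def intro!: exI[of _ j])
  qed
  also have "\<dots> = (\<Sum>j<length xs. ennreal (diameter (U j) powr s))"
    by (rule suminf_finite) (auto simp: U_def diameter_def)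
  also have "\<dots> = (\<Sum>j<length xs. ennreal (diameter (c (xs ! j)) powr s))"
    by (simp add: U_def)
  also have "\<dots> = (\<Sum>f\<in>F. ennreal (diameter (c f) powr s))"
    using xs by (subst sum.reindex_bij_betw[OF bij_betw_nth[OF xs(2) refl xs(1)[symmetric]], symmetric]) simp
  finally show ?thesis .
qed

text \<open>Max-flow/min-cut form of Frostman's lemma on the dyadic tree: \<open>capacity\<close> is the value of the
  minimal cut below a vertex, and \<open>flow\<close> distributes it downwards proportionally.\<close>

primrec capacity :: "nat \<Rightarrow> real \<Rightarrow> (int \<Rightarrow> bool) \<Rightarrow> nat \<Rightarrow> int \<Rightarrow> real" where
  "capacity K s H 0 i = (if H i then 2 powr (- s * real K) else 0)"
| "capacity K s H (Suc n) i = min (2 powr (- s * real (K - Suc n)))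
     (capacity K s H n (2 * i) + capacity K s H n (2 * i + 1))"

primrec flow :: "nat \<Rightarrow> real \<Rightarrow> (int \<Rightarrow> bool) \<Rightarrow> nat \<Rightarrow> int \<Rightarrow> real" where
  "flow K s H 0 j = (if j \<in> {0, 1} then capacity K s H K j else 0)"
| "flow K s H (Suc k) j = flow K s H k (j div 2) * (capacity K s H (K - Suc k) j /
     (capacity K s H (K - Suc k) (2 * (j div 2)) + capacity K s H (K - Suc k) (2 * (j div 2) + 1)))"

lemma capacity_nonneg: "0 \<le> capacity K s H n i"
  by (induction n arbitrary: i) auto

lemma capacity_le: "n \<le> K \<Longrightarrow> capacity K s H n i \<le> 2 powr (- s * real (K - n))"
  by (cases n) auto

text \<open>A minimal cut is a cover. Height \<open>n\<close> above the leaves means level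
  \<open>K - n\<close>. If the minimum is attained by the vertex's own bound, the cell covers
  itself; otherwise the covers of its two halves are united.\<close>

lemma capacity_cover:
  assumes H: "\<And>x. x \<in> A \<Longrightarrow> H \<lfloor>2 ^ K * x\<rfloor>" and "n \<le> K"
  shows "\<exists>F. finite F \<and> A \<inter> cell (K - n) i \<subseteq> (\<Union>(k, j)\<in>F. cell k j) \<and>
      (\<Sum>(k, j)\<in>F. 2 powr (- s * real k)) \<le> capacity K s H n i"
  using assms(2)
proof (induction n arbitrary: i)
  case 0
  show ?case
  proof (cases "H i")
    case True then show ?thesis by (intro exI[of _ "{(K, i)}"]) auto
  next
    case False
    then have "A \<inter> cell K i = {}" using H by (auto simp: cell_def)
    then show ?thesis using False by (intro exI[of _ "{}"]) auto
  qed
next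
  case (Suc n)
  then have sk: "Suc (K - Suc n) = K - n" and nK: "n \<le> K" by simp_all
  obtain F1 where F1: "finite F1" "A \<inter> cell (K - n) (2 * i) \<subseteq> (\<Union>(k, j)\<in>F1. cell k j)"
      "(\<Sum>(k, j)\<in>F1. 2 powr (- s * real k)) \<le> capacity K s H n (2 * i)"
    using Suc.IH[OF nK, of "2 * i"] by (elim exE conjE) (rule that)
  obtain F2 where F2: "finite F2" "A \<inter> cell (K - n) (2 * i + 1) \<subseteq> (\<Union>(k, j)\<in>F2. cell k j)"
      "(\<Sum>(k, j)\<in>F2. 2 powr (- s * real k)) \<le> capacity K s H n (2 * i + 1)"
    using Suc.IH[OF nK, of "2 * i + 1"] by (elim exE conjE) (rule that)
  show ?case
  proof (cases "2 powr (- s * real (K - Suc n)) \<le> capacity K s H n (2 * i) + capacity K s H n (2 * i + 1)")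
    case True then show ?thesis by (intro exI[of _ "{(K - Suc n, i)}"]) auto
  next
    case False
    \<comment> \<open>The two covers come from existence statements and may overlap, so only an
      inequality is available.\<close>
    have "(\<Sum>(k, j)\<in>F1 \<union> F2. 2 powr (- s * real k)) \<le> (\<Sum>(k, j)\<in>F1. 2 powr (- s * real k)) + (\<Sum>(k, j)\<in>F2. 2 powr (- s * real k))"
      using sum.union_inter[OF F1(1) F2(1), of "\<lambda>(k, j). 2 powr (- s * real k)"]
        sum_nonneg[of "F1 \<inter> F2" "\<lambda>(k, j). 2 powr (- s * real k)"] by (simp add: case_prod_beta)
    moreover have "A \<inter> cell (K - Suc n) i \<subseteq> (\<Union>(k, j)\<in>F1 \<union> F2. cell k j)"
      using F1(2) F2(2) unfolding cell_split[of "K - Suc n"] sk by blast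
    moreover have "capacity K s H (Suc n) i = capacity K s H n (2 * i) + capacity K s H n (2 * i + 1)"
      using False by simp
    ultimately show ?thesis
      using F1(1,3) F2(1,3) by (intro exI[of _ "F1 \<union> F2"] conjI finite_UnI) linarith+
  qed
qed

text \<open>The flow into a vertex is at most its capacity, hence at most the sum of the capacities
  of its children; a share proportional to the capacity of a child cannot exceed that
  capacity.\<close>

lemma flow_bounds: "k \<le> K \<Longrightarrow> 0 \<le> flow K s H k i \<and> flow K s H k i \<le> capacity K s H (K - k) i"
proof (induction k arbitrary: i)
  case 0 then show ?case by (auto simp: capacity_nonneg)
next
  case (Suc k)
  let ?c = "capacity K s H (K - Suc k)" and ?i = "i div 2"
  let ?S = "?c (2 * ?i) + ?c (2 * ?i + 1)"
  have S: "0 \<le> ?S" by (simp add: capacity_nonneg)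
  have "K - k = Suc (K - Suc k)" using Suc.prems by simp
  then have "flow K s H k ?i \<le> ?S" "0 \<le> flow K s H k ?i" using Suc.IH[of ?i] Suc.prems by auto
  then have "flow K s H k ?i * (?c i / ?S) \<le> ?S * (?c i / ?S)"
    using S by (intro mult_right_mono divide_nonneg_nonneg capacity_nonneg)
  also have "\<dots> \<le> ?c i" using capacity_nonneg[of K s H "K - Suc k" i] by auto
  finally show ?case using \<open>0 \<le> flow K s H k ?i\<close> S capacity_nonneg[of K s H "K - Suc k" i] by simp
qed

text \<open>The index range describes the cells inside [0, 2). There are two roots because the end
  point 1 of the unit interval lies in the second unit cell.\<close>

locale mass_tree =
  fixes K :: nat and W :: "nat \<Rightarrow> int \<Rightarrow> real"
  assumes mass_split: "k < K \<Longrightarrow> W k i = W (Suc k) (2 * i) + W (Suc k) (2 * i + 1)"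
    and mass_nonneg: "k \<le> K \<Longrightarrow> 0 \<le> W k i"
    and mass_support: "k \<le> K \<Longrightarrow> W k i \<noteq> 0 \<Longrightarrow> 0 \<le> i \<and> i < 2 ^ Suc k"

text \<open>The mass at the two roots is the value of the minimal cut, and that cut is an explicit
  cover by cells of diameter at most \<open>1 / 2 ^ k\<close>; so it dominates the content.\<close>

lemma frostman_tree:
  assumes s: "s > 0" and A: "A \<subseteq> {0..1}"
  obtains W where "mass_tree K W" "\<And>k i. k \<le> K \<Longrightarrow> W k i \<le> 2 powr (- s * real k)"
    "\<And>i. W K i \<noteq> 0 \<Longrightarrow> cell K i \<inter> A \<noteq> {}" "hausdorff_content s A \<le> ennreal (W 0 0 + W 0 1)"
proof -
  define H where "H i \<longleftrightarrow> cell K i \<inter> A \<noteq> {}" for i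
  define W where "W = flow K s H"
  have W: "0 \<le> W k i" "W k i \<le> capacity K s H (K - k) i" if "k \<le> K" for k i
    using flow_bounds[OF that] by (auto simp: W_def)
  show thesis
  proof (rule that)
    show "mass_tree K W"
    proof
      fix k i assume k: "k < K"
      let ?c = "capacity K s H (K - Suc k)"
      have e: "K - k = Suc (K - Suc k)" using k by simp
      have c: "0 \<le> ?c (2 * i)" "0 \<le> ?c (2 * i + 1)" by (rule capacity_nonneg)+
      show "W k i = W (Suc k) (2 * i) + W (Suc k) (2 * i + 1)"
      \<comment> \<open>With no capacity below, the shares are 0 / 0 = 0; but then the capacity of
        the vertex, and with it the flow, is 0 as well.\<close>
      proof (cases "?c (2 * i) + ?c (2 * i + 1) = 0")
        case True
        then have "W k i = 0" using W[of k i] k unfolding e by simp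
        then show ?thesis by (simp add: W_def)
      next
        case False
        then show ?thesis by (simp add: W_def flip: distrib_left add_divide_distrib)
      qed
    next
      fix k i
      show "0 \<le> W k i" if "k \<le> K" using W(1) that .
      show "0 \<le> i \<and> i < 2 ^ Suc k" if "W k i \<noteq> 0" for i
        using that
      proof (induction k arbitrary: i)
        case (Suc k)
        then have "W k (i div 2) \<noteq> 0" by (auto simp: W_def)
        from Suc.IH[OF this] show ?case unfolding power_Suc by linarith
      qed (auto simp: W_def split: if_splits)
    qed
  next
    fix k i assume k: "k \<le> K"
    show "W k i \<le> 2 powr (- s * real k)"
      using W(2)[OF k, of i] capacity_le[of "K - k" K s H i] k by simp
  next
    fix i assume "W K i \<noteq> 0"
    then have "H i" using W[of K i] by (auto split: if_splits)
    then show "cell K i \<inter> A \<noteq> {}" by (simp add: H_def)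
  next
    have HA: "x \<in> A \<Longrightarrow> H \<lfloor>2 ^ K * x\<rfloor>" for x by (auto simp: H_def cell_def)
    obtain F0 where F0: "finite F0" "A \<inter> cell 0 0 \<subseteq> (\<Union>(k, j)\<in>F0. cell k j)"
      "(\<Sum>(k, j)\<in>F0. 2 powr (- s * real k)) \<le> W 0 0"
      using capacity_cover[where A=A and H=H and n=K and s=s and i=0, OF HA order_refl] by (auto simp: W_def)
    obtain F1 where F1: "finite F1" "A \<inter> cell 0 1 \<subseteq> (\<Union>(k, j)\<in>F1. cell k j)"
      "(\<Sum>(k, j)\<in>F1. 2 powr (- s * real k)) \<le> W 0 1"
      using capacity_cover[where A=A and H=H and n=K and s=s and i=1, OF HA order_refl] by (auto simp: W_def)
    let ?F = "F0 \<union> F1" and ?f = "\<lambda>p. 2 powr (- s * real (fst p))"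
    have "x \<in> cell 0 0 \<union> cell 0 1" if "x \<in> A" for x
      using A that by (force simp: cell_eq)
    then have cov: "A \<subseteq> (\<Union>p\<in>?F. cell (fst p) (snd p))" using F0(2) F1(2) by (fastforce simp: case_prod_beta)
    have "hausdorff_content s A \<le> (\<Sum>p\<in>?F. ennreal (diameter (cell (fst p) (snd p)) powr s))"
      using F0(1) F1(1) cov bounded_cell by (intro hausdorff_content_le_finite) auto
    also have "\<dots> \<le> (\<Sum>p\<in>?F. ennreal (?f p))"
    proof (intro sum_mono ennreal_leI)
      fix p
      have "diameter (cell (fst p) (snd p)) powr s \<le> (1 / 2 ^ fst p) powr s"
        using diameter_cell s by (intro powr_mono2) (auto intro: diameter_ge_0 bounded_cell)
      also have "1 / 2 ^ fst p = 2 powr (- real (fst p))" by (simp add: powr_minus powr_realpow divide_inverse)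
      finally show "diameter (cell (fst p) (snd p)) powr s \<le> ?f p" by (simp add: powr_powr mult.commute)
    qed
    also have "\<dots> = ennreal (\<Sum>p\<in>?F. ?f p)" by (rule sum_ennreal) simp
    also have "\<dots> \<le> ennreal (W 0 0 + W 0 1)"
    proof (rule ennreal_leI)
      have "sum ?f ?F \<le> sum ?f F0 + sum ?f F1"
        using sum.union_inter[OF F0(1) F1(1), of ?f] sum_nonneg[of "F0 \<inter> F1" ?f] by auto
      then show "sum ?f ?F \<le> W 0 0 + W 0 1" using F0(3) F1(3) by (auto simp: case_prod_beta)
    qed
    finally show "hausdorff_content s A \<le> ennreal (W 0 0 + W 0 1)" .
  qed
qed

section \<open>Integrals of dyadic step functions and neighbourhoods of grids\<close>

lemma sum_even_odd:
  fixes g :: "int \<Rightarrow> 'a :: comm_monoid_add"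
  shows "(\<Sum>i\<in>{0..<2 * n}. g i) = (\<Sum>i\<in>{0..<n}. g (2 * i) + g (2 * i + 1))"
proof -
  have "x \<in> (\<lambda>i. 2 * i) ` {0..<n} \<union> (\<lambda>i. 2 * i + 1) ` {0..<n}" if "x \<in> {0..<2 * n}" for x :: int
  proof (cases "even x")
    case True
    then obtain y where "x = 2 * y" by (elim evenE)
    with that show ?thesis by auto
  next
    case False
    then obtain y where "x = 2 * y + 1" by (elim oddE)
    with that show ?thesis by auto
  qed
  then have "{0..<2 * n} \<subseteq> (\<lambda>i. 2 * i) ` {0..<n} \<union> (\<lambda>i. 2 * i + 1) ` {0..<n}" by (rule subsetI)
  moreover have "(\<lambda>i. 2 * i) ` {0..<n} \<union> (\<lambda>i. 2 * i + 1) ` {0..<n} \<subseteq> {0..<2 * n}" by auto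
  ultimately have "{0..<2 * n} = (\<lambda>i. 2 * i) ` {0..<n} \<union> (\<lambda>i. 2 * i + 1) ` {0..<n}" by (rule subset_antisym)
  moreover have "2 * i \<noteq> 2 * j + 1" for i j :: int by presburger
  ultimately have "(\<Sum>i\<in>{0..<2 * n}. g i) = sum g ((\<lambda>i. 2 * i) ` {0..<n}) + sum g ((\<lambda>i. 2 * i + 1) ` {0..<n})"
    by (simp only:) (intro sum.union_disjoint; force)
  then show ?thesis
    by (simp add: sum.reindex inj_on_def sum.distrib)
qed

lemma has_integral_step:
  fixes \<phi> :: "int \<Rightarrow> real" and n :: int
  assumes "\<And>i. \<phi> i \<noteq> 0 \<Longrightarrow> 0 \<le> i \<and> i < n"
  shows "has_bochner_integral lborel (\<lambda>y::real. \<phi> \<lfloor>2 ^ k * y\<rfloor>) ((\<Sum>i\<in>{0..<n}. \<phi> i) / 2 ^ k)"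
proof -
  have eq: "\<phi> \<lfloor>2 ^ k * y\<rfloor> = (\<Sum>i\<in>{0..<n}. \<phi> i * indicator (cell k i) y)" for y :: real
  proof -
    have "(\<Sum>i\<in>{0..<n}. \<phi> i * indicator (cell k i) y) = (\<Sum>i\<in>{0..<n}. if i = \<lfloor>2 ^ k * y\<rfloor> then \<phi> i else 0)"
      by (intro sum.cong) (auto simp: cell_def indicator_def)
    also have "\<dots> = \<phi> \<lfloor>2 ^ k * y\<rfloor>"
      using assms[of "\<lfloor>2 ^ k * y\<rfloor>"] by (auto simp: sum.delta)
    finally show ?thesis by simp
  qed
  have c: "has_bochner_integral lborel (indicator (cell k i) :: real \<Rightarrow> real) (1 / 2 ^ k)" for i
  proof -
    have "has_bochner_integral lborel (indicator (cell k i) :: real \<Rightarrow> real) (measure lborel (cell k i))"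
      by (rule has_bochner_integral_real_indicator) (auto simp: cell_eq divide_right_mono)
    also have "measure lborel (cell k i) = 1 / 2 ^ k"
      by (simp add: cell_eq divide_right_mono flip: diff_divide_distrib)
    finally show ?thesis .
  qed
  have "has_bochner_integral lborel (\<lambda>y::real. \<phi> \<lfloor>2 ^ k * y\<rfloor>) (\<Sum>i\<in>{0..<n}. \<phi> i * (1 / 2 ^ k))"
    unfolding eq by (intro has_bochner_integral_sum has_bochner_integral_mult_right c)
  then show ?thesis by (simp add: sum_divide_distrib)
qed

text \<open>The points less than \<open>\<theta>\<close> cell lengths to the right of a point of the
  grid shifted by \<open>p\<close>; they contain those whose cell changes under a small
  displacement.\<close>

definition near_grid :: "nat \<Rightarrow> real \<Rightarrow> real \<Rightarrow> real set" where
  "near_grid k p \<theta> = {y. 0 \<le> y \<and> y < 2 \<and> frac (2 ^ k * (y - p)) < \<theta>}"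

text \<open>At most 2 * 2^k + 2 grid points are relevant, which is at most 4 * 2^k, and each comes
  with an interval of length \<open>\<theta> / 2 ^ k\<close>.\<close>

lemma near_grid_integral:
  assumes "0 \<le> \<theta>"
  shows "integrable lborel (indicator (near_grid k p \<theta>) :: real \<Rightarrow> real)"
    and "(LINT y|lborel. indicator (near_grid k p \<theta>) y) \<le> 4 * \<theta>"
proof -
  define J where "J = {\<lfloor>2 ^ k * (0 - p)\<rfloor>..\<lfloor>2 ^ k * (2 - p)\<rfloor>}"
  define I where "I j = {p + of_int j / 2 ^ k ..< p + (of_int j + \<theta>) / 2 ^ k}" for j :: int
  have [measurable]: "near_grid k p \<theta> \<in> sets borel"
    unfolding near_grid_def frac_def by measurable
  have c: "real (card J) \<le> 2 * 2 ^ k + 2"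
  proof -
    have "real (card J) = real_of_int (\<lfloor>2 ^ k * (2 - p)\<rfloor> - \<lfloor>2 ^ k * (0 - p)\<rfloor> + 1)"
    proof -
      have "\<lfloor>2 ^ k * (0 - p)\<rfloor> \<le> \<lfloor>2 ^ k * (2 - p)\<rfloor>" by (intro floor_mono mult_left_mono) auto
      then show ?thesis by (simp add: J_def)
    qed
    moreover have "2 ^ k * (2 - p) = 2 * 2 ^ k + 2 ^ k * (0 - p)" by (simp add: algebra_simps)
    ultimately show ?thesis by linarith
  qed
  have le: "indicator (near_grid k p \<theta>) y \<le> (\<Sum>j\<in>J. indicator (I j) y :: real)" for y
  proof (cases "y \<in> near_grid k p \<theta>")
    case True
    let ?j = "\<lfloor>2 ^ k * (y - p)\<rfloor>"
    have "?j \<in> J" using True unfolding J_def near_grid_def atLeastAtMost_iff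
      by (intro conjI floor_mono mult_left_mono) auto
    moreover have "y \<in> I ?j"
    proof -
      have "of_int ?j \<le> 2 ^ k * (y - p)" "2 ^ k * (y - p) < of_int ?j + \<theta>"
        using True by (auto simp: near_grid_def frac_def)
      then show ?thesis by (simp add: I_def field_simps)
    qed
    ultimately have "(1::real) \<le> (\<Sum>j\<in>J. indicator (I j) y)"
      using member_le_sum[of ?j J "\<lambda>j. indicator (I j) y :: real"] by (auto simp: J_def)
    then show ?thesis using True by simp
  qed (auto intro: sum_nonneg)
  have i: "has_bochner_integral lborel (indicator (I j) :: real \<Rightarrow> real) (\<theta> / 2 ^ k)" for j
  proof -
    have "has_bochner_integral lborel (indicator (I j) :: real \<Rightarrow> real) (measure lborel (I j))"
      using assms by (intro has_bochner_integral_real_indicator) (auto simp: I_def divide_right_mono)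
    also have "measure lborel (I j) = \<theta> / 2 ^ k"
      using assms by (simp add: I_def divide_right_mono add_divide_distrib)
    finally show ?thesis .
  qed
  have s: "has_bochner_integral lborel (\<lambda>y. \<Sum>j\<in>J. indicator (I j) y :: real) (\<Sum>j\<in>J. \<theta> / 2 ^ k)"
    by (intro has_bochner_integral_sum i)
  show "integrable lborel (indicator (near_grid k p \<theta>) :: real \<Rightarrow> real)"
    by (rule Bochner_Integration.integrable_bound[OF integrable.intros[OF s]])
       (use le in \<open>auto intro!: AE_I2 order_trans[OF _ abs_ge_self]\<close>)
  have "(LINT y|lborel. indicator (near_grid k p \<theta>) y) \<le> (LINT y|lborel. (\<Sum>j\<in>J. indicator (I j) y :: real))"
    by (rule integral_mono'[OF integrable.intros[OF s] le]) (simp add: sum_nonneg)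
  also have "\<dots> = real (card J) * (\<theta> / 2 ^ k)"
    using has_bochner_integral_integral_eq[OF s] by simp
  also have "\<dots> \<le> (4 * 2 ^ k) * (\<theta> / 2 ^ k)"
  proof (rule mult_right_mono)
    have "(1::real) \<le> 2 ^ k" by simp
    then show "real (card J) \<le> 4 * 2 ^ k" using c by linarith
  qed (use assms in auto)
  finally show "(LINT y|lborel. indicator (near_grid k p \<theta>) y) \<le> 4 * \<theta>" by simp
qed

lemma frac_less_if_floor_neq:
  assumes "y' \<le> y" "\<lfloor>2 ^ k * y'\<rfloor> \<noteq> \<lfloor>2 ^ k * y\<rfloor>"
  shows "frac (2 ^ k * y) < 2 ^ k * (y - y' :: real)"
proof -
  have "2 ^ k * y' \<le> 2 ^ k * y" using assms by simp
  then have "\<lfloor>2 ^ k * y'\<rfloor> < \<lfloor>2 ^ k * y\<rfloor>" using assms(2) floor_mono le_neq_trans by blast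
  then have "2 ^ k * y' < of_int \<lfloor>2 ^ k * y\<rfloor>" by (simp add: floor_less_iff)
  then show ?thesis by (simp add: frac_def right_diff_distrib)
qed

lemma tameI:
  assumes [measurable]: "g \<in> borel_measurable borel"
    and b: "\<And>x. \<bar>g x\<bar> \<le> B" and z: "\<And>x. x \<notin> {0..<2} \<Longrightarrow> g x = 0"
  shows "tame B g"
proof -
  have le: "\<bar>g x\<bar> \<le> B * indicator {0..<2} x" for x
    using b[of x] z[of x] by (cases "x \<in> {0..<2}") auto
  have i: "integrable lborel (\<lambda>x::real. B * indicator {0..<2} x)"
    by (intro integrable_mult_right integrable_real_indicator) auto
  have gi: "integrable lborel g"
    by (rule Bochner_Integration.integrable_bound[OF i])
       (use le in \<open>auto intro!: AE_I2 order_trans[OF _ abs_ge_self]\<close>)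
  moreover have "(LINT x|lborel. \<bar>g x\<bar>) \<le> (LINT x|lborel. B * indicator {0..<2::real} x)"
    using gi i le by (intro integral_mono) auto
  ultimately show ?thesis using b by (simp add: tame_def mult.commute)
qed

section \<open>The density martingale\<close>

context mass_tree
begin

definition dens :: "nat \<Rightarrow> real \<Rightarrow> real" where
  "dens k x = 2 ^ k * W k \<lfloor>2 ^ k * x\<rfloor>"

lemma dens_nonneg: "k \<le> K \<Longrightarrow> 0 \<le> dens k x"
  by (simp add: dens_def mass_nonneg)

lemma borel_measurable_dens [measurable]: "dens k \<in> borel_measurable borel"
  unfolding dens_def by measurable

lemma dens_outside: "k \<le> K \<Longrightarrow> x \<notin> {0..<2} \<Longrightarrow> dens k x = 0"
proof (rule ccontr)
  assume k: "k \<le> K" and x: "x \<notin> {0..<2}" and "dens k x \<noteq> 0"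
  then have f: "0 \<le> \<lfloor>2 ^ k * x\<rfloor>" "\<lfloor>2 ^ k * x\<rfloor> < 2 ^ Suc k"
    using mass_support[OF k, of "\<lfloor>2 ^ k * x\<rfloor>"] by (auto simp: dens_def)
  from f(1) have "0 \<le> 2 ^ k * x" by simp
  then have "0 \<le> x" by (simp only: zero_le_mult_iff) (use zero_less_power[of "2::real" k] in linarith)
  moreover have "x < 2"
  proof -
    have "2 ^ k * x < of_int (2 ^ Suc k)" using f(2) unfolding floor_less_iff .
    then show ?thesis by simp
  qed
  ultimately show False using x by simp
qed

lemma has_integral_dens_mult:
  assumes "k \<le> K"
  shows "has_bochner_integral lborel (\<lambda>y. dens k y * \<psi> \<lfloor>2 ^ k * y\<rfloor>) (\<Sum>i\<in>{0..<2 ^ Suc k}. W k i * \<psi> i)"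
proof -
  have "has_bochner_integral lborel (\<lambda>y::real. (\<lambda>i. 2 ^ k * W k i * \<psi> i) \<lfloor>2 ^ k * y\<rfloor>)
      ((\<Sum>i\<in>{0..<2 ^ Suc k}. 2 ^ k * W k i * \<psi> i) / 2 ^ k)"
    by (rule has_integral_step) (use mass_support[OF assms] in auto)
  then show ?thesis by (simp add: dens_def sum_divide_distrib)
qed

text \<open>The martingale property: a function of the coarse cell takes the same value on sibling
  cells, whose masses add up by \<open>mass_split\<close>.\<close>

lemma integral_dens_Suc:
  assumes "Suc k \<le> K"
  shows "(LINT y|lborel. dens (Suc k) y * \<psi> \<lfloor>2 ^ k * y\<rfloor>) = (LINT y|lborel. dens k y * \<psi> \<lfloor>2 ^ k * y\<rfloor>)"
proof -
  have f: "\<lfloor>2 ^ k * y\<rfloor> = \<lfloor>2 ^ Suc k * y\<rfloor> div 2" for y :: real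
    using floor_dyadic_div[of k "Suc k" y] by simp
  have "(LINT y|lborel. dens (Suc k) y * \<psi> \<lfloor>2 ^ k * y\<rfloor>) = (\<Sum>i\<in>{0..<2 ^ Suc (Suc k)}. W (Suc k) i * \<psi> (i div 2))"
    unfolding f by (rule has_bochner_integral_integral_eq[OF has_integral_dens_mult[OF assms, of "\<lambda>i. \<psi> (i div 2)"]])
  also have "\<dots> = (\<Sum>i\<in>{0..<2 * 2 ^ Suc k}. W (Suc k) i * \<psi> (i div 2))" by simp
  also have "\<dots> = (\<Sum>i\<in>{0..<2 ^ Suc k}. W (Suc k) (2 * i) * \<psi> i + W (Suc k) (2 * i + 1) * \<psi> i)"
    unfolding sum_even_odd by (intro sum.cong) auto
  also have "\<dots> = (\<Sum>i\<in>{0..<2 ^ Suc k}. W k i * \<psi> i)"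
    using assms by (intro sum.cong) (auto simp: mass_split[of k] distrib_right)
  also have "\<dots> = (LINT y|lborel. dens k y * \<psi> \<lfloor>2 ^ k * y\<rfloor>)"
    using assms by (intro has_bochner_integral_integral_eq[symmetric] has_integral_dens_mult) simp
  finally show ?thesis .
qed

lemma integral_dens_coarser:
  assumes "k \<le> k'" "k' \<le> K"
  shows "(LINT y|lborel. dens k' y * \<psi> \<lfloor>2 ^ k * y\<rfloor>) = (LINT y|lborel. dens k y * \<psi> \<lfloor>2 ^ k * y\<rfloor>)"
  using assms
proof (induction k' rule: dec_induct)
  case (step n)
  have "\<lfloor>2 ^ k * y\<rfloor> = \<lfloor>2 ^ n * y\<rfloor> div 2 ^ (n - k)" for y :: real
    using step by (intro floor_dyadic_div) simp
  then have "(LINT y|lborel. dens (Suc n) y * \<psi> \<lfloor>2 ^ k * y\<rfloor>) = (LINT y|lborel. dens n y * \<psi> \<lfloor>2 ^ k * y\<rfloor>)"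
    using integral_dens_Suc[OF step.prems, of "\<lambda>i. \<psi> (i div 2 ^ (n - k))"] by simp
  then show ?case using step by simp
qed simp

lemma integrable_dens_coarser:
  assumes "k \<le> k'" "k' \<le> K"
  shows "integrable lborel (\<lambda>y. dens k' y * \<psi> \<lfloor>2 ^ k * y\<rfloor>)"
proof -
  have f: "\<lfloor>2 ^ k * y\<rfloor> = \<lfloor>2 ^ k' * y\<rfloor> div 2 ^ (k' - k)" for y :: real
    using assms by (intro floor_dyadic_div)
  show ?thesis unfolding f
    by (rule integrable.intros[OF has_integral_dens_mult[OF assms(2), of "\<lambda>i. \<psi> (i div 2 ^ (k' - k))"]])
qed

lemma cancels_dens:
  assumes "k \<le> k'" "k' \<le> K"
  shows "cancels k (\<lambda>y. dens k' y - dens k y)"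
  unfolding cancels_def left_diff_distrib
  using integrable_dens_coarser[OF assms] integrable_dens_coarser[of k k] integral_dens_coarser[OF assms] assms
  by simp

lemma integral_dens:
  assumes "k \<le> K" shows "has_bochner_integral lborel (dens k) (W 0 0 + W 0 1)"
proof -
  have "integrable lborel (dens k)" using integrable_dens_coarser[of 0 k "\<lambda>_. 1"] assms by simp
  moreover have "(LINT y|lborel. dens k y) = (LINT y|lborel. dens 0 y)"
    using integral_dens_coarser[of 0 k "\<lambda>_. 1"] assms by simp
  moreover have "(LINT y|lborel. dens 0 y) = W 0 0 + W 0 1"
  proof -
    have "{0..<2::int} = {0, 1}" by auto
    then show ?thesis using has_bochner_integral_integral_eq[OF has_integral_dens_mult[of 0 "\<lambda>_. 1"]] by simp
  qed
  ultimately show ?thesis by (simp add: has_bochner_integral_iff)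
qed

lemma tame_dens: "k \<le> K \<Longrightarrow> (\<And>x. dens k x \<le> B) \<Longrightarrow> tame B (dens k)"
  by (intro tameI) (auto simp: dens_nonneg dens_outside)

text \<open>Both densities lie in [0, B], so their difference obeys the bound \<open>B\<close> and
  not only \<open>2 * B\<close>. Replacing one density by another thus leaves \<open>B\<close>
  unchanged.\<close>

lemma tame_dens_diff:
  assumes "k \<le> K" "k' \<le> K" "\<And>x. dens k x \<le> B" "\<And>x. dens k' x \<le> B"
  shows "tame B (\<lambda>x. dens k' x - dens k x)"
proof (rule tameI)
  show "\<bar>dens k' x - dens k x\<bar> \<le> B" for x
    using assms(3,4)[of x] dens_nonneg[OF assms(1), of x] dens_nonneg[OF assms(2), of x] by linarith
qed (use assms in \<open>auto simp: dens_outside\<close>)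

text \<open>Pythagoras for martingale increments: the coarse density is itself a function of the
  coarse cell, so it can be used as test function and the cross term equals its square.\<close>

lemma integral_dens_diff_sq:
  assumes "k \<le> k'" "k' \<le> K"
  shows "integrable lborel (\<lambda>y. (dens k y)\<^sup>2)"
    and "integrable lborel (\<lambda>y. (dens k' y - dens k y)\<^sup>2)"
    and "(LINT y|lborel. (dens k' y - dens k y)\<^sup>2) = (LINT y|lborel. (dens k' y)\<^sup>2) - (LINT y|lborel. (dens k y)\<^sup>2)"
proof -
  have sq: "integrable lborel (\<lambda>y. (dens k y)\<^sup>2)" if "k \<le> K" for k
    using integrable_dens_coarser[of k k "\<lambda>i. 2 ^ k * W k i"] that by (simp add: dens_def power2_eq_square)
  have cr: "integrable lborel (\<lambda>y. dens k' y * dens k y)" "(LINT y|lborel. dens k' y * dens k y) = (LINT y|lborel. (dens k y)\<^sup>2)"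
    using integrable_dens_coarser[OF assms, of "\<lambda>i. 2 ^ k * W k i"] integral_dens_coarser[OF assms, of "\<lambda>i. 2 ^ k * W k i"]
    by (simp_all add: dens_def power2_eq_square)
  show "integrable lborel (\<lambda>y. (dens k y)\<^sup>2)" using sq assms by simp
  have k: "k \<le> K" using assms by simp
  have eq: "(dens k' y - dens k y)\<^sup>2 = (dens k' y)\<^sup>2 - 2 * (dens k' y * dens k y) + (dens k y)\<^sup>2" for y
    by (simp add: power2_diff)
  show "integrable lborel (\<lambda>y. (dens k' y - dens k y)\<^sup>2)"
    unfolding eq using sq[OF k] sq[OF assms(2)] cr(1) by simp
  show "(LINT y|lborel. (dens k' y - dens k y)\<^sup>2) = (LINT y|lborel. (dens k' y)\<^sup>2) - (LINT y|lborel. (dens k y)\<^sup>2)"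
    unfolding eq using sq[OF k] sq[OF assms(2)] cr by simp
qed

text \<open>Pointwise AM-GM instead of Cauchy-Schwarz; the term \<open>\<epsilon> / 2\<close> lives
  on an interval of length 2 and integrates to \<open>\<epsilon>\<close>.\<close>

lemma integral_abs_dens_diff:
  assumes "k \<le> k'" "k' \<le> K" "0 < \<epsilon>"
  shows "(LINT y|lborel. \<bar>dens k' y - dens k y\<bar>) \<le> \<epsilon> + (LINT y|lborel. (dens k' y - dens k y)\<^sup>2) / (2 * \<epsilon>)"
proof -
  let ?D = "\<lambda>y. dens k' y - dens k y"
  have k: "k \<le> K" using assms by simp
  have i: "integrable lborel ?D"
    using integrable.intros[OF integral_dens[OF k]] integrable.intros[OF integral_dens[OF assms(2)]] by simp
  have ii: "integrable lborel (indicator {0..<2} :: real \<Rightarrow> real)" by (intro integrable_real_indicator) auto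
  have pw: "\<bar>?D y\<bar> \<le> \<epsilon> / 2 * indicator {0..<2} y + (?D y)\<^sup>2 / (2 * \<epsilon>)" for y
  proof (cases "y \<in> {0..<2}")
    case True
    have "0 \<le> (\<bar>?D y\<bar> - \<epsilon>)\<^sup>2" by simp
    also have "\<dots> = (?D y)\<^sup>2 - 2 * \<epsilon> * \<bar>?D y\<bar> + \<epsilon>\<^sup>2" by (subst power2_diff) simp
    finally have "2 * \<epsilon> * \<bar>?D y\<bar> \<le> \<epsilon>\<^sup>2 + (?D y)\<^sup>2" by linarith
    then have "\<bar>?D y\<bar> \<le> (\<epsilon>\<^sup>2 + (?D y)\<^sup>2) / (2 * \<epsilon>)" using assms(3) by (simp add: field_simps)
    also have "\<dots> = \<epsilon> / 2 + (?D y)\<^sup>2 / (2 * \<epsilon>)" using assms(3) by (simp add: add_divide_distrib power2_eq_square)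
    finally show ?thesis using True by simp
  qed (use k assms in \<open>auto simp: dens_outside\<close>)
  have "(LINT y|lborel. \<bar>?D y\<bar>) \<le> (LINT y|lborel. \<epsilon> / 2 * indicator {0..<2} y + (?D y)\<^sup>2 / (2 * \<epsilon>))"
    using i ii integral_dens_diff_sq(2)[OF assms(1,2)] by (intro integral_mono pw) auto
  also have "\<dots> = \<epsilon> + (LINT y|lborel. (?D y)\<^sup>2) / (2 * \<epsilon>)"
    using ii integral_dens_diff_sq(2)[OF assms(1,2)] by simp
  finally show ?thesis .
qed

section \<open>Perturbed products of densities and the unshifted main term\<close>

lemma prod_dens_bounds:
  assumes "\<And>i. i \<in> {1..m} \<Longrightarrow> \<kappa> i \<le> K" "\<And>i x. i \<in> {1..m} \<Longrightarrow> dens (\<kappa> i) x \<le> B"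
  shows "0 \<le> (\<Prod>i=1..m. dens (\<kappa> i) (z i))" "(\<Prod>i=1..m. dens (\<kappa> i) (z i)) \<le> B ^ m"
proof -
  show "0 \<le> (\<Prod>i=1..m. dens (\<kappa> i) (z i))" using assms dens_nonneg by (intro prod_nonneg) auto
  have "(\<Prod>i=1..m. dens (\<kappa> i) (z i)) \<le> (\<Prod>i=1..m. B)"
    using assms dens_nonneg by (intro prod_mono) auto
  then show "(\<Prod>i=1..m. dens (\<kappa> i) (z i)) \<le> B ^ m" by simp
qed

text \<open>Densities are constant on cells. The products agree unless some argument changes its
  cell; then the sum is at least 1, while both products lie in \<open>0\<close> to
  \<open>B ^ m\<close>.\<close>

lemma prod_dens_diff:
  assumes "\<And>i. i \<in> {1..m} \<Longrightarrow> \<kappa> i \<le> K" "\<And>i x. i \<in> {1..m} \<Longrightarrow> dens (\<kappa> i) x \<le> B" and B: "0 \<le> B"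
  shows "\<bar>(\<Prod>i=1..m. dens (\<kappa> i) (z i)) - (\<Prod>i=1..m. dens (\<kappa> i) (z' i))\<bar>
    \<le> B ^ m * (\<Sum>i=1..m. if \<lfloor>2 ^ \<kappa> i * z i\<rfloor> \<noteq> \<lfloor>2 ^ \<kappa> i * z' i\<rfloor> then 1 else 0)"
proof (cases "\<forall>i\<in>{1..m}. \<lfloor>2 ^ \<kappa> i * z i\<rfloor> = \<lfloor>2 ^ \<kappa> i * z' i\<rfloor>")
  case True
  then have "(\<Prod>i=1..m. dens (\<kappa> i) (z i)) = (\<Prod>i=1..m. dens (\<kappa> i) (z' i))"
    by (intro prod.cong) (auto simp: dens_def)
  then show ?thesis using B by (simp add: sum_nonneg)
next
  case False
  then obtain j where j: "j \<in> {1..m}" "\<lfloor>2 ^ \<kappa> j * z j\<rfloor> \<noteq> \<lfloor>2 ^ \<kappa> j * z' j\<rfloor>" by blast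
  let ?f = "\<lambda>i. if \<lfloor>2 ^ \<kappa> i * z i\<rfloor> \<noteq> \<lfloor>2 ^ \<kappa> i * z' i\<rfloor> then 1 else 0 :: real"
  have "?f j \<le> sum ?f {1..m}" by (rule member_le_sum[OF j(1)]) auto
  then have "B ^ m * 1 \<le> B ^ m * sum ?f {1..m}" using j(2) B by (intro mult_left_mono) auto
  moreover have "\<bar>(\<Prod>i=1..m. dens (\<kappa> i) (z i)) - (\<Prod>i=1..m. dens (\<kappa> i) (z' i))\<bar> \<le> B ^ m"
    using prod_dens_bounds[of m \<kappa> B z] prod_dens_bounds[of m \<kappa> B z'] assms(1,2) by (simp add: abs_le_iff)
  ultimately show ?thesis by linarith
qed

lemma integral_prod_dens_perturb:
  assumes \<kappa>: "\<And>i. i \<in> {1..m} \<Longrightarrow> \<kappa> i \<le> K" "\<And>i x. i \<in> {1..m} \<Longrightarrow> dens (\<kappa> i) x \<le> B" and B: "0 \<le> B"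
    and u: "\<And>y. \<bar>u y\<bar> \<le> B" "\<And>y. y \<notin> {0..<2} \<Longrightarrow> u y = 0"
    and \<theta>: "\<And>i. i \<in> {1..m} \<Longrightarrow> 0 \<le> \<theta> i"
    and near: "\<And>i y. i \<in> {1..m} \<Longrightarrow> \<lfloor>2 ^ \<kappa> i * z i y\<rfloor> \<noteq> \<lfloor>2 ^ \<kappa> i * z' i y\<rfloor> \<Longrightarrow> frac (2 ^ \<kappa> i * (y - q i)) < \<theta> i"
  shows "\<bar>LINT y|lborel. u y * ((\<Prod>i=1..m. dens (\<kappa> i) (z i y)) - (\<Prod>i=1..m. dens (\<kappa> i) (z' i y)))\<bar>
    \<le> B ^ (m + 1) * (\<Sum>i=1..m. 4 * \<theta> i)"
proof -
  let ?I = "\<lambda>i y. indicator (near_grid (\<kappa> i) (q i) (\<theta> i)) y :: real"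
  have int: "integrable lborel (\<lambda>y. \<Sum>i=1..m. ?I i y)"
    by (intro Bochner_Integration.integrable_sum near_grid_integral \<theta>)
  have "\<bar>LINT y|lborel. u y * ((\<Prod>i=1..m. dens (\<kappa> i) (z i y)) - (\<Prod>i=1..m. dens (\<kappa> i) (z' i y)))\<bar>
    \<le> (LINT y|lborel. B ^ (m + 1) * (\<Sum>i=1..m. ?I i y))"
  proof (rule abs_integral_le)
    fix y
    show "\<bar>u y * ((\<Prod>i=1..m. dens (\<kappa> i) (z i y)) - (\<Prod>i=1..m. dens (\<kappa> i) (z' i y)))\<bar> \<le> B ^ (m + 1) * (\<Sum>i=1..m. ?I i y)"
    proof (cases "y \<in> {0..<2}")
      case True
      have "(\<Sum>i=1..m. if \<lfloor>2 ^ \<kappa> i * z i y\<rfloor> \<noteq> \<lfloor>2 ^ \<kappa> i * z' i y\<rfloor> then 1 else 0) \<le> (\<Sum>i=1..m. ?I i y)"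
        using True near by (intro sum_mono) (auto simp: near_grid_def)
      then have "B ^ m * (\<Sum>i=1..m. if \<lfloor>2 ^ \<kappa> i * z i y\<rfloor> \<noteq> \<lfloor>2 ^ \<kappa> i * z' i y\<rfloor> then 1 else 0) \<le> B ^ m * (\<Sum>i=1..m. ?I i y)"
        using B by (intro mult_left_mono) auto
      then have "\<bar>(\<Prod>i=1..m. dens (\<kappa> i) (z i y)) - (\<Prod>i=1..m. dens (\<kappa> i) (z' i y))\<bar> \<le> B ^ m * (\<Sum>i=1..m. ?I i y)"
        by (rule order_trans[rotated]) (rule prod_dens_diff; (rule \<kappa> B | assumption)+)
      from mult_mono[OF u(1)[of y] this B abs_ge_zero] show ?thesis by (simp only: abs_mult) (simp add: mult.assoc)
    qed (use u(2) B in \<open>auto intro!: mult_nonneg_nonneg sum_nonneg\<close>)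
  qed (use int in simp)
  also have "\<dots> = B ^ (m + 1) * (\<Sum>i=1..m. LINT y|lborel. ?I i y)"
    using near_grid_integral(1)[OF \<theta>] by (simp add: Bochner_Integration.integral_sum)
  also have "\<dots> \<le> B ^ (m + 1) * (\<Sum>i=1..m. 4 * \<theta> i)"
    using B by (intro mult_left_mono sum_mono near_grid_integral \<theta>) auto
  finally show ?thesis .
qed

text \<open>Where all coarse densities exceed \<open>\<eta>\<close>, their product is at least
  \<open>\<eta> ^ m\<close>. The set where \<open>dens (\<kappa> i)\<close> is at most
  \<open>\<eta>\<close> consists of cells of level \<open>\<kappa> i\<close>, so by the martingale
  property its mass may be computed with \<open>dens (\<kappa> i)\<close> itself and is at most
  \<open>2 * \<eta>\<close>. Removing these \<open>m\<close> sets works for different levels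
  \<open>\<kappa> i\<close> at once.\<close>

lemma main_term:
  assumes \<kappa>: "\<And>i. i \<in> {1..m} \<Longrightarrow> \<kappa> i \<le> k" "k \<le> K" "\<And>i x. i \<in> {1..m} \<Longrightarrow> dens (\<kappa> i) x \<le> B" and \<eta>: "0 < \<eta>"
  shows "(W 0 0 + W 0 1 - 2 * real m * \<eta>) * \<eta> ^ m \<le> (LINT x|lborel. dens k x * (\<Prod>i=1..m. dens (\<kappa> i) x))"
proof -
  have \<kappa>K: "\<kappa> i \<le> K" if "i \<in> {1..m}" for i using \<kappa>(1)[OF that] \<kappa>(2) by simp
  let ?low = "\<lambda>i x. if dens (\<kappa> i) x \<le> \<eta> then 1 else 0 :: real"
  have low: "integrable lborel (\<lambda>x. dens k x * ?low i x)" "(LINT x|lborel. dens k x * ?low i x) \<le> 2 * \<eta>"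
    if i: "i \<in> {1..m}" for i
  proof -
    have e: "?low i x = (\<lambda>j. if 2 ^ \<kappa> i * W (\<kappa> i) j \<le> \<eta> then 1 else 0) \<lfloor>2 ^ \<kappa> i * x\<rfloor>" for x
      by (simp add: dens_def)
    show "integrable lborel (\<lambda>x. dens k x * ?low i x)"
      unfolding e by (rule integrable_dens_coarser[OF \<kappa>(1)[OF i] \<kappa>(2)])
    have "(LINT x|lborel. dens k x * ?low i x) = (LINT x|lborel. dens (\<kappa> i) x * ?low i x)"
      unfolding e by (rule integral_dens_coarser[OF \<kappa>(1)[OF i] \<kappa>(2)])
    also have "\<dots> \<le> (LINT x|lborel. \<eta> * indicator {0..<2::real} x)"
    proof (rule integral_mono')
      show "integrable lborel (\<lambda>x. \<eta> * indicator {0..<2::real} x)"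
        by (intro integrable_mult_right integrable_real_indicator) auto
      show "dens (\<kappa> i) x * ?low i x \<le> \<eta> * indicator {0..<2} x" for x
        using dens_outside[OF \<kappa>K[OF i], of x] \<eta> by (auto simp: indicator_def)
    qed (use \<eta> in auto)
    also have "\<dots> = 2 * \<eta>" by simp
    finally show "(LINT x|lborel. dens k x * ?low i x) \<le> 2 * \<eta>" .
  qed
  have ik: "integrable lborel (dens k)" "(LINT x|lborel. dens k x) = W 0 0 + W 0 1"
    using integral_dens[OF \<kappa>(2)] by (simp_all add: has_bochner_integral_iff)
  have isum: "integrable lborel (\<lambda>x. \<Sum>i=1..m. dens k x * ?low i x)"
    by (intro Bochner_Integration.integrable_sum low)
  have pw: "\<eta> ^ m * (dens k x - (\<Sum>i=1..m. dens k x * ?low i x)) \<le> dens k x * (\<Prod>i=1..m. dens (\<kappa> i) x)" for x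
  proof (cases "\<forall>i\<in>{1..m}. \<eta> < dens (\<kappa> i) x")
    case True
    then have "(\<Sum>i=1..m. dens k x * ?low i x) = 0" by (intro sum.neutral) auto
    moreover have "(\<Prod>i=1..m. \<eta>) \<le> (\<Prod>i=1..m. dens (\<kappa> i) x)"
      using True \<eta> by (intro prod_mono) (simp add: less_imp_le)
    then have "dens k x * \<eta> ^ m \<le> dens k x * (\<Prod>i=1..m. dens (\<kappa> i) x)"
      by (intro mult_left_mono dens_nonneg[OF \<kappa>(2)]) simp
    ultimately show ?thesis by (simp add: mult.commute)
  next
    case False
    then obtain j where j: "j \<in> {1..m}" "dens (\<kappa> j) x \<le> \<eta>" by force
    have "dens k x * ?low j x \<le> (\<Sum>i=1..m. dens k x * ?low i x)"
      by (rule member_le_sum[OF j(1)]) (auto simp: dens_nonneg \<kappa>(2))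
    then have "\<eta> ^ m * (dens k x - (\<Sum>i=1..m. dens k x * ?low i x)) \<le> 0"
      using j(2) \<eta> by (intro mult_nonneg_nonpos) auto
    also have "0 \<le> dens k x * (\<Prod>i=1..m. dens (\<kappa> i) x)"
      using \<kappa>K dens_nonneg \<kappa>(2) by (intro mult_nonneg_nonneg prod_nonneg) auto
    finally show ?thesis .
  qed
  have ip: "integrable lborel (\<lambda>x. dens k x * (\<Prod>i=1..m. dens (\<kappa> i) x))"
    using slice_integrable[of "dens k" m "\<lambda>i. dens (\<kappa> i)" B "\<lambda>_. 0"] ik(1) \<kappa> \<kappa>K dens_nonneg by simp
  have "(\<Sum>i=1..m. LINT x|lborel. dens k x * ?low i x) \<le> (\<Sum>i=1..m. 2 * \<eta>)"
    by (intro sum_mono low)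
  then have "W 0 0 + W 0 1 - 2 * real m * \<eta> \<le> (LINT x|lborel. dens k x - (\<Sum>i=1..m. dens k x * ?low i x))"
    using ik isum low(1) by (simp add: Bochner_Integration.integral_sum)
  then have "\<eta> ^ m * (W 0 0 + W 0 1 - 2 * real m * \<eta>) \<le> \<eta> ^ m * (LINT x|lborel. dens k x - (\<Sum>i=1..m. dens k x * ?low i x))"
    using \<eta> by (intro mult_left_mono) auto
  also have "\<dots> = (LINT x|lborel. \<eta> ^ m * (dens k x - (\<Sum>i=1..m. dens k x * ?low i x)))" by simp
  also have "\<dots> \<le> (LINT x|lborel. dens k x * (\<Prod>i=1..m. dens (\<kappa> i) x))"
    using ik(1) isum ip by (intro integral_mono pw) auto
  finally show ?thesis by (simp add: mult.commute)
qed

end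

section \<open>Comparison of densities at different levels\<close>

lemma form_cong:
  assumes "\<And>i. i \<in> {1..m} \<Longrightarrow> g i = h i"
  shows "form m P l g0 g = form m P l g0 h"
  unfolding form_def slice_def using assms by simp

text \<open>Telescoping over the slots, one replacement at a time. In each step the remaining slots
  are a mixture of \<open>g\<close> and \<open>h\<close>, so the error bound \<open>E\<close> is
  required for all tame companions \<open>F\<close>.\<close>

lemma form_hybrid:
  assumes g0: "tame B g0" and g: "\<And>i. i \<in> {1..m} \<Longrightarrow> tame B (g i)" and h: "\<And>i. i \<in> {1..m} \<Longrightarrow> tame B (h i)"
    and d: "\<And>i. i \<in> {1..m} \<Longrightarrow> tame B (\<lambda>x. g i x - h i x)"
    and E: "\<And>j F. j \<in> {1..m} \<Longrightarrow> (\<And>i. i \<in> {1..m} \<Longrightarrow> tame B (F i)) \<Longrightarrow> F j = (\<lambda>x. g j x - h j x) \<Longrightarrow>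
      \<bar>form m P l g0 F\<bar> \<le> E j"
  shows "\<bar>form m P l g0 g - form m P l g0 h\<bar> \<le> (\<Sum>j=1..m. E j)"
proof -
  define F where "F n i = (if i \<le> n then h i else g i)" for n i
  have "\<bar>form m P l g0 g - form m P l g0 (F n)\<bar> \<le> (\<Sum>j=1..n. E j)" if "n \<le> m" for n
    using that
  proof (induction n)
    case 0
    have "form m P l g0 (F 0) = form m P l g0 g" by (rule form_cong) (auto simp: F_def)
    then show ?case by simp
  next
    case (Suc n)
    let ?j = "Suc n"
    have j: "?j \<in> {1..m}" using Suc.prems by simp
    have tF: "tame B (F n i)" if "i \<in> {1..m}" for i using g[OF that] h[OF that] by (simp add: F_def)
    have "form m P l g0 ((F n)(?j := \<lambda>x. g ?j x - h ?j x))
        = form m P l g0 ((F n)(?j := g ?j)) - form m P l g0 ((F n)(?j := h ?j))"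
      by (rule form_diff[OF j g0 tF g[OF j] h[OF j]])
    moreover have "(F n)(?j := g ?j) = F n" "(F n)(?j := h ?j) = F ?j" by (auto simp: F_def fun_eq_iff)
    moreover have "\<bar>form m P l g0 ((F n)(?j := \<lambda>x. g ?j x - h ?j x))\<bar> \<le> E ?j"
      by (rule E[OF j]) (use tF d[OF j] in auto)
    ultimately have "\<bar>form m P l g0 (F n) - form m P l g0 (F ?j)\<bar> \<le> E ?j" by simp
    then show ?case using Suc by simp
  qed
  from this[of m] have "\<bar>form m P l g0 g - form m P l g0 (F m)\<bar> \<le> (\<Sum>j=1..m. E j)" by simp
  moreover have "form m P l g0 (F m) = form m P l g0 h" by (rule form_cong) (auto simp: F_def)
  ultimately show ?thesis by simp
qed

text \<open>The Sobolev estimate stripped of Fourier analysis, the only form in which it is used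
  from here on. The upper bound on \<open>\<sigma>\<close> allows errors
  \<open>2 powr (- real R)\<close> to be absorbed into
  \<open>2 powr (- \<sigma> * real R)\<close>.\<close>

definition dyadic_gain :: "nat \<Rightarrow> (nat \<Rightarrow> real poly) \<Rightarrow> real \<Rightarrow> real \<Rightarrow> real \<Rightarrow> bool" where
  "dyadic_gain m P L \<sigma> D \<longleftrightarrow> 0 < \<sigma> \<and> \<sigma> \<le> 1 / 2 \<and> 0 \<le> D \<and>
     (\<forall>l k g0 g B j. real l \<ge> L \<longrightarrow> tame B g0 \<longrightarrow> (\<forall>i\<in>{1..m}. tame B (g i)) \<longrightarrow> j \<in> {1..m} \<longrightarrow>
        cancels k (g j) \<longrightarrow> l * order 0 (P j) \<le> k \<longrightarrow>
        \<bar>form m P l g0 g\<bar> \<le> D * B ^ (m + 1) * 2 powr (- \<sigma> * real (k - l * order 0 (P j))))"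

lemma sobolev_dyadic_gain:
  assumes "sobolev_estimate m P \<sigma> C" "m \<ge> 1"
  shows "dyadic_gain m P C (min \<sigma> 1 / 2) (8 ^ m * 4 * C + 280 * pi)"
proof -
  have "0 < \<sigma>" "0 < C" using assms by (auto simp: sobolev_estimate_def)
  then show ?thesis
    unfolding dyadic_gain_def using abs_form_le_cancels[OF assms] by (simp add: add_nonneg_nonneg)
qed

lemma dyadic_gainD:
  assumes "dyadic_gain m P L \<sigma> D" "real l \<ge> L" "tame B g0" "\<And>i. i \<in> {1..m} \<Longrightarrow> tame B (g i)"
    "j \<in> {1..m}" "cancels k (g j)" "l * order 0 (P j) \<le> q" "q \<le> k"
  shows "\<bar>form m P l g0 g\<bar> \<le> D * B ^ (m + 1) * 2 powr (- \<sigma> * (real k - real q))"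
proof -
  have s: "0 < \<sigma>" "0 \<le> D" using assms(1) by (auto simp: dyadic_gain_def)
  have "l * order 0 (P j) \<le> k" using assms(7,8) by simp
  then have "\<bar>form m P l g0 g\<bar> \<le> D * B ^ (m + 1) * 2 powr (- \<sigma> * real (k - l * order 0 (P j)))"
    using assms(1-6) unfolding dyadic_gain_def by simp
  also have "\<dots> \<le> D * B ^ (m + 1) * 2 powr (- \<sigma> * (real k - real q))"
  proof (rule mult_left_mono)
    have "real k - real q \<le> real (k - l * order 0 (P j))" using assms(7,8) by (simp flip: of_nat_diff)
    then show "2 powr (- \<sigma> * real (k - l * order 0 (P j))) \<le> 2 powr (- \<sigma> * (real k - real q))"
      using s by (intro powr_mono) auto
  qed (use s tame_nonneg[OF assms(3)] in auto)
  finally show ?thesis .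
qed

section \<open>Lowering the levels along doublings\<close>

context mass_tree
begin

lemma tail_step_slots:
  assumes G: "dyadic_gain m P L \<sigma> D" and l: "real l \<ge> L"
    and k: "k \<le> k'" "k' \<le> K" and q: "\<And>i. i \<in> {1..m} \<Longrightarrow> l * order 0 (P i) \<le> q" "q \<le> k"
    and B: "\<And>x. dens k x \<le> B" "\<And>x. dens k' x \<le> B" and g0: "tame B g0"
  shows "\<bar>form m P l g0 (\<lambda>_. dens k') - form m P l g0 (\<lambda>_. dens k)\<bar>
    \<le> real m * (D * B ^ (m + 1) * 2 powr (- \<sigma> * (real k - real q)))"
proof -
  have kK: "k \<le> K" using k by simp
  have "\<bar>form m P l g0 (\<lambda>_. dens k') - form m P l g0 (\<lambda>_. dens k)\<bar>
      \<le> (\<Sum>j=1..m. D * B ^ (m + 1) * 2 powr (- \<sigma> * (real k - real q)))"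
  proof (rule form_hybrid[OF g0])
    fix j F assume j: "j \<in> {1..m}" "\<And>i. i \<in> {1..m} \<Longrightarrow> tame B (F i)" "F j = (\<lambda>x. dens k' x - dens k x)"
    have cn: "cancels k (F j)" using cancels_dens[OF k] j(3) by simp
    show "\<bar>form m P l g0 F\<bar> \<le> D * B ^ (m + 1) * 2 powr (- \<sigma> * (real k - real q))"
      by (rule dyadic_gainD[where q=q, OF G l g0]) (rule j cn q | assumption)+
  qed (use tame_dens[OF kK B(1)] tame_dens[OF k(2) B(2)] tame_dens_diff[OF kK k(2) B] in auto)
  then show ?thesis by simp
qed

text \<open>No Fourier gain is involved. The difference of the base densities cancels at level
  \<open>k'\<close>, so the product of the coarser slots may be frozen at the left end of each cell
  of level \<open>k'\<close>. Freezing matters only where a shifted grid point of level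
  \<open>k\<close> is crossed, a set of measure at most \<open>4 * (2 ^ k / 2 ^ k')\<close> for each
  slot.\<close>

lemma tail_step_base:
  assumes k: "k \<le> k'" "k' \<le> k''" "k'' \<le> K" and m: "m \<ge> 1"
    and B: "\<And>x. dens k x \<le> B" "\<And>x. dens k' x \<le> B" "\<And>x. dens k'' x \<le> B"
  shows "\<bar>form m P l (dens k'') (\<lambda>_. dens k) - form m P l (dens k') (\<lambda>_. dens k)\<bar>
    \<le> B ^ (m + 1) * (real m * (4 * (2 ^ k / 2 ^ k')))"
proof -
  have kK: "k \<le> K" "k' \<le> K" using k by simp_all
  let ?u = "\<lambda>x. dens k'' x - dens k' x"
  have u: "tame B ?u" by (rule tame_dens_diff[OF kK(2) k(3) B(2,3)])
  have B0: "0 \<le> B" using tame_nonneg[OF u] .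
  let ?r = "\<lambda>y :: real. of_int \<lfloor>2 ^ k' * y\<rfloor> / 2 ^ k' :: real"
  have r: "?r y \<le> y" "y - ?r y \<le> 1 / 2 ^ k'" for y
  proof -
    have "of_int \<lfloor>2 ^ k' * y\<rfloor> \<le> 2 ^ k' * y" "2 ^ k' * y \<le> of_int \<lfloor>2 ^ k' * y\<rfloor> + 1" by linarith+
    then have "?r y \<le> y" "y \<le> (of_int \<lfloor>2 ^ k' * y\<rfloor> + 1) / 2 ^ k'" by (simp_all add: field_simps)
    then show "?r y \<le> y" "y - ?r y \<le> 1 / 2 ^ k'" by (simp_all add: add_divide_distrib)
  qed
  have "form m P l ?u (\<lambda>_. dens k) = form m P l (dens k'') (\<lambda>_. dens k) - form m P l (dens k') (\<lambda>_. dens k)"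
    by (rule form_diff_0[where B=B]) (use tame_dens kK k(3) B in auto)
  moreover have "\<bar>form m P l ?u (\<lambda>_. dens k)\<bar> \<le> B ^ (m + 1) * (real m * (4 * (2 ^ k / 2 ^ k')))"
  proof (rule abs_form_le)
    fix t :: real
    let ?p = "\<lambda>i. poly (P i) (t / 2 ^ l)"
    have bd: "\<bar>dens k x\<bar> \<le> B" for x using B(1)[of x] dens_nonneg[OF kK(1), of x] by simp
    have i1: "integrable lborel (\<lambda>y. ?u y * (\<Prod>i=1..m. dens k (y - ?p i)))"
      by (rule slice_integrable[where B=B]) (use u bd in \<open>auto dest: tame_measurable tame_integrable\<close>)
    have i2: "integrable lborel (\<lambda>y. ?u y * (\<Prod>i=1..m. dens k (?r y - ?p i)))"
    proof (rule integrable_mult_bounded[where c="B ^ m"])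
      show "(\<lambda>y. \<Prod>i=1..m. dens k (?r y - ?p i)) \<in> borel_measurable borel" by measurable
      show "\<bar>\<Prod>i=1..m. dens k (?r y - ?p i)\<bar> \<le> B ^ m" for y by (intro abs_prod_le_power bd)
    qed (rule tame_integrable[OF u])
    have "(LINT y|lborel. ?u y * (\<Prod>i=1..m. dens k (?r y - ?p i))) = 0"
      using cancels_dens[OF k(2,3)] unfolding cancels_def
      by (elim allE[of _ "\<lambda>j. \<Prod>i=1..m. dens k (of_int j / 2 ^ k' - ?p i)"])
    then have "slice m P ?u (\<lambda>_. dens k) (t / 2 ^ l)
        = (LINT y|lborel. ?u y * ((\<Prod>i=1..m. dens k (y - ?p i)) - (\<Prod>i=1..m. dens k (?r y - ?p i))))"
      using i1 i2 by (simp add: slice_def right_diff_distrib)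
    moreover have "\<bar>LINT y|lborel. ?u y * ((\<Prod>i=1..m. dens k (y - ?p i)) - (\<Prod>i=1..m. dens k (?r y - ?p i)))\<bar>
        \<le> B ^ (m + 1) * (\<Sum>i=1..m. 4 * (2 ^ k / 2 ^ k'))"
    proof (rule integral_prod_dens_perturb[where q="?p"])
      show "\<bar>?u y\<bar> \<le> B" for y by (rule tame_abs_le[OF u])
      show "?u y = 0" if "y \<notin> {0..<2}" for y using dens_outside[OF k(3) that] dens_outside[OF kK(2) that] by simp
      fix i y assume "\<lfloor>2 ^ k * (y - ?p i)\<rfloor> \<noteq> \<lfloor>2 ^ k * (?r y - ?p i)\<rfloor>"
      then have "frac (2 ^ k * (y - ?p i)) < 2 ^ k * ((y - ?p i) - (?r y - ?p i))"
        using r(1) by (intro frac_less_if_floor_neq) auto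
      also have "\<dots> \<le> 2 ^ k * (1 / 2 ^ k')" using r(2)[of y] by (intro mult_left_mono) auto
      finally show "frac (2 ^ k * (y - ?p i)) < 2 ^ k / 2 ^ k'" by simp
    qed (use kK B B0 in auto)
    ultimately show "\<bar>slice m P ?u (\<lambda>_. dens k) (t / 2 ^ l)\<bar> \<le> B ^ (m + 1) * (real m * (4 * (2 ^ k / 2 ^ k')))"
      by simp
  qed
  ultimately show ?thesis by simp
qed

text \<open>The order matters: the slots descend from \<open>2 * k\<close> to \<open>k\<close> under
  the base \<open>4 * k\<close>, and only then the base descends to \<open>2 * k\<close>, so that it
  always moves above strictly coarser slots. The \<open>m + 1\<close> sup bounds cost at most
  \<open>2 powr (\<sigma> / 2 * real k)\<close> by the smallness of \<open>c\<close>, which is half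
  of the gain in \<open>k\<close>.\<close>

lemma tail_step:
  assumes G: "dyadic_gain m P L \<sigma> D" and l: "real l \<ge> L" and m: "m \<ge> 1"
    and k: "4 * k \<le> K" and q: "\<And>i. i \<in> {1..m} \<Longrightarrow> l * order 0 (P i) \<le> q" "q \<le> k"
    and B: "\<And>j x. j \<le> K \<Longrightarrow> dens j x \<le> 2 powr (c * real j)"
    and c: "0 \<le> c" "4 * c * (real m + 1) \<le> \<sigma> / 2"
    and r: "r \<le> real k / 2 - real q" "0 \<le> r"
  shows "\<bar>form m P l (dens (4 * k)) (\<lambda>_. dens (2 * k)) - form m P l (dens (2 * k)) (\<lambda>_. dens k)\<bar>
    \<le> real m * (D + 4) * 2 powr (- \<sigma> * r)"
proof -
  have s: "0 < \<sigma>" "\<sigma> \<le> 1 / 2" "0 \<le> D" using G by (auto simp: dyadic_gain_def)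
  let ?B = "2 powr (c * real (4 * k)) :: real"
  have bd: "dens j x \<le> ?B" if "j \<le> 4 * k" for j x
  proof -
    have "c * real j \<le> c * real (4 * k)" using that c by (intro mult_left_mono) auto
    then have "2 powr (c * real j) \<le> ?B" by (intro powr_mono) auto
    moreover have "dens j x \<le> 2 powr (c * real j)" using B[of j x] that k by simp
    ultimately show ?thesis by linarith
  qed
  have Bm: "?B ^ (m + 1) \<le> 2 powr (\<sigma> / 2 * real k)"
  proof -
    have "?B ^ (m + 1) = ?B powr real (m + 1)" by (rule powr_realpow[symmetric]) simp
    also have "\<dots> = 2 powr (4 * c * (real m + 1) * real k)" by (simp add: powr_powr algebra_simps)
    also have "\<dots> \<le> 2 powr (\<sigma> / 2 * real k)" using c by (intro powr_mono mult_right_mono) auto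
    finally show ?thesis .
  qed
  have t4: "tame ?B (dens (4 * k))" by (rule tame_dens[OF k]) (rule bd, simp)
  have "\<bar>form m P l (dens (4 * k)) (\<lambda>_. dens (2 * k)) - form m P l (dens (4 * k)) (\<lambda>_. dens k)\<bar>
      \<le> real m * (D * ?B ^ (m + 1) * 2 powr (- \<sigma> * (real k - real q)))"
    by (rule tail_step_slots[OF G l _ _ q bd bd t4]) (use k in auto)
  also have "\<dots> \<le> real m * (D * 2 powr (\<sigma> / 2 * real k) * 2 powr (- \<sigma> * (real k - real q)))"
    using Bm s by (intro mult_left_mono mult_right_mono) auto
  also have "\<dots> = real m * D * 2 powr (- \<sigma> * (real k / 2 - real q))"
    by (simp add: algebra_simps flip: powr_add)
  also have "\<dots> \<le> real m * D * 2 powr (- \<sigma> * r)"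
  proof (rule mult_left_mono, rule powr_mono)
    have "\<sigma> * r \<le> \<sigma> * (real k / 2 - real q)" using s r(1) by (intro mult_left_mono) auto
    then show "- \<sigma> * (real k / 2 - real q) \<le> - \<sigma> * r" by simp
  qed (use s in auto)
  finally have e1: "\<bar>form m P l (dens (4 * k)) (\<lambda>_. dens (2 * k)) - form m P l (dens (4 * k)) (\<lambda>_. dens k)\<bar>
      \<le> real m * D * 2 powr (- \<sigma> * r)" .
  have "\<bar>form m P l (dens (4 * k)) (\<lambda>_. dens k) - form m P l (dens (2 * k)) (\<lambda>_. dens k)\<bar>
      \<le> ?B ^ (m + 1) * (real m * (4 * (2 ^ k / 2 ^ (2 * k))))"
    by (rule tail_step_base) (use k m bd in auto)
  also have "\<dots> \<le> 2 powr (\<sigma> / 2 * real k) * (real m * (4 * (2 ^ k / 2 ^ (2 * k))))"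
    using Bm by (intro mult_right_mono) auto
  also have "2 ^ k / 2 ^ (2 * k) = (2 powr (- real k) :: real)"
    by (simp only: mult_2 power_add) (simp add: powr_minus powr_realpow field_simps)
  also have "2 powr (\<sigma> / 2 * real k) * (real m * (4 * 2 powr (- real k))) = real m * 4 * 2 powr (\<sigma> / 2 * real k - real k)"
    by (simp only: diff_conv_add_uminus powr_add mult_ac)
  also have "\<dots> \<le> real m * 4 * 2 powr (- \<sigma> * r)"
  proof (intro mult_left_mono powr_mono)
    have "\<sigma> * real k \<le> 1 * real k" using s by (intro mult_right_mono) auto
    moreover have "\<sigma> * r \<le> \<sigma> * (real k / 2)" using s r by (intro mult_left_mono) auto
    ultimately show "\<sigma> / 2 * real k - real k \<le> - \<sigma> * r" by simp
  qed auto
  finally have "\<bar>form m P l (dens (4 * k)) (\<lambda>_. dens k) - form m P l (dens (2 * k)) (\<lambda>_. dens k)\<bar>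
      \<le> real m * 4 * 2 powr (- \<sigma> * r)" .
  with e1 show ?thesis by (simp add: algebra_simps)
qed

lemma tail_estimate:
  assumes G: "dyadic_gain m P L \<sigma> D" and l: "real l \<ge> L" and m: "m \<ge> 1"
    and n: "2 * (k * 2 ^ n) \<le> K" and q: "\<And>i. i \<in> {1..m} \<Longrightarrow> l * order 0 (P i) \<le> q"
    and B: "\<And>j x. j \<le> K \<Longrightarrow> dens j x \<le> 2 powr (c * real j)"
    and c: "0 \<le> c" "4 * c * (real m + 1) \<le> \<sigma> / 2"
    and R: "real R \<le> real k / 2 - real q" and \<delta>: "2 powr (- \<sigma> * real R) \<le> 1 / 2"
  shows "\<bar>form m P l (dens (2 * (k * 2 ^ n))) (\<lambda>_. dens (k * 2 ^ n)) - form m P l (dens (2 * k)) (\<lambda>_. dens k)\<bar>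
    \<le> 2 * real m * (D + 4) * 2 powr (- \<sigma> * real R)"
proof -
  let ?d = "2 powr (- \<sigma> * real R)"
  let ?a = "\<lambda>n. form m P l (dens (2 * (k * 2 ^ n))) (\<lambda>_. dens (k * 2 ^ n))"
  have s: "0 < \<sigma>" "0 \<le> D" using G by (auto simp: dyadic_gain_def)
  have "\<bar>?a n - ?a 0\<bar> \<le> real m * (D + 4) * (\<Sum>j<n. ?d ^ Suc j)"
    using n
  proof (induction n)
    case (Suc n)
    let ?k = "k * 2 ^ n"
    have le: "4 * ?k \<le> K" "2 * ?k \<le> K" using Suc.prems by simp_all
    \<comment> \<open>The exponential growth of the levels is weakened to linear growth, which turns
      the error of the \<open>n\<close>-th doubling into the power \<open>?d ^ Suc n\<close> of a
      geometric series.\<close>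
    have kn: "real k * (1 + real n) \<le> real ?k"
    proof -
      have "1 + real n \<le> 2 ^ n" using Bernoulli_inequality[of 1 n] by simp
      then have "real k * (1 + real n) \<le> real k * 2 ^ n" by (intro mult_left_mono) auto
      then show ?thesis by simp
    qed
    have r: "real R * (1 + real n) \<le> real ?k / 2 - real q"
    proof -
      have "(real R + real q) * (1 + real n) \<le> real k / 2 * (1 + real n)"
        using R by (intro mult_right_mono) auto
      moreover have "0 \<le> real q * real n" by simp
      ultimately show ?thesis using kn unfolding distrib_left distrib_right by linarith
    qed
    moreover have "0 \<le> real R * (1 + real n)" by simp
    ultimately have "real q \<le> real ?k / 2" by linarith
    then have "real q \<le> real ?k" by linarith
    then have qk: "q \<le> ?k" by (rule of_nat_le_iff[THEN iffD1])
    have "\<bar>form m P l (dens (4 * ?k)) (\<lambda>_. dens (2 * ?k)) - form m P l (dens (2 * ?k)) (\<lambda>_. dens ?k)\<bar>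
        \<le> real m * (D + 4) * 2 powr (- \<sigma> * (real R * (1 + real n)))"
      by (rule tail_step[OF G l m le(1) q qk B c r]) auto
    moreover have "2 powr (- \<sigma> * (real R * (1 + real n))) = ?d ^ Suc n"
    proof -
      have "?d ^ Suc n = ?d powr real (Suc n)" by (rule powr_realpow[symmetric]) simp
      then show ?thesis by (simp add: powr_powr mult_ac)
    qed
    ultimately have "\<bar>?a (Suc n) - ?a n\<bar> \<le> real m * (D + 4) * ?d ^ Suc n"
      by (simp add: mult_ac)
    moreover have "\<bar>?a n - ?a 0\<bar> \<le> real m * (D + 4) * (\<Sum>j<n. ?d ^ Suc j)"
      using Suc.IH le by simp
    ultimately have "\<bar>?a (Suc n) - ?a 0\<bar> \<le> real m * (D + 4) * (\<Sum>j<n. ?d ^ Suc j) + real m * (D + 4) * ?d ^ Suc n"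
      by linarith
    then show ?case by (simp add: distrib_left)
  qed simp
  also have "\<dots> \<le> real m * (D + 4) * (2 * ?d)"
  proof (rule mult_left_mono)
    have "(\<Sum>j<n. ?d ^ Suc j) = ?d * (\<Sum>j<n. ?d ^ j)" by (simp add: sum_distrib_left)
    also have "(\<Sum>j<n. ?d ^ j) \<le> (\<Sum>j<n. (1 / 2) ^ j)" using \<delta> by (intro sum_mono power_mono) auto
    also have "\<dots> \<le> 2" by (simp add: sum_gp_strict)
    finally show "(\<Sum>j<n. ?d ^ Suc j) \<le> 2 * ?d" by (simp add: mult.commute)
  qed (use s in auto)
  finally show ?thesis by simp
qed

section \<open>A good scale and the lower bound at that scale\<close>

text \<open>For fixed \<open>i\<close> the windows of radius \<open>R\<close> around
  \<open>2 * R * n * e i\<close> do not overlap, since consecutive centres differ by at least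
  \<open>2 * R\<close>. The energy is monotone in the level and at most 2^2 times the length 2 of
  the support, so the increments over all windows add up to at most 8 for each \<open>i\<close>.
  Summing over \<open>i\<close> before choosing \<open>n\<close> gives one scale for all
  slots.\<close>

lemma energy_pigeonhole:
  assumes J: "J \<ge> 1" and R: "R \<ge> 1"
    and e: "\<And>i. i \<in> {1..m} \<Longrightarrow> 1 \<le> e i \<and> 2 * R * J * e i + R \<le> k" and k: "k \<le> K"
    and B: "\<And>j x. j \<le> k \<Longrightarrow> dens j x \<le> 2"
  shows "\<exists>n\<in>{1..J}. (\<Sum>i=1..m. LINT y|lborel. (dens (2 * R * n * e i + R) y - dens (2 * R * n * e i - R) y)\<^sup>2) \<le> 8 * real m / real J"
proof -
  let ?N = "\<lambda>j. LINT y|lborel. (dens j y)\<^sup>2"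
  let ?d = "\<lambda>n i. LINT y|lborel. (dens (2 * R * n * e i + R) y - dens (2 * R * n * e i - R) y)\<^sup>2"
  have mono: "?N j \<le> ?N j'" if "j \<le> j'" "j' \<le> K" for j j'
  proof -
    have "0 \<le> (LINT y|lborel. (dens j' y - dens j y)\<^sup>2)" by (rule integral_nonneg_AE) simp
    then show ?thesis using integral_dens_diff_sq(3)[OF that] by simp
  qed
  have N0: "0 \<le> ?N j" for j by (rule integral_nonneg_AE) simp
  have N8: "?N j \<le> 8" if "j \<le> k" for j
  proof -
    have "?N j \<le> (LINT y|lborel. 4 * indicator {0..<2::real} y)"
    proof (rule integral_mono')
      show "integrable lborel (\<lambda>y. 4 * indicator {0..<2::real} y :: real)"
        by (intro integrable_mult_right integrable_real_indicator) auto
      have "dens j y \<le> 2" "0 \<le> dens j y" for y using B[OF that] dens_nonneg[of j] that k by auto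
      then have "(dens j y)\<^sup>2 \<le> 2\<^sup>2" for y by (intro power_mono)
      then show "(dens j y)\<^sup>2 \<le> 4 * indicator {0..<2::real} y" for y
        using dens_outside[of j y] that k by (auto simp: indicator_def)
    qed auto
    then show ?thesis by simp
  qed
  have tele: "(\<Sum>n=1..j. ?d n i) \<le> ?N (2 * R * j * e i + R)" if "i \<in> {1..m}" "j \<le> J" for i j
    using that(2)
  proof (induction j)
    case (Suc j)
    have ei: "1 \<le> e i" "2 * R * J * e i + R \<le> K" using e[OF that(1)] k by simp_all
    have "2 * R * Suc j * e i \<le> 2 * R * J * e i" using Suc.prems by (intro mult_le_mono) auto
    then have u: "2 * R * Suc j * e i + R \<le> K" using ei(2) by linarith
    have "2 * R * 1 \<le> 2 * R * e i" using ei(1) by (intro mult_le_mono) auto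
    then have g: "2 * R * j * e i + R \<le> 2 * R * Suc j * e i - R" by (simp add: algebra_simps)
    have "?d (Suc j) i = ?N (2 * R * Suc j * e i + R) - ?N (2 * R * Suc j * e i - R)"
      by (rule integral_dens_diff_sq(3)[OF _ u]) simp
    moreover have "?N (2 * R * j * e i + R) \<le> ?N (2 * R * Suc j * e i - R)"
      by (rule mono[OF g]) (use u in linarith)
    moreover have "(\<Sum>n=1..j. ?d n i) \<le> ?N (2 * R * j * e i + R)" using Suc by simp
    ultimately show ?case by simp
  qed (simp add: N0)
  have "(\<Sum>n=1..J. \<Sum>i=1..m. ?d n i) = (\<Sum>i=1..m. \<Sum>n=1..J. ?d n i)" by (rule sum.swap)
  also have "\<dots> \<le> (\<Sum>i=1..m. 8)"
  proof (rule sum_mono)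
    fix i assume i: "i \<in> {1..m}"
    have "?N (2 * R * J * e i + R) \<le> 8" using N8 e[OF i] by blast
    then show "(\<Sum>n=1..J. ?d n i) \<le> 8" using tele[OF i order_refl] by linarith
  qed
  finally have tot: "(\<Sum>n=1..J. \<Sum>i=1..m. ?d n i) \<le> 8 * real m" by simp
  show ?thesis
  proof (rule ccontr)
    assume "\<not> ?thesis"
    then have lt: "8 * real m / real J < (\<Sum>i=1..m. ?d n i)" if "n \<in> {1..J}" for n using that by force
    have "(\<Sum>n=1..J. 8 * real m / real J) < (\<Sum>n=1..J. \<Sum>i=1..m. ?d n i)"
      by (rule sum_strict_mono) (use lt J in auto)
    then show False using tot J by simp
  qed
qed

text \<open>Two replacements of different nature: down to \<open>R\<close> levels above the critical
  level by the Sobolev gain, then across the critical level by the L1 distance of the densities,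
  which the choice of the scale makes small.\<close>

lemma form_scale_split:
  assumes G: "dyadic_gain m P L \<sigma> D" and l: "real l \<ge> L" and m: "m \<ge> 1" and R: "R \<le> l"
    and e: "\<And>i. i \<in> {1..m} \<Longrightarrow> 1 \<le> order 0 (P i) \<and> l * order 0 (P i) + R \<le> k"
    and k: "2 * k \<le> K" and B: "\<And>j x. j \<le> 2 * k \<Longrightarrow> dens j x \<le> 2"
  shows "\<bar>form m P l (dens (2 * k)) (\<lambda>_. dens k) - form m P l (dens (2 * k)) (\<lambda>i. dens (l * order 0 (P i) - R))\<bar>
    \<le> real m * (D * 2 ^ (m + 1) * 2 powr (- \<sigma> * real R))
      + 2 ^ m * (\<Sum>i=1..m. LINT y|lborel. \<bar>dens (l * order 0 (P i) + R) y - dens (l * order 0 (P i) - R) y\<bar>)"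
proof -
  let ?e = "\<lambda>i. l * order 0 (P i)"
  have jk: "j \<le> K" if "j \<le> 2 * k" for j using that k by simp
  have t: "tame 2 (dens j)" if "j \<le> 2 * k" for j by (rule tame_dens[OF jk[OF that] B[OF that]])
  have td: "tame 2 (\<lambda>x. dens j' x - dens j x)" if "j \<le> 2 * k" "j' \<le> 2 * k" for j j'
    by (rule tame_dens_diff[OF jk[OF that(1)] jk[OF that(2)] B[OF that(1)] B[OF that(2)]])
  have le: "?e i + R \<le> 2 * k" "?e i - R \<le> 2 * k" "?e i + R \<le> k" "k \<le> 2 * k" if "i \<in> {1..m}" for i
    using e[OF that] by linarith+
  have "\<bar>form m P l (dens (2 * k)) (\<lambda>_. dens k) - form m P l (dens (2 * k)) (\<lambda>i. dens (?e i + R))\<bar>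
      \<le> (\<Sum>j=1..m. D * 2 ^ (m + 1) * 2 powr (- \<sigma> * real R))"
  proof (rule form_hybrid[where B=2])
    fix j F assume j: "j \<in> {1..m}" "\<And>i. i \<in> {1..m} \<Longrightarrow> tame 2 (F i)" "F j = (\<lambda>x. dens k x - dens (?e j + R) x)"
    have cn: "cancels (?e j + R) (F j)" unfolding j(3) by (rule cancels_dens) (use le(3)[OF j(1)] k in auto)
    have "\<bar>form m P l (dens (2 * k)) F\<bar> \<le> D * 2 ^ (m + 1) * 2 powr (- \<sigma> * (real (?e j + R) - real (?e j)))"
      by (rule dyadic_gainD[where q="?e j" and g=F and j=j and k="?e j + R", OF G l t j(2) j(1) cn]) auto
    then show "\<bar>form m P l (dens (2 * k)) F\<bar> \<le> D * 2 ^ (m + 1) * 2 powr (- \<sigma> * real R)" by simp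
  qed (use t td le in auto)
  then have e1: "\<bar>form m P l (dens (2 * k)) (\<lambda>_. dens k) - form m P l (dens (2 * k)) (\<lambda>i. dens (?e i + R))\<bar>
      \<le> real m * (D * 2 ^ (m + 1) * 2 powr (- \<sigma> * real R))" by simp
  have "\<bar>form m P l (dens (2 * k)) (\<lambda>i. dens (?e i + R)) - form m P l (dens (2 * k)) (\<lambda>i. dens (?e i - R))\<bar>
      \<le> (\<Sum>j=1..m. 2 ^ m * (LINT y|lborel. \<bar>dens (?e j + R) y - dens (?e j - R) y\<bar>))"
  proof (rule form_hybrid[where B=2])
    fix j F assume j: "j \<in> {1..m}" "\<And>i. i \<in> {1..m} \<Longrightarrow> tame 2 (F i)" "F j = (\<lambda>x. dens (?e j + R) x - dens (?e j - R) x)"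
    show "\<bar>form m P l (dens (2 * k)) F\<bar> \<le> 2 ^ m * (LINT y|lborel. \<bar>dens (?e j + R) y - dens (?e j - R) y\<bar>)"
    proof (rule abs_form_le)
      fix s
      have "\<bar>slice m P (dens (2 * k)) F (s / 2 ^ l)\<bar> \<le> 2 ^ m * (LINT x|lborel. \<bar>F j x\<bar>)"
      proof (rule abs_slice_le[OF j(1)])
        show "\<bar>dens (2 * k) x\<bar> \<le> 2" for x using tame_abs_le[OF t] by simp
        show "\<bar>F i x\<bar> \<le> 2" if "i \<in> {1..m} - {j}" for i x using that tame_abs_le[OF j(2)] by blast
        show "integrable lborel (F j)" by (rule tame_integrable[OF j(2)[OF j(1)]])
      qed
      then show "\<bar>slice m P (dens (2 * k)) F (s / 2 ^ l)\<bar> \<le> 2 ^ m * (LINT y|lborel. \<bar>dens (?e j + R) y - dens (?e j - R) y\<bar>)"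
        unfolding j(3) .
    qed
  qed (use t td le in auto)
  then show ?thesis using e1 by (simp add: sum_distrib_left)
qed

text \<open>The shift by P_i(s / 2^l) is at most \<open>Cp\<close> times 2^(-l e_i), that is
  \<open>Cp * 2 powr (- real R)\<close> cell lengths of the slot, so it changes the cell only on a
  set of proportionally small measure. What is left is the unshifted integral.\<close>

lemma form_unshift:
  assumes R: "R \<le> l" and m: "m \<ge> 1"
    and e: "\<And>i. i \<in> {1..m} \<Longrightarrow> 1 \<le> order 0 (P i) \<and> l * order 0 (P i) + R \<le> k"
    and k: "2 * k \<le> K" and B: "\<And>j x. j \<le> 2 * k \<Longrightarrow> dens j x \<le> 2"
    and Cp: "0 \<le> Cp" "\<And>i t. i \<in> {1..m} \<Longrightarrow> 0 \<le> t \<Longrightarrow> t \<le> 1 \<Longrightarrow> \<bar>poly (P i) t\<bar> \<le> Cp * t ^ order 0 (P i)"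
    and a: "0 < a" "a \<le> W 0 0 + W 0 1"
  shows "a / 2 * (a / (4 * real m)) ^ m - 2 ^ (m + 1) * (real m * (4 * (Cp * 2 powr (- real R))))
    \<le> form m P l (dens (2 * k)) (\<lambda>i. dens (l * order 0 (P i) - R))"
proof -
  let ?\<kappa> = "\<lambda>i. l * order 0 (P i) - R" and ?g = "\<lambda>i. dens (l * order 0 (P i) - R)"
  let ?E = "a / 2 * (a / (4 * real m)) ^ m - 2 ^ (m + 1) * (real m * (4 * (Cp * 2 powr (- real R))))"
  have jk: "j \<le> K" if "j \<le> 2 * k" for j using that k by simp
  have t: "tame 2 (dens j)" if "j \<le> 2 * k" for j by (rule tame_dens[OF jk[OF that] B[OF that]])
  have \<kappa>: "?\<kappa> i \<le> 2 * k" if "i \<in> {1..m}" for i using e[OF that] by linarith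
  have \<kappa>K: "?\<kappa> i \<le> K" if "i \<in> {1..m}" for i using \<kappa>[OF that] k by linarith
  have bg: "dens (?\<kappa> i) x \<le> 2" if "i \<in> {1..m}" for i x using B[OF \<kappa>[OF that]] .
  have abg: "\<bar>dens (?\<kappa> i) x\<bar> \<le> 2" if "i \<in> {1..m}" for i x
    using bg[OF that] dens_nonneg[OF \<kappa>K[OF that]] by simp
  have iall: "integrable lborel (\<lambda>x. dens (2 * k) x * (\<Prod>i=1..m. dens (?\<kappa> i) (x - p i)))" for p
    by (rule slice_integrable[where B=2]) (use abg tame_integrable[OF t] in auto)
  \<comment> \<open>The threshold \<open>a / (4 * real m)\<close> is chosen so that discarding the
    low-density sets costs at most half of \<open>a\<close>.\<close>
  have "a / 2 * (a / (4 * real m)) ^ m \<le> (W 0 0 + W 0 1 - 2 * real m * (a / (4 * real m))) * (a / (4 * real m)) ^ m"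
    using a m by (intro mult_right_mono) (auto simp: field_simps)
  also have "\<dots> \<le> (LINT x|lborel. dens (2 * k) x * (\<Prod>i=1..m. dens (?\<kappa> i) x))"
    by (rule main_term[where B=2]) (use \<kappa> k bg a m in auto)
  finally have main: "a / 2 * (a / (4 * real m)) ^ m \<le> (LINT x|lborel. dens (2 * k) x * (\<Prod>i=1..m. dens (?\<kappa> i) x))" .
  have sl: "?E \<le> slice m P (dens (2 * k)) ?g (s / 2 ^ l)" if s: "0 \<le> s" "s \<le> 1" for s :: real
  proof -
    let ?p = "\<lambda>i. poly (P i) (s / 2 ^ l)"
    have pb: "2 ^ ?\<kappa> i * \<bar>?p i\<bar> \<le> Cp * 2 powr (- real R)" if i: "i \<in> {1..m}" for i
    proof -
      have "s / 2 ^ l \<le> 1 / 2 ^ l" using s by (simp add: divide_right_mono)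
      moreover have "(1::real) / 2 ^ l \<le> 1" by simp
      ultimately have "s / 2 ^ l \<le> 1" by linarith
      then have "\<bar>?p i\<bar> \<le> Cp * (s / 2 ^ l) ^ order 0 (P i)" using Cp(2)[OF i] s by simp
      also have "\<dots> \<le> Cp * (1 / 2 ^ l) ^ order 0 (P i)"
        using Cp s by (intro mult_left_mono power_mono divide_right_mono) auto
      also have "\<dots> = Cp / 2 ^ (l * order 0 (P i))" by (simp add: power_one_over power_mult[symmetric] divide_inverse power_inverse)
      finally have "2 ^ ?\<kappa> i * \<bar>?p i\<bar> \<le> 2 ^ ?\<kappa> i * (Cp / 2 ^ (l * order 0 (P i)))" by (intro mult_left_mono) auto
      also have "\<dots> = Cp * (2 ^ ?\<kappa> i / 2 ^ (l * order 0 (P i)))" by simp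
      also have "(2::real) ^ (l * order 0 (P i)) = 2 ^ ?\<kappa> i * 2 ^ R"
      proof -
        have "l * 1 \<le> l * order 0 (P i)" using e[OF i] by (intro mult_le_mono) auto
        then have "l * order 0 (P i) = ?\<kappa> i + R" using R by linarith
        then show ?thesis by (metis power_add)
      qed
      also have "Cp * (2 ^ ?\<kappa> i / (2 ^ ?\<kappa> i * 2 ^ R)) = Cp * 2 powr (- real R)"
        by (simp add: powr_minus powr_realpow divide_inverse)
      finally show ?thesis .
    qed
    \<comment> \<open>The right one of the two points \<open>y\<close> and \<open>y - ?p i\<close>
      is the one close to the grid: \<open>y\<close> itself for a nonnegative shift, the shifted
      point otherwise.\<close>
    let ?q = "\<lambda>i. if 0 \<le> ?p i then 0 else ?p i"
    have "\<bar>LINT x|lborel. dens (2 * k) x * ((\<Prod>i=1..m. dens (?\<kappa> i) (x - ?p i)) - (\<Prod>i=1..m. dens (?\<kappa> i) x))\<bar>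
      \<le> 2 ^ (m + 1) * (\<Sum>i=1..m. 4 * (2 ^ ?\<kappa> i * \<bar>?p i\<bar>))"
    proof (rule integral_prod_dens_perturb[where q="?q"])
      fix i y assume i: "i \<in> {1..m}" and ne: "\<lfloor>2 ^ ?\<kappa> i * (y - ?p i)\<rfloor> \<noteq> \<lfloor>2 ^ ?\<kappa> i * y\<rfloor>"
      show "frac (2 ^ ?\<kappa> i * (y - ?q i)) < 2 ^ ?\<kappa> i * \<bar>?p i\<bar>"
      proof (cases "0 \<le> ?p i")
        case True
        then show ?thesis using frac_less_if_floor_neq[OF _ ne] by simp
      next
        case False
        then show ?thesis using frac_less_if_floor_neq[OF _ ne[symmetric]] by simp
      qed
    next
      show "\<bar>dens (2 * k) y\<bar> \<le> 2" for y using tame_abs_le[OF t] by simp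
    qed (use \<kappa>K bg k in \<open>auto simp: dens_outside\<close>)
    also have "\<dots> \<le> 2 ^ (m + 1) * (\<Sum>i=1..m. 4 * (Cp * 2 powr (- real R)))"
      by (intro mult_left_mono sum_mono pb) auto
    finally have "\<bar>LINT x|lborel. dens (2 * k) x * ((\<Prod>i=1..m. dens (?\<kappa> i) (x - ?p i)) - (\<Prod>i=1..m. dens (?\<kappa> i) x))\<bar>
      \<le> 2 ^ (m + 1) * (real m * (4 * (Cp * 2 powr (- real R))))" by simp
    moreover have "(LINT x|lborel. dens (2 * k) x * ((\<Prod>i=1..m. dens (?\<kappa> i) (x - ?p i)) - (\<Prod>i=1..m. dens (?\<kappa> i) x)))
      = slice m P (dens (2 * k)) ?g (s / 2 ^ l) - (LINT x|lborel. dens (2 * k) x * (\<Prod>i=1..m. dens (?\<kappa> i) x))"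
      using iall[of ?p] iall[of "\<lambda>_. 0"] by (simp add: slice_def right_diff_distrib)
    ultimately show ?thesis using main by linarith
  qed
  have si: "set_integrable lborel {0..1} (\<lambda>s. slice m P (dens (2 * k)) ?g (s / 2 ^ l))"
    by (rule set_integrable_slice[where B=2]) (use abg tame_integrable[OF t] in auto)
  have "?E = (LINT s:{0..1::real}|lborel. ?E)" by (simp add: set_integral_const)
  also have "\<dots> \<le> form m P l (dens (2 * k)) ?g"
    unfolding form_def by (rule set_integral_mono[OF _ si sl]) (auto simp: set_integrable_def)
  finally show ?thesis .
qed

end

section \<open>From a gap between two scales to an approximate pattern\<close>

text \<open>By substitution, the left side of the assumption is exactly the contribution of
  \<open>t\<close> up to \<open>1 / 2 ^ R\<close> to the right side. A strict inequality therefore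
  forces a nonzero slice at some larger \<open>t\<close>.\<close>

lemma form_extract:
  assumes lt: "form m P (l + R) g0 g / 2 ^ R < form m P l g0 g"
  obtains t x where "1 / 2 ^ R < t" "t \<le> 1" "g0 x \<noteq> 0"
    "\<And>i. i \<in> {1..m} \<Longrightarrow> g i (x - poly (P i) (t / 2 ^ l)) \<noteq> 0"
proof -
  have "\<exists>t. 1 / 2 ^ R < t \<and> t \<le> 1 \<and> slice m P g0 g (t / 2 ^ l) \<noteq> 0"
  proof (rule ccontr)
    assume "\<not> ?thesis"
    then have z: "slice m P g0 g (t / 2 ^ l) = 0" if "1 / 2 ^ R < t" "t \<le> 1" for t using that by blast
    have le1: "1 / 2 ^ R \<le> (1::real)" by simp
    have "form m P l g0 g = (LINT t|lborel. indicator {0..1 / 2 ^ R} t * slice m P g0 g (t / 2 ^ l))"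
      unfolding form_def set_lebesgue_integral_def
    proof (rule Bochner_Integration.integral_cong[OF refl])
      fix t :: real
      show "indicator {0..1} t *\<^sub>R slice m P g0 g (t / 2 ^ l) = indicator {0..1 / 2 ^ R} t * slice m P g0 g (t / 2 ^ l)"
      proof (cases "t \<le> 1 / 2 ^ R")
        case True
        then have "t \<le> 1" using le1 by linarith
        then show ?thesis using True by (simp add: indicator_def)
      next
        case False
        then show ?thesis using z[of t] by (auto simp: indicator_def)
      qed
    qed
    also have "\<dots> = \<bar>1 / 2 ^ R\<bar> *\<^sub>R (LINT t|lborel. indicator {0..1 / 2 ^ R} (0 + 1 / 2 ^ R * t) * slice m P g0 g ((0 + 1 / 2 ^ R * t) / 2 ^ l))"
      by (rule lborel_integral_real_affine) simp
    also have "\<dots> = form m P (l + R) g0 g / 2 ^ R"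
    proof -
      have "indicator {0..1 / 2 ^ R} (0 + 1 / 2 ^ R * t) = (indicator {0..1} t :: real)" for t :: real
        by (auto simp: indicator_def divide_simps)
      moreover have "(0 + 1 / 2 ^ R * t) / 2 ^ l = t / 2 ^ (l + R)" for t :: real
        by (simp add: power_add)
      ultimately show ?thesis unfolding form_def set_lebesgue_integral_def by (simp only:) simp
    qed
    finally show False using lt by simp
  qed
  then obtain t where t: "1 / 2 ^ R < t" "t \<le> 1" "slice m P g0 g (t / 2 ^ l) \<noteq> 0" by blast
  have "\<exists>x. g0 x * (\<Prod>i=1..m. g i (x - poly (P i) (t / 2 ^ l))) \<noteq> 0"
  proof (rule ccontr)
    assume "\<not> ?thesis"
    then have "g0 x * (\<Prod>i=1..m. g i (x - poly (P i) (t / 2 ^ l))) = 0" for x by blast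
    then have "slice m P g0 g (t / 2 ^ l) = 0" unfolding slice_def by (simp only: Bochner_Integration.integral_zero)
    then show False using t(3) by simp
  qed
  then obtain x where x: "g0 x * (\<Prod>i=1..m. g i (x - poly (P i) (t / 2 ^ l))) \<noteq> 0" by blast
  show thesis
  proof (rule that[OF t(1,2)])
    show "g0 x \<noteq> 0" using x by auto
    show "g i (x - poly (P i) (t / 2 ^ l)) \<noteq> 0" if "i \<in> {1..m}" for i
    proof
      assume "g i (x - poly (P i) (t / 2 ^ l)) = 0"
      then have "(\<Prod>i=1..m. g i (x - poly (P i) (t / 2 ^ l))) = 0"
        using that by (intro prod_zero) auto
      then show False using x by simp
    qed
  qed
qed

context mass_tree
begin

lemma mass_descendant:
  assumes "k \<le> K" "W k i \<noteq> 0"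
  obtains j where "W K j \<noteq> 0" "j div 2 ^ (K - k) = i"
proof -
  have "\<exists>j. W k' j \<noteq> 0 \<and> j div 2 ^ (k' - k) = i" if "k \<le> k'" "k' \<le> K" for k'
    using that
  proof (induction k' rule: dec_induct)
    case base then show ?case using assms(2) by auto
  next
    case (step k')
    then obtain j where j: "W k' j \<noteq> 0" "j div 2 ^ (k' - k) = i" by auto
    have "W (Suc k') (2 * j) \<noteq> 0 \<or> W (Suc k') (2 * j + 1) \<noteq> 0"
      using mass_split[of k' j] step.prems j(1) by auto
    then obtain j' where j': "W (Suc k') j' \<noteq> 0" "j' div 2 = j" by fastforce
    have "Suc k' - k = Suc (k' - k)" using step by simp
    then have "j' div 2 ^ (Suc k' - k) = i" using j(2) j'(2) by (simp add: zdiv_zmult2_eq)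
    then show ?case using j'(1) by blast
  qed
  from this[OF assms(1) order_refl] that show thesis by blast
qed

text \<open>Nonzero mass descends to a nonzero leaf, whose cell meets \<open>A\<close>; that point
  of \<open>A\<close> shares the cell of level \<open>k\<close> with \<open>x\<close>.\<close>

lemma dens_nonzero_near:
  assumes "k \<le> K" "dens k x \<noteq> 0" and A: "\<And>i. W K i \<noteq> 0 \<Longrightarrow> cell K i \<inter> A \<noteq> {}"
  obtains y where "y \<in> A" "\<bar>x - y\<bar> \<le> 1 / 2 ^ k"
proof -
  have "W k \<lfloor>2 ^ k * x\<rfloor> \<noteq> 0" using assms(2) by (simp add: dens_def)
  then obtain j where j: "W K j \<noteq> 0" "j div 2 ^ (K - k) = \<lfloor>2 ^ k * x\<rfloor>" using mass_descendant[OF assms(1)] by blast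
  from A[OF j(1)] obtain y where y: "y \<in> A" "\<lfloor>2 ^ K * y\<rfloor> = j" by (auto simp: cell_def)
  have "\<lfloor>2 ^ k * y\<rfloor> = \<lfloor>2 ^ k * x\<rfloor>" using floor_dyadic_div[OF assms(1), of y] y(2) j(2) by simp
  then have "\<bar>2 ^ k * x - 2 ^ k * y\<bar> \<le> 1" by linarith
  then have "2 ^ k * \<bar>x - y\<bar> \<le> 1" by (simp add: abs_mult flip: right_diff_distrib)
  then have "\<bar>x - y\<bar> \<le> 1 / 2 ^ k" by (simp add: field_simps)
  with y(1) that show thesis by blast
qed

text \<open>Error budget against the main term \<open>\<kappa>\<close>: the assumption with the
  factor \<open>2 powr (- \<rho> * real R)\<close> keeps Sobolev errors, shifts, both tails and the
  small-\<open>t\<close> part below \<open>\<kappa> / 4\<close>, and the energy term costs another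
  \<open>\<kappa> / 4\<close>. The tail is needed at both scales \<open>l\<close> and
  \<open>l + R\<close>.\<close>

lemma form_gap:
  fixes a c Cp :: real and m :: nat
  defines "\<kappa> \<equiv> a / 2 * (a / (4 * real m)) ^ m"
  assumes G: "dyadic_gain m P L \<rho> D" and m: "m \<ge> 1" and R: "R \<ge> 1" "L \<le> real R" and J: "J \<ge> 1"
    and \<delta>: "2 powr (- \<rho> * real R) \<le> 1 / 2"
    and e: "\<And>i. i \<in> {1..m} \<Longrightarrow> 1 \<le> order 0 (P i) \<and> order 0 (P i) \<le> e"
    and Cp: "0 \<le> Cp" "\<And>i t. i \<in> {1..m} \<Longrightarrow> 0 \<le> t \<Longrightarrow> t \<le> 1 \<Longrightarrow> \<bar>poly (P i) t\<bar> \<le> Cp * t ^ order 0 (P i)"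
    and k: "k = 10 * e * R * J" "2 * (k * 2 ^ n) \<le> K"
    and B: "\<And>j x. j \<le> K \<Longrightarrow> dens j x \<le> 2 powr (c * real j)"
    and c: "0 \<le> c" "c * (2 * real k) \<le> 1" "4 * c * (real m + 1) \<le> \<rho> / 2"
    and a: "0 < a" "a \<le> W 0 0 + W 0 1"
    and Y: "(real m * (D * 2 ^ (m + 1)) + 2 ^ (m + 1) * (real m * (4 * Cp)) + 4 * real m * (D + 4) + 2 ^ (m + 2))
        * 2 powr (- \<rho> * real R) \<le> \<kappa> / 4"
    and Q: "256 * 4 ^ m * (real m)\<^sup>2 \<le> real J * \<kappa>\<^sup>2"
  shows "\<exists>l \<le> 2 * R * J. form m P (l + R) (dens (2 * (k * 2 ^ n))) (\<lambda>_. dens (k * 2 ^ n)) / 2 ^ R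
    < form m P l (dens (2 * (k * 2 ^ n))) (\<lambda>_. dens (k * 2 ^ n))"
proof -
  let ?d = "2 powr (- \<rho> * real R)"
  have \<kappa>: "\<kappa> > 0" using a m by (simp add: \<kappa>_def)
  have \<rho>: "0 < \<rho>" "\<rho> \<le> 1 / 2" "0 \<le> D" using G by (auto simp: dyadic_gain_def)
  have e1: "1 \<le> e" using e[of 1] m by force
  have RJ: "R \<le> R * J" "R * J \<le> e * R * J" using J e1 by simp_all
  have "k * 1 \<le> k * 2 ^ n" by (intro mult_le_mono) auto
  then have kK: "2 * k \<le> K" using k(2) by linarith
  have B2: "dens j x \<le> 2" if "j \<le> 2 * k" for j x
  proof -
    have "c * real j \<le> c * (2 * real k)" using c that by (intro mult_left_mono) auto
    then have "2 powr (c * real j) \<le> 2 powr 1" using c by (intro powr_mono) auto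
    then show ?thesis using B[of j x] that kK by simp
  qed
  have ek: "1 \<le> order 0 (P i) \<and> 2 * R * J * order 0 (P i) + R \<le> k" if "i \<in> {1..m}" for i
  proof -
    have "2 * R * J * order 0 (P i) \<le> 2 * R * J * e" using e[OF that] by (intro mult_le_mono) auto
    also have "\<dots> = 2 * (e * R * J)" by simp
    finally have "2 * R * J * order 0 (P i) + R \<le> 10 * (e * R * J)" using RJ by linarith
    then show ?thesis using e[OF that] k(1) by (simp add: mult.assoc)
  qed
  have "\<exists>n\<in>{1..J}. (\<Sum>i=1..m. LINT y|lborel. (dens (2 * R * n * order 0 (P i) + R) y - dens (2 * R * n * order 0 (P i) - R) y)\<^sup>2) \<le> 8 * real m / real J"
    by (rule energy_pigeonhole[where k=k]) (use J R ek kK B2 in auto)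
  then obtain n0 where n0: "n0 \<in> {1..J}" and
    en: "(\<Sum>i=1..m. LINT y|lborel. (dens (2 * R * n0 * order 0 (P i) + R) y - dens (2 * R * n0 * order 0 (P i) - R) y)\<^sup>2) \<le> 8 * real m / real J"
    by blast
  define l where "l = 2 * R * n0"
  have l: "R \<le> l" "l \<le> 2 * R * J" using n0 by (simp_all add: l_def)
  have lL: "L \<le> real l" "L \<le> real (l + R)" using R l by linarith+
  have lk: "1 \<le> order 0 (P i) \<and> l * order 0 (P i) + R \<le> k" if "i \<in> {1..m}" for i
  proof -
    have "l * order 0 (P i) \<le> 2 * R * J * order 0 (P i)" using l by (intro mult_le_mono) auto
    then show ?thesis using ek[OF that] by linarith
  qed
  \<comment> \<open>Balances the two terms of the AM-GM bound: the first becomes exactly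
    \<open>\<kappa> / 8\<close>, the second at most \<open>\<kappa> / 8\<close> by the lower bound
    on \<open>J\<close>.\<close>
  define \<epsilon> where "\<epsilon> = \<kappa> / (8 * 2 ^ m * real m)"
  have \<epsilon>: "\<epsilon> > 0" using \<kappa> m by (simp add: \<epsilon>_def)
  let ?S = "\<Sum>i=1..m. LINT y|lborel. \<bar>dens (l * order 0 (P i) + R) y - dens (l * order 0 (P i) - R) y\<bar>"
  have S: "2 ^ m * ?S \<le> \<kappa> / 4"
  proof -
    have "?S \<le> (\<Sum>i=1..m. \<epsilon> + (LINT y|lborel. (dens (l * order 0 (P i) + R) y - dens (l * order 0 (P i) - R) y)\<^sup>2) / (2 * \<epsilon>))"
    proof (rule sum_mono)
      fix i assume i: "i \<in> {1..m}"
      show "(LINT y|lborel. \<bar>dens (l * order 0 (P i) + R) y - dens (l * order 0 (P i) - R) y\<bar>)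
        \<le> \<epsilon> + (LINT y|lborel. (dens (l * order 0 (P i) + R) y - dens (l * order 0 (P i) - R) y)\<^sup>2) / (2 * \<epsilon>)"
        by (rule integral_abs_dens_diff[OF _ _ \<epsilon>]) (use lk[OF i] kK in linarith)+
    qed
    also have "\<dots> = real m * \<epsilon> + (\<Sum>i=1..m. LINT y|lborel. (dens (l * order 0 (P i) + R) y - dens (l * order 0 (P i) - R) y)\<^sup>2) / (2 * \<epsilon>)"
      by (simp add: sum.distrib sum_divide_distrib)
    also have "\<dots> \<le> real m * \<epsilon> + (8 * real m / real J) / (2 * \<epsilon>)"
      using en \<epsilon> unfolding l_def by (intro add_left_mono divide_right_mono) auto
    finally have "2 ^ m * ?S \<le> 2 ^ m * (real m * \<epsilon> + (8 * real m / real J) / (2 * \<epsilon>))" by (intro mult_left_mono) auto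
    also have "\<dots> = \<kappa> / 8 + (256 * 4 ^ m * (real m)\<^sup>2) / (real J * \<kappa>\<^sup>2) * (\<kappa> / 8)"
    proof -
      have p4: "(4::real) ^ m = 2 ^ m * 2 ^ m" by (simp flip: power_mult_distrib)
      have "2 ^ m * (real m * \<epsilon>) = \<kappa> / 8" using m by (simp add: \<epsilon>_def)
      moreover have "2 ^ m * ((8 * real m / real J) / (2 * \<epsilon>)) = (256 * 4 ^ m * (real m)\<^sup>2) / (real J * \<kappa>\<^sup>2) * (\<kappa> / 8)"
        unfolding p4 using m J \<kappa> by (simp add: \<epsilon>_def power2_eq_square mult_ac)
      ultimately show ?thesis by (simp only: distrib_left)
    qed
    also have "\<dots> \<le> \<kappa> / 8 + 1 * (\<kappa> / 8)"
      using Q J \<kappa> by (intro add_left_mono mult_right_mono) (auto simp: divide_le_eq_1)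
    finally show ?thesis by simp
  qed
  have dR: "2 powr (- real R) \<le> ?d"
  proof (rule powr_mono)
    have "\<rho> * real R \<le> 1 * real R" using \<rho> by (intro mult_right_mono) auto
    then show "- real R \<le> - \<rho> * real R" by simp
  qed simp
  let ?f = "\<lambda>l. form m P l (dens (2 * k)) (\<lambda>_. dens k)"
  let ?a = "\<lambda>l. form m P l (dens (2 * (k * 2 ^ n))) (\<lambda>_. dens (k * 2 ^ n))"
  have s1: "\<bar>?f l - form m P l (dens (2 * k)) (\<lambda>i. dens (l * order 0 (P i) - R))\<bar>
    \<le> real m * (D * 2 ^ (m + 1) * ?d) + 2 ^ m * ?S"
    by (rule form_scale_split[OF G lL(1) m l(1) lk kK B2])
  have s2: "\<kappa> - 2 ^ (m + 1) * (real m * (4 * (Cp * 2 powr (- real R))))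
    \<le> form m P l (dens (2 * k)) (\<lambda>i. dens (l * order 0 (P i) - R))"
    unfolding \<kappa>_def by (rule form_unshift[OF l(1) m lk kK B2 Cp a])
  have s3: "2 ^ (m + 1) * (real m * (4 * (Cp * 2 powr (- real R)))) \<le> 2 ^ (m + 1) * (real m * (4 * (Cp * ?d)))"
    using dR Cp(1) by (intro mult_left_mono) auto
  have tail: "\<bar>?a l' - ?f l'\<bar> \<le> 2 * real m * (D + 4) * ?d" if l': "l' \<le> 2 * R * J + R" "L \<le> real l'" for l'
  \<comment> \<open>The factor 10 in \<open>k\<close> is used here: the critical levels at scales up
    to \<open>2 * R * J + R\<close> are at most \<open>3 * (e * R * J)\<close>, and half of
    \<open>k\<close> is \<open>5 * (e * R * J)\<close>, which leaves room for
    \<open>R\<close>.\<close>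
  proof (rule tail_estimate[where q="e * (2 * R * J + R)" and c=c, OF G l'(2) m k(2) _ B c(1,3) _ \<delta>])
    show "l' * order 0 (P i) \<le> e * (2 * R * J + R)" if "i \<in> {1..m}" for i
      using mult_le_mono[OF l'(1), of "order 0 (P i)" e] e[OF that] by (simp add: mult.commute)
    have "e * (2 * R * J + R) = 2 * (e * R * J) + e * R" by (simp add: algebra_simps)
    moreover have "e * R \<le> e * R * J" using J by simp
    ultimately have "e * (2 * R * J + R) \<le> 3 * (e * R * J)" by linarith
    then have "real (e * (2 * R * J + R)) \<le> real (3 * (e * R * J))" by (rule of_nat_mono)
    moreover have "real (3 * (e * R * J)) = 3 * real (e * R * J)" by (simp only: of_nat_mult of_nat_numeral)
    moreover have "real (3 * (e * R * J)) = 3 * real (e * R * J)" by (simp only: of_nat_mult of_nat_numeral)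
    moreover have "real R \<le> real (e * R * J)" using RJ by (intro of_nat_mono) linarith
    moreover have "real k = 10 * real (e * R * J)" unfolding k(1) by (simp only: of_nat_mult of_nat_numeral mult.assoc)
    ultimately show "real R \<le> real k / 2 - real (e * (2 * R * J + R))" by linarith
  qed
  \<comment> \<open>At the finer scale a trivial bound is enough, since this form is divided by
    \<open>2 ^ R\<close> afterwards.\<close>
  have up: "\<bar>?f (l + R)\<bar> \<le> 2 ^ (m + 2)"
  proof (rule abs_form_le)
    fix t
    have tk: "tame 2 (dens j)" if "j \<le> 2 * k" for j
      by (rule tame_dens) (use that kK B2 in auto)
    have "\<bar>slice m P (dens (2 * k)) (\<lambda>_. dens k) (t / 2 ^ (l + R))\<bar> \<le> 2 ^ m * (LINT x|lborel. \<bar>dens k x\<bar>)"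
    proof (rule abs_slice_le[where j=1])
      show "\<bar>dens (2 * k) x\<bar> \<le> 2" "\<bar>dens k x\<bar> \<le> 2" for x using tame_abs_le[OF tk] by simp_all
      show "integrable lborel (dens k)" using tame_integrable[OF tk] by simp
    qed (use m in auto)
    also have "\<dots> \<le> 2 ^ m * (2 * 2)" using tame_integral[OF tk[of k]] by (intro mult_left_mono) auto
    finally show "\<bar>slice m P (dens (2 * k)) (\<lambda>_. dens k) (t / 2 ^ (l + R))\<bar> \<le> 2 ^ (m + 2)" by simp
  qed
  have t1: "\<bar>?a l - ?f l\<bar> \<le> 2 * real m * (D + 4) * ?d" by (rule tail) (use l lL in auto)
  have t2: "\<bar>?a (l + R) - ?f (l + R)\<bar> \<le> 2 * real m * (D + 4) * ?d" by (rule tail) (use l lL in auto)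
  have "?a (l + R) / 2 ^ R \<le> 2 ^ (m + 2) * ?d + 2 * real m * (D + 4) * ?d"
  proof -
    let ?h = "2 * real m * (D + 4) * ?d"
    have "?a (l + R) \<le> 2 ^ (m + 2) + ?h" using up t2 by linarith
    then have "?a (l + R) / 2 ^ R \<le> (2 ^ (m + 2) + ?h) / 2 ^ R" by (intro divide_right_mono) auto
    also have "\<dots> = 2 ^ (m + 2) * 2 powr (- real R) + ?h / 2 ^ R"
      by (simp only: add_divide_distrib) (simp add: powr_minus powr_realpow divide_inverse)
    also have "\<dots> \<le> 2 ^ (m + 2) * ?d + ?h / 1"
      using dR \<rho> by (intro add_mono mult_left_mono divide_left_mono) auto
    finally show ?thesis by simp
  qed
  moreover have "real m * (D * 2 ^ (m + 1) * ?d) + 2 ^ (m + 1) * (real m * (4 * (Cp * ?d)))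
      + (2 * real m * (D + 4) * ?d + 2 * real m * (D + 4) * ?d) + 2 ^ (m + 2) * ?d \<le> \<kappa> / 4"
  proof -
    have "real m * (D * 2 ^ (m + 1) * x) + 2 ^ (m + 1) * (real m * (4 * (Cp * x)))
      + (2 * real m * (D + 4) * x + 2 * real m * (D + 4) * x) + 2 ^ (m + 2) * x
      = (real m * (D * 2 ^ (m + 1)) + 2 ^ (m + 1) * (real m * (4 * Cp)) + 4 * real m * (D + 4) + 2 ^ (m + 2)) * x" for x
      by (simp add: algebra_simps)
    then show ?thesis using Y by (simp only:)
  qed
  ultimately have "?a (l + R) / 2 ^ R < ?a l" using s1 s2 s3 S t1 \<kappa> by linarith
  then show ?thesis using l(2) by blast
qed

end

section \<open>Polynomials near 0 and compactness\<close>

lemma poly_order_bound: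
  fixes p :: "real poly"
  assumes "p \<noteq> 0"
  obtains C where "0 \<le> C" "\<And>t. 0 \<le> t \<Longrightarrow> t \<le> 1 \<Longrightarrow> \<bar>poly p t\<bar> \<le> C * t ^ order 0 p"
proof -
  obtain q where q: "p = [:- 0, 1:] ^ order 0 p * q" using order_decomp[OF assms, of 0] by blast
  have "bounded (poly q ` {0..1})"
    by (intro compact_imp_bounded compact_continuous_image continuous_on_poly continuous_on_id compact_Icc)
  then obtain C where "\<forall>y\<in>poly q ` {0..1}. norm y \<le> C" unfolding bounded_iff by blast
  then have C: "\<bar>poly q x\<bar> \<le> C" if "x \<in> {0..1}" for x using that by simp
  have "\<bar>poly p t\<bar> \<le> C * t ^ order 0 p" if "0 \<le> t" "t \<le> 1" for t
  proof -
    have "poly p t = t ^ order 0 p * poly q t" by (subst q) simp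
    then have "\<bar>poly p t\<bar> = \<bar>poly q t\<bar> * t ^ order 0 p" using that by (simp add: abs_mult)
    also have "\<dots> \<le> C * t ^ order 0 p" using C[of t] that by (intro mult_right_mono) auto
    finally show ?thesis .
  qed
  moreover have "0 \<le> C" using C[of 0] by force
  ultimately show thesis using that by blast
qed

text \<open>A convergent subsequence in \<open>A\<close> times the parameter interval. The bound
  \<open>\<tau>\<close> is common to all \<open>n\<close>, so it survives in the limit and keeps the
  parameter away from 0.\<close>

lemma pattern_of_approximations:
  fixes A :: "real set" and p :: "nat \<Rightarrow> real poly"
  assumes A: "compact A" and \<tau>: "0 < \<tau>"
    and ap: "\<And>n. \<exists>x\<in>A. \<exists>t\<in>{\<tau>..1}. \<forall>i\<in>I. \<exists>y\<in>A. \<bar>x - poly (p i) t - y\<bar> \<le> 2 / 2 ^ n"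
  shows "\<exists>x\<in>A. \<exists>t\<in>{\<tau>..1}. \<forall>i\<in>I. x - poly (p i) t \<in> A"
proof -
  obtain x t y where x: "\<And>n. x n \<in> A" and t: "\<And>n. t n \<in> {\<tau>..1}"
    and y: "\<And>n i. i \<in> I \<Longrightarrow> y n i \<in> A" "\<And>n i. i \<in> I \<Longrightarrow> \<bar>x n - poly (p i) (t n) - y n i\<bar> \<le> 2 / 2 ^ n"
    using ap by metis
  have "compact (A \<times> {\<tau>..1})" using A by (intro compact_Times) auto
  then obtain z r where z: "z \<in> A \<times> {\<tau>..1}" and r: "strict_mono r"
    and lim: "((\<lambda>n. (x n, t n)) \<circ> r) \<longlonglongrightarrow> z"
    unfolding compact_def using x t by (metis (no_types, lifting) SigmaI)
  have lx: "(\<lambda>n. x (r n)) \<longlonglongrightarrow> fst z" and lt: "(\<lambda>n. t (r n)) \<longlonglongrightarrow> snd z"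
    using tendsto_fst[OF lim] tendsto_snd[OF lim] by (simp_all add: o_def)
  have "fst z - poly (p i) (snd z) \<in> A" if i: "i \<in> I" for i
  proof -
    let ?e = "\<lambda>n. x (r n) - poly (p i) (t (r n)) - y (r n) i"
    have "(\<lambda>n. 2 / 2 ^ n :: real) \<longlonglongrightarrow> 0" by real_asymp
    then have "(\<lambda>n. 2 / 2 ^ r n :: real) \<longlonglongrightarrow> 0" using LIMSEQ_subseq_LIMSEQ[OF _ r] by (fastforce simp: o_def)
    then have e: "?e \<longlonglongrightarrow> 0"
      by (rule tendsto_0_le[where K=1]) (use y(2)[OF i] in \<open>auto intro!: always_eventually\<close>)
    have "(\<lambda>n. x (r n) - poly (p i) (t (r n)) - ?e n) \<longlonglongrightarrow> fst z - poly (p i) (snd z) - 0"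
      by (intro tendsto_diff lx e tendsto_poly lt)
    then have "(\<lambda>n. y (r n) i) \<longlonglongrightarrow> fst z - poly (p i) (snd z)" by simp
    then show ?thesis
      by (rule closed_sequentially[OF compact_imp_closed[OF A], rotated]) (rule y(1)[OF i])
  qed
  then show ?thesis using z by (intro bexI[of _ "fst z"] bexI[of _ "snd z"]) auto
qed

section \<open>Choice of parameters and conclusion\<close>

text \<open>The threshold \<open>c0\<close> has to be fixed before \<open>a\<close> is known. Every
  requirement on \<open>R\<close> and \<open>J\<close> is a power law in \<open>a\<close>, with
  constants collected in \<open>X\<close>, \<open>Q'\<close> and \<open>U\<close>; the remaining
  condition on \<open>c\<close> is then a power law as well.\<close>

lemma parameters_exist:
  fixes m e :: nat and \<sigma> \<rho> C Y Q :: real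
  assumes m: "m \<ge> 1" and e: "e \<ge> 1" and pos: "0 < \<sigma>" "0 < \<rho>" "0 \<le> Y" "0 \<le> Q" "0 \<le> C"
  obtains c0 :: real where "0 < c0" "c0 \<le> 1 / 2"
    "\<And>a c. 0 < a \<Longrightarrow> a \<le> 2 \<Longrightarrow> 0 < c \<Longrightarrow> c \<le> \<sigma> * a ^ (10 * m) \<Longrightarrow> c \<le> c0 \<Longrightarrow>
      \<exists>R J. 1 \<le> R \<and> C \<le> real R \<and> 2 powr (- \<rho> * real R) \<le> 1 / 2 \<and> 1 \<le> J \<and>
        c * (2 * real (10 * e * R * J)) \<le> 1 \<and> 4 * c * (real m + 1) \<le> \<rho> / 2 \<and>
        Y * 2 powr (- \<rho> * real R) \<le> (a / 2 * (a / (4 * real m)) ^ m) / 4 \<and>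
        Q \<le> real J * (a / 2 * (a / (4 * real m)) ^ m)\<^sup>2"
proof -
  define q where "q = 2 * (4 * real m) ^ m"
  have q: "q > 0" using m by (simp add: q_def)
  have \<kappa>: "a / 2 * (a / (4 * real m)) ^ m = a ^ (m + 1) / q" for a :: real
    by (simp add: q_def power_divide)
  define Z where "Z = max 1 (4 * Y * q)"
  have Z: "1 \<le> Z" "4 * Y * q \<le> Z" by (simp_all add: Z_def)
  define T where "T = (real m + 1) * Z / (\<rho> * ln 2)"
  define X where "X = T + 2 * C + 2 / \<rho> + 2"
  define Q' where "Q' = Q * q\<^sup>2 + 2 ^ (2 * m + 2)"
  define U where "U = 20 * real e * (X + 2) * Q'"
  have t0: "0 \<le> T" using Z pos by (simp add: T_def)
  have X0: "0 < X" using pos t0 by (auto simp: X_def intro!: add_nonneg_pos)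
  have Q'0: "0 < Q'" using pos by (auto simp: Q'_def intro!: add_nonneg_pos)
  have U0: "0 < U" using X0 Q'0 e by (auto simp: U_def)
  define c0 where "c0 = min (1 / 2) (min (\<rho> / (8 * (real m + 1))) (1 / (\<sigma> * 2 ^ (6 * m) * U\<^sup>2)))"
  have c0: "0 < c0" "c0 \<le> 1 / 2" "c0 \<le> \<rho> / (8 * (real m + 1))" "c0 \<le> 1 / (\<sigma> * 2 ^ (6 * m) * U\<^sup>2)"
    using pos U0 unfolding c0_def by (simp_all only: min.cobounded1 min.coboundedI2 min.cobounded2 order_refl) (auto simp: min_def)
  show thesis
  proof (rule that[OF c0(1,2)])
    fix a c :: real
    assume a: "0 < a" "a \<le> 2" and c: "0 < c" "c \<le> \<sigma> * a ^ (10 * m)" "c \<le> c0"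
    \<comment> \<open>Order \<open>1 / a\<close> is more than the logarithm that the decay would
      require, but it keeps all bounds polynomial. \<open>J\<close> is the smallest order allowed by
      the energy condition.\<close>
    define R where "R = nat \<lceil>X / a\<rceil>"
    define J where "J = nat \<lceil>Q * q\<^sup>2 / a ^ (2 * m + 2)\<rceil> + 1"
    have Xa: "0 < X / a" using X0 a by simp
    have R: "X / a \<le> real R" "real R \<le> X / a + 1" using Xa by (simp_all add: R_def)
    have Rle: "real R \<le> (X + 2) / a"
      using R(2) a by (simp add: field_simps)
    have J0: "0 \<le> Q * q\<^sup>2 / a ^ (2 * m + 2)" using pos a by simp
    have "real J = of_int \<lceil>Q * q\<^sup>2 / a ^ (2 * m + 2)\<rceil> + 1" using J0 unfolding J_def by (simp add: of_nat_nat)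
    then have J: "Q * q\<^sup>2 / a ^ (2 * m + 2) \<le> real J" "real J \<le> Q * q\<^sup>2 / a ^ (2 * m + 2) + 2"
      by linarith+
    have Jle: "real J \<le> Q' * 2 / a ^ (2 * m + 2)"
    proof -
      have "a ^ (2 * m + 2) \<le> 2 ^ (2 * m + 2)" using a by (intro power_mono) auto
      then have "2 \<le> 2 * 2 ^ (2 * m + 2) / a ^ (2 * m + 2)" using a by (simp add: pos_le_divide_eq)
      moreover have "Q * q\<^sup>2 / a ^ (2 * m + 2) \<le> 2 * (Q * q\<^sup>2) / a ^ (2 * m + 2)"
        using pos a by (intro divide_right_mono) auto
      moreover have "2 * (Q * q\<^sup>2) / a ^ (2 * m + 2) + 2 * 2 ^ (2 * m + 2) / a ^ (2 * m + 2) = Q' * 2 / a ^ (2 * m + 2)"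
        by (simp add: Q'_def add_divide_distrib distrib_right)
      ultimately show ?thesis using J(2) by linarith
    qed
    have "X / 2 \<le> X / a" using a X0 by (intro divide_left_mono) auto
    then have Xp: "X / 2 \<le> real R" using R(1) by linarith
    have C: "C \<le> real R" "1 \<le> real R" "1 / \<rho> \<le> real R"
    proof -
      have "0 \<le> 1 / \<rho>" using pos by simp
      moreover have "X / 2 = T / 2 + C + 1 / \<rho> + 1" by (simp add: X_def add_divide_distrib)
      ultimately show "C \<le> real R" "1 \<le> real R" "1 / \<rho> \<le> real R" using Xp t0 pos(5) by linarith+
    qed
    have R1: "1 \<le> \<rho> * real R" using C(3) pos by (simp add: field_simps)
    have p: "2 powr (- \<rho> * real R) \<le> 1 / 2"
    proof -
      have "2 powr (- \<rho> * real R) \<le> 2 powr (- 1)" using R1 by (intro powr_mono) auto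
      then show ?thesis by (simp add: powr_minus)
    qed
    \<comment> \<open>An exponential beats a power through
      \<open>exp (?y / (real m + 1)) \<ge> ?y / (real m + 1)\<close>, raised to the power
      \<open>m + 1\<close>. Taking \<open>Z\<close> at least 1 ensures
      \<open>Z \<le> Z ^ (m + 1)\<close>.\<close>
    have grow: "4 * Y * q \<le> 2 powr (\<rho> * real R) * a ^ (m + 1)"
    proof -
      let ?y = "\<rho> * real R * ln 2"
      have "(real m + 1) * Z / (\<rho> * ln 2) \<le> X" using pos t0 by (simp add: X_def T_def)
      then have "(real m + 1) * Z / (\<rho> * ln 2) / a \<le> X / a" using a by (intro divide_right_mono) auto
      then have "(real m + 1) * Z / (\<rho> * ln 2) / a \<le> real R" using R(1) by linarith
      then have "Z / a \<le> ?y / (real m + 1)" using pos a by (simp add: field_simps)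
      also have "\<dots> \<le> exp (?y / (real m + 1))" using exp_ge_add_one_self[of "?y / (real m + 1)"] by linarith
      finally have "(Z / a) ^ (m + 1) \<le> exp (?y / (real m + 1)) ^ (m + 1)" using Z a by (intro power_mono) auto
      also have "\<dots> = exp (real (m + 1) * (?y / (real m + 1)))" by (rule exp_of_nat_mult[symmetric])
      also have "real (m + 1) * (?y / (real m + 1)) = ?y" by (simp add: field_simps)
      also have "exp ?y = 2 powr (\<rho> * real R)" by (simp add: powr_def)
      finally have "(Z / a) ^ (m + 1) * a ^ (m + 1) \<le> 2 powr (\<rho> * real R) * a ^ (m + 1)"
        using a by (intro mult_right_mono) auto
      moreover have "(Z / a) ^ (m + 1) * a ^ (m + 1) = Z ^ (m + 1)" using a by (simp add: power_divide)
      moreover have "Z \<le> Z ^ (m + 1)" using Z by (intro self_le_power) auto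
      ultimately show ?thesis using Z(2) by linarith
    qed
    have Y: "Y * 2 powr (- \<rho> * real R) \<le> (a ^ (m + 1) / q) / 4"
    proof -
      have "Y \<le> 2 powr (\<rho> * real R) * (a ^ (m + 1) / q / 4)" using grow q by (simp add: field_simps)
      then have "Y * 2 powr (- \<rho> * real R) \<le> 2 powr (\<rho> * real R) * (a ^ (m + 1) / q / 4) * 2 powr (- \<rho> * real R)"
        by (intro mult_right_mono) auto
      also have "\<dots> = (a ^ (m + 1) / q / 4) * (2 powr (\<rho> * real R) * 2 powr (- \<rho> * real R))" by (simp only: mult_ac)
      also have "2 powr (\<rho> * real R) * 2 powr (- \<rho> * real R) = (1::real)" by (simp flip: powr_add)
      finally show ?thesis by simp
    qed
    have QJ: "Q \<le> real J * (a ^ (m + 1) / q)\<^sup>2"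
    proof -
      have "(m + 1) * 2 = 2 * m + 2" by simp
      then have "(a ^ (m + 1))\<^sup>2 = a ^ (2 * m + 2)" by (metis power_mult)
      moreover have "Q * q\<^sup>2 \<le> real J * a ^ (2 * m + 2)" using J(1) a by (simp add: pos_divide_le_eq)
      ultimately show ?thesis using q by (simp add: power_divide pos_le_divide_eq)
    qed
    have c5: "4 * c * (real m + 1) \<le> \<rho> / 2"
    proof -
      have "c \<le> \<rho> / (8 * (real m + 1))" using c(3) c0(3) by linarith
      then show ?thesis by (simp add: field_simps)
    qed
    \<comment> \<open>Geometric mean of the two upper bounds for \<open>c\<close>: in their product
      \<open>\<sigma>\<close> cancels, and the surplus power \<open>a ^ (6 * m - 6)\<close> is at
      most \<open>2 ^ (6 * m - 6)\<close> because \<open>a\<close> is at most 2.\<close>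
    have cU: "c \<le> a ^ (2 * m + 3) / (2 * U)"
    proof (rule power2_le_imp_le)
      have "10 * m = (4 * m + 6) + (6 * m - 6)" using m by simp
      then have "a ^ (10 * m) = a ^ (4 * m + 6) * a ^ (6 * m - 6)" by (simp only: power_add)
      also have "\<dots> \<le> a ^ (4 * m + 6) * 2 ^ (6 * m - 6)" using a by (intro mult_left_mono power_mono) auto
      finally have a10: "a ^ (10 * m) \<le> a ^ (4 * m + 6) * 2 ^ (6 * m - 6)" .
      have "6 * m = (6 * m - 6) + 6" using m by simp
      then have p6: "(2::real) ^ (6 * m) = 2 ^ (6 * m - 6) * 2 ^ 6" by (metis power_add)
      have "c\<^sup>2 \<le> 1 / (\<sigma> * 2 ^ (6 * m) * U\<^sup>2) * (\<sigma> * a ^ (10 * m))"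
        unfolding power2_eq_square[of c] using c c0(4) pos U0 by (intro mult_mono) auto
      also have "\<dots> = a ^ (10 * m) / (2 ^ (6 * m) * U\<^sup>2)" using pos by simp
      also have "\<dots> \<le> a ^ (4 * m + 6) * 2 ^ (6 * m - 6) / (2 ^ (6 * m) * U\<^sup>2)"
        using a10 by (intro divide_right_mono) auto
      also have "\<dots> = a ^ (4 * m + 6) / (64 * U\<^sup>2)" unfolding p6 by simp
      also have "\<dots> \<le> a ^ (4 * m + 6) / (4 * U\<^sup>2)" using a U0 by (intro divide_left_mono) auto
      also have "\<dots> = (a ^ (2 * m + 3) / (2 * U))\<^sup>2"
      proof -
        have "(2 * m + 3) * 2 = 4 * m + 6" by simp
        then have "(a ^ (2 * m + 3))\<^sup>2 = a ^ (4 * m + 6)" by (metis power_mult)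
        then show ?thesis by (simp add: power_divide power_mult_distrib)
      qed
      finally show "c\<^sup>2 \<le> (a ^ (2 * m + 3) / (2 * U))\<^sup>2" .
    qed (use a U0 in auto)
    have ck: "c * (2 * real (10 * e * R * J)) \<le> 1"
    proof -
      have "real R * real J \<le> ((X + 2) / a) * (Q' * 2 / a ^ (2 * m + 2))"
        using Rle Jle X0 a by (intro mult_mono) auto
      then have "c * (20 * real e * (real R * real J)) \<le> c * (20 * real e * (((X + 2) / a) * (Q' * 2 / a ^ (2 * m + 2))))"
        using c(1) by (intro mult_left_mono) auto
      also have "\<dots> = c * (2 * U / a ^ (2 * m + 3))"
      proof -
        have "a ^ (2 * m + 3) = a * a ^ (2 * m + 2)" by (simp add: eval_nat_numeral)
        then show ?thesis by (simp add: U_def)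
      qed
      also have "\<dots> \<le> (a ^ (2 * m + 3) / (2 * U)) * (2 * U / a ^ (2 * m + 3))"
        using cU U0 a by (intro mult_right_mono) auto
      also have "\<dots> = 1" using a U0 by simp
      finally show ?thesis by (simp add: mult_ac)
    qed
    show "\<exists>R J. 1 \<le> R \<and> C \<le> real R \<and> 2 powr (- \<rho> * real R) \<le> 1 / 2 \<and> 1 \<le> J \<and>
        c * (2 * real (10 * e * R * J)) \<le> 1 \<and> 4 * c * (real m + 1) \<le> \<rho> / 2 \<and>
        Y * 2 powr (- \<rho> * real R) \<le> (a / 2 * (a / (4 * real m)) ^ m) / 4 \<and>
        Q \<le> real J * (a / 2 * (a / (4 * real m)) ^ m)\<^sup>2"
      unfolding \<kappa> using C p c5 ck Y QJ by (intro exI[of _ R] exI[of _ J]) (auto simp: J_def)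
  qed
qed

text \<open>Each depth gets its own tree, so no limiting measure is formed: \<open>R\<close>,
  \<open>J\<close> and \<open>\<tau>\<close> are chosen before the depth, and the limit is taken
  only for the points found.\<close>

lemma pattern_if_content:
  assumes m: "m \<ge> 1" and rc: "relatively_curved m P" and S: "sobolev_estimate m P \<sigma> C"
  obtains c0 where "0 < c0"
    "\<And>a c s A. 0 < a \<Longrightarrow> 0 < c \<Longrightarrow> c \<le> \<sigma> * a ^ (10 * m) \<Longrightarrow> c \<le> c0 \<Longrightarrow> compact A \<Longrightarrow> A \<subseteq> {0..1} \<Longrightarrow>
      1 - c < s \<Longrightarrow> ennreal a \<le> hausdorff_content s A \<Longrightarrow>
      \<exists>x\<in>A. \<exists>t\<in>{0..1}. t \<noteq> 0 \<and> (\<forall>i\<in>{1..m}. x - poly (P i) t \<in> A)"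
proof -
  define \<rho> where "\<rho> = min \<sigma> 1 / 2"
  define D where "D = 8 ^ m * 4 * C + 280 * pi"
  have \<sigma>: "0 < \<sigma>" and C: "0 \<le> C" using S by (auto simp: sobolev_estimate_def)
  have G: "dyadic_gain m P C \<rho> D"
    unfolding \<rho>_def D_def by (rule sobolev_dyadic_gain[OF S m])
  have \<rho>: "0 < \<rho>" "0 \<le> D" using G by (auto simp: dyadic_gain_def)
  define e where "e = (\<Sum>i=1..m. order 0 (P i))"
  have P: "P i \<noteq> 0" "1 \<le> order 0 (P i)" "order 0 (P i) \<le> e" if i: "i \<in> {1..m}" for i
  proof -
    show p: "P i \<noteq> 0" using rc i unfolding relatively_curved_def by blast
    have "poly (P i) 0 = 0" using rc i unfolding relatively_curved_def by blast
    then have "order 0 (P i) \<noteq> 0" using p by (simp add: order_root)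
    then show "1 \<le> order 0 (P i)" by simp
    show "order 0 (P i) \<le> e" unfolding e_def using i by (intro member_le_sum) auto
  qed
  have e1: "1 \<le> e" using P(2,3)[of 1] m by force
  have "\<forall>i\<in>{1..m}. \<exists>B. 0 \<le> B \<and> (\<forall>t. 0 \<le> t \<longrightarrow> t \<le> 1 \<longrightarrow> \<bar>poly (P i) t\<bar> \<le> B * t ^ order 0 (P i))"
  proof
    fix i assume "i \<in> {1..m}"
    from poly_order_bound[OF P(1)[OF this]] show "\<exists>B. 0 \<le> B \<and> (\<forall>t. 0 \<le> t \<longrightarrow> t \<le> 1 \<longrightarrow> \<bar>poly (P i) t\<bar> \<le> B * t ^ order 0 (P i))"
      by metis
  qed
  then obtain Cf where Cf: "\<And>i. i \<in> {1..m} \<Longrightarrow> 0 \<le> Cf i"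
      "\<And>i t. i \<in> {1..m} \<Longrightarrow> 0 \<le> t \<Longrightarrow> t \<le> 1 \<Longrightarrow> \<bar>poly (P i) t\<bar> \<le> Cf i * t ^ order 0 (P i)"
    by metis
  define Cp where "Cp = (\<Sum>i=1..m. Cf i)"
  have Cp0: "0 \<le> Cp" unfolding Cp_def by (intro sum_nonneg Cf)
  have Cp: "\<bar>poly (P i) t\<bar> \<le> Cp * t ^ order 0 (P i)" if i: "i \<in> {1..m}" and t: "0 \<le> t" "t \<le> 1" for i t
  proof -
    have "Cf i \<le> Cp" unfolding Cp_def using i Cf(1) by (intro member_le_sum) auto
    then have "Cf i * t ^ order 0 (P i) \<le> Cp * t ^ order 0 (P i)" using t by (intro mult_right_mono) auto
    then show ?thesis using Cf(2)[OF i t] by linarith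
  qed
  define Y where "Y = real m * (D * 2 ^ (m + 1)) + 2 ^ (m + 1) * (real m * (4 * Cp)) + 4 * real m * (D + 4) + 2 ^ (m + 2)"
  have Y0: "0 \<le> Y" using \<rho> Cp0 by (auto simp: Y_def intro!: add_nonneg_nonneg mult_nonneg_nonneg)
  have Q0: "0 \<le> 256 * 4 ^ m * (real m)\<^sup>2" by simp
  obtain c0 where c0: "0 < c0" "c0 \<le> 1 / 2"
    and par: "\<And>a c. 0 < a \<Longrightarrow> a \<le> 2 \<Longrightarrow> 0 < c \<Longrightarrow> c \<le> \<sigma> * a ^ (10 * m) \<Longrightarrow> c \<le> c0 \<Longrightarrow>
      \<exists>R J. 1 \<le> R \<and> C \<le> real R \<and> 2 powr (- \<rho> * real R) \<le> 1 / 2 \<and> 1 \<le> J \<and>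
        c * (2 * real (10 * e * R * J)) \<le> 1 \<and> 4 * c * (real m + 1) \<le> \<rho> / 2 \<and>
        Y * 2 powr (- \<rho> * real R) \<le> (a / 2 * (a / (4 * real m)) ^ m) / 4 \<and>
        256 * 4 ^ m * (real m)\<^sup>2 \<le> real J * (a / 2 * (a / (4 * real m)) ^ m)\<^sup>2"
    using parameters_exist[OF m e1 \<sigma> \<rho>(1) Y0 Q0 C] by blast
  show thesis
  proof (rule that[OF c0(1)])
    fix a c s :: real and A :: "real set"
    assume a: "0 < a" and c: "0 < c" "c \<le> \<sigma> * a ^ (10 * m)" "c \<le> c0"
      and A: "compact A" "A \<subseteq> {0..1}" and s: "1 - c < s" and cont: "ennreal a \<le> hausdorff_content s A"
    \<comment> \<open>This is why \<open>c0\<close> was taken at most 1/2.\<close>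
    have s0: "0 < s" using s c c0 by linarith
    have mass: "a \<le> w" if "hausdorff_content s A \<le> ennreal w" "0 \<le> w" for w
    proof -
      have "ennreal a \<le> ennreal w" using cont that(1) by (rule order_trans)
      then show ?thesis using that(2) by simp
    qed
    \<comment> \<open>The tree of depth 0 consists of the two roots, each of mass at most 1.\<close>
    have "a \<le> 2"
    proof (rule frostman_tree[OF s0 A(2), of 0])
      fix W :: "nat \<Rightarrow> int \<Rightarrow> real"
      assume "mass_tree 0 W" and W: "\<And>k i. k \<le> 0 \<Longrightarrow> W k i \<le> 2 powr (- s * real k)"
        and h: "hausdorff_content s A \<le> ennreal (W 0 0 + W 0 1)"
      then interpret mass_tree 0 W by simp
      have "0 \<le> W 0 0" "0 \<le> W 0 1" by (rule mass_nonneg; simp)+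
      moreover have "W 0 0 \<le> 1" "W 0 1 \<le> 1" using W[of 0] by simp_all
      ultimately show ?thesis using mass[OF h] by linarith
    qed
    from par[OF a this c] obtain R J where R: "1 \<le> R" "C \<le> real R" and \<delta>: "2 powr (- \<rho> * real R) \<le> 1 / 2"
      and J: "1 \<le> J" and ck: "c * (2 * real (10 * e * R * J)) \<le> 1" and cm: "4 * c * (real m + 1) \<le> \<rho> / 2"
      and Y: "Y * 2 powr (- \<rho> * real R) \<le> (a / 2 * (a / (4 * real m)) ^ m) / 4"
      and Q: "256 * 4 ^ m * (real m)\<^sup>2 \<le> real J * (a / 2 * (a / (4 * real m)) ^ m)\<^sup>2"
      by blast
    define k where "k = 10 * e * R * J"
    have k1: "1 \<le> k" using e1 R J by (simp add: k_def)
    \<comment> \<open>The good scale satisfies \<open>l \<le> 2 * R * J\<close> and the extracted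
      parameter exceeds \<open>1 / 2 ^ R\<close> before division by \<open>2 ^ l\<close>.\<close>
    define \<tau> :: real where "\<tau> = 1 / 2 ^ (2 * R * J + R)"
    have \<tau>: "0 < \<tau>" by (simp add: \<tau>_def)
    have "\<exists>x\<in>A. \<exists>t\<in>{\<tau>..1}. \<forall>i\<in>{1..m}. x - poly (P i) t \<in> A"
    proof (rule pattern_of_approximations[OF A(1) \<tau>])
      fix n :: nat
      \<comment> \<open>The depth equals the level of the base density after \<open>n\<close>
        doublings, and the slots sit at half of it; both resolve \<open>A\<close> to within
        \<open>1 / 2 ^ n\<close>.\<close>
      let ?K = "2 * (k * 2 ^ n)"
      obtain W where tree: "mass_tree ?K W" and Wle: "\<And>k i. k \<le> ?K \<Longrightarrow> W k i \<le> 2 powr (- s * real k)"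
        and hit: "\<And>i. W ?K i \<noteq> 0 \<Longrightarrow> cell ?K i \<inter> A \<noteq> {}"
        and h: "hausdorff_content s A \<le> ennreal (W 0 0 + W 0 1)"
        using frostman_tree[OF s0 A(2), of ?K] by blast
      interpret mass_tree ?K W by (rule tree)
      have B: "dens j x \<le> 2 powr (c * real j)" if "j \<le> ?K" for j x
      proof -
        have "dens j x \<le> 2 ^ j * 2 powr (- s * real j)"
          unfolding dens_def using Wle[OF that] by (intro mult_left_mono) auto
        also have "\<dots> = 2 powr ((1 - s) * real j)"
          by (simp add: powr_realpow[symmetric] left_diff_distrib flip: powr_add)
        also have "\<dots> \<le> 2 powr (c * real j)" using s by (intro powr_mono mult_right_mono) auto
        finally show ?thesis .
      qed
      have aW: "a \<le> W 0 0 + W 0 1"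
        by (rule mass[OF h]) (intro add_nonneg_nonneg mass_nonneg; simp)
      have Pe: "1 \<le> order 0 (P i) \<and> order 0 (P i) \<le> e" if "i \<in> {1..m}" for i using P[OF that] by simp
      have "\<exists>l \<le> 2 * R * J. form m P (l + R) (dens ?K) (\<lambda>_. dens (k * 2 ^ n)) / 2 ^ R < form m P l (dens ?K) (\<lambda>_. dens (k * 2 ^ n))"
        by (rule form_gap[OF G m R J \<delta> Pe Cp0 Cp k_def order_refl B less_imp_le[OF c(1)] ck[folded k_def] cm a aW Y[unfolded Y_def] Q])
      then obtain l where l: "l \<le> 2 * R * J"
        and lt: "form m P (l + R) (dens ?K) (\<lambda>_. dens (k * 2 ^ n)) / 2 ^ R < form m P l (dens ?K) (\<lambda>_. dens (k * 2 ^ n))"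
        by blast
      obtain t x where t: "1 / 2 ^ R < t" "t \<le> 1" and x: "dens ?K x \<noteq> 0"
        and xi: "\<And>i. i \<in> {1..m} \<Longrightarrow> dens (k * 2 ^ n) (x - poly (P i) (t / 2 ^ l)) \<noteq> 0"
        using form_extract[OF lt] by blast
      have "n \<le> k * 2 ^ n"
        using mult_le_mono[OF k1 less_imp_le[OF less_exp[of n]]] by simp
      then have small: "(1::real) / 2 ^ (k * 2 ^ n) \<le> 1 / 2 ^ n" "(1::real) / 2 ^ ?K \<le> 1 / 2 ^ n"
        by (intro divide_left_mono power_increasing; simp)+
      obtain y where y: "y \<in> A" "\<bar>x - y\<bar> \<le> 1 / 2 ^ ?K"
        using dens_nonzero_near[OF order_refl x hit] by blast
      have tin: "t / 2 ^ l \<in> {\<tau>..1}"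
      proof -
        have "\<tau> \<le> 1 / 2 ^ (l + R)" unfolding \<tau>_def using l by (intro divide_left_mono power_increasing) auto
        also have "\<dots> = (1 / 2 ^ R) / 2 ^ l" by (simp add: power_add)
        also have "\<dots> \<le> t / 2 ^ l" using t by (intro divide_right_mono) auto
        finally have "\<tau> \<le> t / 2 ^ l" .
        moreover have "t \<le> 2 ^ l" using t(2) one_le_power[of "2::real" l] by linarith
        ultimately show ?thesis by simp
      qed
      have "\<forall>i\<in>{1..m}. \<exists>z\<in>A. \<bar>y - poly (P i) (t / 2 ^ l) - z\<bar> \<le> 2 / 2 ^ n"
      proof
        fix i assume i: "i \<in> {1..m}"
        obtain z where z: "z \<in> A" "\<bar>x - poly (P i) (t / 2 ^ l) - z\<bar> \<le> 1 / 2 ^ (k * 2 ^ n)"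
          using dens_nonzero_near[OF _ xi[OF i] hit] by auto
        have "(2::real) / 2 ^ n = 1 / 2 ^ n + 1 / 2 ^ n" by simp
        then have "\<bar>y - poly (P i) (t / 2 ^ l) - z\<bar> \<le> 2 / 2 ^ n" using z(2) y(2) small by linarith
        then show "\<exists>z\<in>A. \<bar>y - poly (P i) (t / 2 ^ l) - z\<bar> \<le> 2 / 2 ^ n" using z(1) by blast
      qed
      then show "\<exists>x\<in>A. \<exists>t\<in>{\<tau>..1}. \<forall>i\<in>{1..m}. \<exists>y\<in>A. \<bar>x - poly (P i) t - y\<bar> \<le> 2 / 2 ^ n"
        using y(1) tin by blast
    qed
    then obtain x t where "x \<in> A" "t \<in> {\<tau>..1}" "\<forall>i\<in>{1..m}. x - poly (P i) t \<in> A" by blast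
    then show "\<exists>x\<in>A. \<exists>t\<in>{0..1}. t \<noteq> 0 \<and> (\<forall>i\<in>{1..m}. x - poly (P i) t \<in> A)"
      using \<tau> by (intro bexI[of _ x] bexI[of _ t]) auto
  qed
qed

theorem theorem1p8:
  fixes m :: nat
  assumes "m \<ge> 1"
  shows "\<exists>Cm::real. Cm > 0 \<and>
    (\<forall>(P :: nat \<Rightarrow> real poly) (\<sigma>::real) (C::real).
       relatively_curved m P \<longrightarrow> sobolev_estimate m P \<sigma> C \<longrightarrow>
       (\<exists>c0::real. c0 > 0 \<and>
          (\<forall>(a::real) (c::real) (s::real) (A :: real set).
             a > 0 \<longrightarrow> c > 0 \<longrightarrow> c \<le> Cm * \<sigma> * a ^ (10 * m) \<longrightarrow> c \<le> c0 \<longrightarrow>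
             compact A \<longrightarrow> A \<subseteq> {0..1} \<longrightarrow>
             s > 1 - c \<longrightarrow> hausdorff_content s A \<ge> ennreal a \<longrightarrow>
             (\<exists>x\<in>{0..1}. \<exists>t\<in>{0..1}. t \<noteq> 0 \<and>
                insert x ((\<lambda>i. x - poly (P i) t) ` {1..m}) \<subseteq> A))))"
proof (rule exI[of _ 1], rule conjI, simp, intro allI impI)
  \<comment> \<open>The value 1 serves for every \<open>m\<close>; all dependence on the polynomials
    is carried by \<open>c0\<close>.\<close>
  fix P :: "nat \<Rightarrow> real poly" and \<sigma> C :: real
  assume P: "relatively_curved m P" "sobolev_estimate m P \<sigma> C"
  obtain c0 where c0: "0 < c0"
    and *: "\<And>a c s A. 0 < a \<Longrightarrow> 0 < c \<Longrightarrow> c \<le> \<sigma> * a ^ (10 * m) \<Longrightarrow> c \<le> c0 \<Longrightarrow> compact A \<Longrightarrow> A \<subseteq> {0..1} \<Longrightarrow>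
      1 - c < s \<Longrightarrow> ennreal a \<le> hausdorff_content s A \<Longrightarrow>
      \<exists>x\<in>A. \<exists>t\<in>{0..1}. t \<noteq> 0 \<and> (\<forall>i\<in>{1..m}. x - poly (P i) t \<in> A)"
    using pattern_if_content[OF assms P] by blast
  show "\<exists>c0::real. c0 > 0 \<and>
          (\<forall>(a::real) (c::real) (s::real) (A :: real set).
             a > 0 \<longrightarrow> c > 0 \<longrightarrow> c \<le> 1 * \<sigma> * a ^ (10 * m) \<longrightarrow> c \<le> c0 \<longrightarrow>
             compact A \<longrightarrow> A \<subseteq> {0..1} \<longrightarrow>
             s > 1 - c \<longrightarrow> hausdorff_content s A \<ge> ennreal a \<longrightarrow>
             (\<exists>x\<in>{0..1}. \<exists>t\<in>{0..1}. t \<noteq> 0 \<and>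
                insert x ((\<lambda>i. x - poly (P i) t) ` {1..m}) \<subseteq> A))"
  proof (rule exI[of _ c0], rule conjI, rule c0, intro allI impI)
    fix a c s :: real and A :: "real set"
    assume h: "0 < a" "0 < c" "c \<le> 1 * \<sigma> * a ^ (10 * m)" "c \<le> c0" "compact A" "A \<subseteq> {0..1}"
      "1 - c < s" "ennreal a \<le> hausdorff_content s A"
    have "c \<le> \<sigma> * a ^ (10 * m)" using h(3) by simp
    from *[OF h(1,2) this h(4-8)] obtain x t where xt: "x \<in> A" "t \<in> {0..1}" "t \<noteq> 0"
      "\<forall>i\<in>{1..m}. x - poly (P i) t \<in> A" by blast
    show "\<exists>x\<in>{0..1}. \<exists>t\<in>{0..1}. t \<noteq> 0 \<and> insert x ((\<lambda>i. x - poly (P i) t) ` {1..m}) \<subseteq> A"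
      using xt h(6) by (intro bexI[of _ x] bexI[of _ t]) auto
  qed
qed

end
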